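(* Let $\Lambda$ be a finitely aligned $k$-graph. The family $X:=\bigsqcup_{n\in\mathbb N^k}X_n$ of Hilbert bimodules over $C_0(\partial\Lambda)$, with multiplication $xy:=\pi_{m,n}(x\otimes y)$ for $x\in X_m$, $y\in X_n$, is a product system over $\mathbb N^k$.
   Context: **$k$-graphs.** $\mathbb N=\{0,1,2,\dots\}$; $\mathbb N^k$ is ordered coordinatewise and $m\vee n$ is the coordinatewise maximum. A $k$-graph is a countable category $\Lambda$ with a functor $d:\Lambda\to\mathbb N^k$ such that whenever $d(\lambda)=m+n$ there are unique $\mu,\nu\in\Lambda$ with $d(\mu)=m$, $d(\nu)=n$, $\lambda=\mu\nu$. $\Lambda^0=d^{-1}(0)$ is identified with the objects; $r,s$ are the codomain and domain maps, so $\lambda\mu$ is defined iff $s(\lambda)=r(\mu)$; $v\Lambda=\{\lambda:r(\lambda)=v\}$. For $\lambda,\mu\in\Lambda$, $\Lambda^{\min}(\lambda,\mu)=\{(\alpha,\beta):\lambda\alpha=\mu\beta,\ d(\lambda\alpha)=d(\lambda)\vee d(\mu)\}$. $\Lambda$ is finitely aligned if every $\Lambda^{\min}(\lambda,\mu)$ is finite. $E\subseteq v\Lambda$ is exhaustive if for every $\mu\in v\Lambda$ there is $\lambda\in E$ with $\Lambda^{\min}(\lambda,\mu)\ne\emptyset$; $v\mathcal{FE}(\Lambda)$ is the set of finite exhaustive subsets of $v\Lambda$. **Boundary paths.** For $m\in(\mathbb N\cup\{\infty\})^k$, $\Omega_{k,m}$ is the $k$-graph with objects $\{p\in\mathbb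 N^k:p\le m\}$, morphisms $(p,q)$ with $p\le q\le m$, $r(p,q)=p$, $s(p,q)=q$, $d(p,q)=q-p$, $(p,q)(q,t)=(p,t)$. A graph morphism is a degree-preserving functor $x:\Omega_{k,m}\to\Lambda$; $d(x)=m$, $r(x)=x(0)$. $\partial\Lambda$ is the set of graph morphisms $x$ such that for all $n\in\mathbb N^k$ with $n\le d(x)$ and all $E\in x(n)\mathcal{FE}(\Lambda)$ there is $\lambda\in E$ with $x(n,n+d(\lambda))=\lambda$. Put $D_\lambda=\{x\in\partial\Lambda:x(0,d(\lambda))=\lambda\}$ and, for finite $F\subseteq s(\lambda)\Lambda$, $D_{\lambda F}=\bigcup_{\nu\in F}D_{\lambda\nu}$. The sets $D_\lambda\setminus D_{\lambda F}$ form a basis of compact open sets for a locally compact Hausdorff topology on $\partial\Lambda$. $\partial\Lambda^{\ge n}=\{x\in\partial\Lambda:d(x)\ge n\}$ (an open subset), and $\sigma_n:\partial\Lambda^{\ge n}\to\partial\Lambda$ is the shift $\sigma_n(x)(p,q)=x(p+n,q+n)$, a local homeomorphism. **Bimodules.** Let $A=C_0(\partial\Lambda)$. If $\partial\Lambda^{\ge n}\neq\emptyset$, $X_n$ is the completion of $C_c(\partial\Lambda^{\ge n})$ for the norm given by $\langle f,g\rangle_n(x)=\sum_{\sigma_n(y)=x}\overline{f(y)}g(y)$, with right action $(f\cdot a)(x)=f(x)a(\sigma_n(x))$ and left action $(a\cdot f)(x)=a(x)f(x)$; if $\partial\Lambda^{\ge n}=\emptyset$, $X_n=\{0\}$. $X_0=A$.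 For $m,n\in\mathbb N^k$, $\pi_{m,n}:X_m\otimes_AX_n\to X_{m+n}$ is the isomorphism of Hilbert $A$-bimodules determined by $\pi_{m,n}(f\otimes g)(x)=f(x)g(\sigma_m(x))$ for $f\in C_c(\partial\Lambda^{\ge m})$, $g\in C_c(\partial\Lambda^{\ge n})$; when $\partial\Lambda^{\ge m+n}=\emptyset$, both sides are $\{0\}$ and $\pi_{m,n}$ is the trivial map. **Product system.** A product system over $\mathbb N^k$ of Hilbert $A$-bimodules is a semigroup $X=\bigsqcup_{n}X_n$ such that each $X_n$ is a Hilbert $A$-bimodule, $X_0=A$, $xy\in X_{m+n}$ for $x\in X_m,y\in X_n$, the map $x\otimes y\mapsto xy$ determines an isomorphism $X_m\otimes_AX_n\cong X_{m+n}$ for all $m,n$, and multiplication by elements of $X_0=A$ is given by the module actions: $ax=a\cdot x$, $xa=x\cdot a$. *)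

theory Defs
  imports "HOL-Analysis.Analysis" "HOL-Library.Function_Algebras" "HOL-Library.Extended_Nat"
begin

section \<open>Higher-rank graphs\<close>

text \<open>
  Degrees live in \<open>'k \<Rightarrow> nat\<close> with \<open>k = CARD('k)\<close>; order, sum, difference, zero and \<open>sup\<close> are
  the pointwise ones.  A category is given by its morphisms alone, each object being identified
  with its identity morphism, so that \<open>rng\<close> and \<open>src\<close> take values in identity morphisms.
\<close>

record ('m, 'k) kgraph_data =
  Mor :: "'m set"
  rng :: "'m \<Rightarrow> 'm"
  src :: "'m \<Rightarrow> 'm"
  cmp :: "'m \<Rightarrow> 'm \<Rightarrow> 'm"
  deg :: "'m \<Rightarrow> 'k \<Rightarrow> nat"

locale kgraph =
  fixes L :: "('m, 'k::finite) kgraph_data"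
  assumes countable_Mor: "countable (Mor L)"
    and rng_closed: "l \<in> Mor L \<Longrightarrow> rng L l \<in> Mor L"
    and src_closed: "l \<in> Mor L \<Longrightarrow> src L l \<in> Mor L"
    and rng_rng: "l \<in> Mor L \<Longrightarrow> rng L (rng L l) = rng L l"
    and src_rng: "l \<in> Mor L \<Longrightarrow> src L (rng L l) = rng L l"
    and rng_src: "l \<in> Mor L \<Longrightarrow> rng L (src L l) = src L l"
    and src_src: "l \<in> Mor L \<Longrightarrow> src L (src L l) = src L l"
    and cmp_closed: "\<lbrakk>l \<in> Mor L; m \<in> Mor L; src L l = rng L m\<rbrakk> \<Longrightarrow> cmp L l m \<in> Mor L"
    and rng_cmp: "\<lbrakk>l \<in> Mor L; m \<in> Mor L; src L l = rng L m\<rbrakk> \<Longrightarrow> rng L (cmp L l m) = rng L l"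
    and src_cmp: "\<lbrakk>l \<in> Mor L; m \<in> Mor L; src L l = rng L m\<rbrakk> \<Longrightarrow> src L (cmp L l m) = src L m"
    and cmp_assoc: "\<lbrakk>l \<in> Mor L; m \<in> Mor L; n \<in> Mor L; src L l = rng L m; src L m = rng L n\<rbrakk>
      \<Longrightarrow> cmp L (cmp L l m) n = cmp L l (cmp L m n)"
    and cmp_rng: "l \<in> Mor L \<Longrightarrow> cmp L (rng L l) l = l"
    and cmp_src: "l \<in> Mor L \<Longrightarrow> cmp L l (src L l) = l"
    and deg_rng: "l \<in> Mor L \<Longrightarrow> deg L (rng L l) = 0"
    and deg_cmp: "\<lbrakk>l \<in> Mor L; m \<in> Mor L; src L l = rng L m\<rbrakk>
      \<Longrightarrow> deg L (cmp L l m) = deg L l + deg L m"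
    and factorisation: "\<lbrakk>l \<in> Mor L; deg L l = p + q\<rbrakk>
      \<Longrightarrow> \<exists>!(\<mu>, \<nu>). \<mu> \<in> Mor L \<and> \<nu> \<in> Mor L \<and> src L \<mu> = rng L \<nu>
            \<and> deg L \<mu> = p \<and> deg L \<nu> = q \<and> l = cmp L \<mu> \<nu>"

definition from_vertex :: "('m, 'k) kgraph_data \<Rightarrow> 'm \<Rightarrow> 'm set" where
  "from_vertex L v = {l \<in> Mor L. rng L l = v}"

definition Lmin :: "('m, 'k) kgraph_data \<Rightarrow> 'm \<Rightarrow> 'm \<Rightarrow> ('m \<times> 'm) set" where
  "Lmin L l m = {(\<alpha>, \<beta>). \<alpha> \<in> from_vertex L (src L l) \<and> \<beta> \<in> from_vertex L (src L m)
      \<and> cmp L l \<alpha> = cmp L m \<beta> \<and> deg L (cmp L l \<alpha>) = sup (deg L l) (deg L m)}"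

definition finitely_aligned :: "('m, 'k) kgraph_data \<Rightarrow> bool" where
  "finitely_aligned L \<longleftrightarrow> (\<forall>l\<in>Mor L. \<forall>m\<in>Mor L. finite (Lmin L l m))"

definition exhaustive :: "('m, 'k) kgraph_data \<Rightarrow> 'm \<Rightarrow> 'm set \<Rightarrow> bool" where
  "exhaustive L v E \<longleftrightarrow> E \<subseteq> from_vertex L v
      \<and> (\<forall>m\<in>from_vertex L v. \<exists>l\<in>E. Lmin L l m \<noteq> {})"

definition FE :: "('m, 'k) kgraph_data \<Rightarrow> 'm \<Rightarrow> 'm set set" where
  "FE L v = {E. finite E \<and> exhaustive L v E}"


section \<open>Boundary paths\<close>

definition le_ext :: "('k \<Rightarrow> nat) \<Rightarrow> ('k \<Rightarrow> enat) \<Rightarrow> bool" where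
  "le_ext n m \<longleftrightarrow> (\<forall>i. enat (n i) \<le> m i)"

text \<open>In \<open>Omega m\<close> the object \<open>p\<close> is identified with the morphism \<open>(p, p)\<close>.\<close>

definition Omega :: "('k \<Rightarrow> enat) \<Rightarrow> (('k \<Rightarrow> nat) \<times> ('k \<Rightarrow> nat), 'k) kgraph_data" where
  "Omega m = \<lparr>Mor = {(p, q). p \<le> q \<and> le_ext q m},
     rng = (\<lambda>(p, q). (p, p)), src = (\<lambda>(p, q). (q, q)),
     cmp = (\<lambda>(p, q) (q', t). (p, t)), deg = (\<lambda>(p, q). q - p)\<rparr>"

text \<open>Degree-preserving functors, normalised to be \<open>undefined\<close> off the domain.\<close>

definition graph_morphism :: "('a, 'k) kgraph_data \<Rightarrow> ('m, 'k) kgraph_data \<Rightarrow> ('a \<Rightarrow> 'm) \<Rightarrow> bool" where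
  "graph_morphism G L x \<longleftrightarrow> x \<in> Mor G \<rightarrow>\<^sub>E Mor L
     \<and> (\<forall>a\<in>Mor G. x (rng G a) = rng L (x a) \<and> x (src G a) = src L (x a) \<and> deg L (x a) = deg G a)
     \<and> (\<forall>a\<in>Mor G. \<forall>b\<in>Mor G. src G a = rng G b \<longrightarrow> x (cmp G a b) = cmp L (x a) (x b))"

text \<open>A path \<open>x\<close> is the pair of its degree \<open>fst x\<close> and the functor \<open>snd x\<close> on \<open>Omega (fst x)\<close>.\<close>

type_synonym ('m, 'k) path = "('k \<Rightarrow> enat) \<times> (('k \<Rightarrow> nat) \<times> ('k \<Rightarrow> nat) \<Rightarrow> 'm)"

text \<open>\<open>has_segment L x n l\<close> says \<open>x(n, n + d(l)) = l\<close>, including that the left side is defined.\<close>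

definition has_segment :: "('m, 'k) kgraph_data \<Rightarrow> ('m, 'k) path \<Rightarrow> ('k \<Rightarrow> nat) \<Rightarrow> 'm \<Rightarrow> bool" where
  "has_segment L x n l \<longleftrightarrow> le_ext (n + deg L l) (fst x) \<and> snd x (n, n + deg L l) = l"

definition bpaths :: "('m, 'k) kgraph_data \<Rightarrow> ('m, 'k) path set" where
  "bpaths L = {x. graph_morphism (Omega (fst x)) L (snd x)
     \<and> (\<forall>n. le_ext n (fst x) \<longrightarrow> (\<forall>E\<in>FE L (snd x (n, n)). \<exists>l\<in>E. has_segment L x n l))}"

definition bpaths_ge :: "('m, 'k) kgraph_data \<Rightarrow> ('k \<Rightarrow> nat) \<Rightarrow> ('m, 'k) path set" where
  "bpaths_ge L n = {x \<in> bpaths L. le_ext n (fst x)}"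

definition shift :: "('k \<Rightarrow> nat) \<Rightarrow> ('m, 'k) path \<Rightarrow> ('m, 'k) path" where
  "shift n x = (let m = (\<lambda>i. fst x i - enat (n i)) in
     (m, restrict (\<lambda>(p, q). snd x (p + n, q + n)) (Mor (Omega m))))"

definition cyl :: "('m, 'k) kgraph_data \<Rightarrow> 'm \<Rightarrow> ('m, 'k) path set" where
  "cyl L l = {x \<in> bpaths L. has_segment L x 0 l}"

definition cyls :: "('m, 'k) kgraph_data \<Rightarrow> 'm \<Rightarrow> 'm set \<Rightarrow> ('m, 'k) path set" where
  "cyls L l F = (\<Union>\<nu>\<in>F. cyl L (cmp L l \<nu>))"

definition bpath_topology :: "('m, 'k) kgraph_data \<Rightarrow> ('m, 'k) path topology" where
  "bpath_topology L = topology_generated_by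
     {cyl L l - cyls L l F | l F. l \<in> Mor L \<and> finite F \<and> F \<subseteq> from_vertex L (src L l)}"


section \<open>C*-algebras and Hilbert bimodules\<close>

record 'e cvs =
  elts :: "'e set"
  zer :: "'e"
  add :: "'e \<Rightarrow> 'e \<Rightarrow> 'e"
  scl :: "complex \<Rightarrow> 'e \<Rightarrow> 'e"

definition dif :: "('e, 'z) cvs_scheme \<Rightarrow> 'e \<Rightarrow> 'e \<Rightarrow> 'e" where
  "dif V x y = add V x (scl V (-1) y)"

locale cvspace =
  fixes V :: "('e, 'z) cvs_scheme"
  assumes zer_closed: "zer V \<in> elts V"
    and add_closed: "\<lbrakk>x \<in> elts V; y \<in> elts V\<rbrakk> \<Longrightarrow> add V x y \<in> elts V"
    and scl_closed: "x \<in> elts V \<Longrightarrow> scl V c x \<in> elts V"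
    and add_assoc: "\<lbrakk>x \<in> elts V; y \<in> elts V; z \<in> elts V\<rbrakk>
      \<Longrightarrow> add V (add V x y) z = add V x (add V y z)"
    and add_commute: "\<lbrakk>x \<in> elts V; y \<in> elts V\<rbrakk> \<Longrightarrow> add V x y = add V y x"
    and add_zer: "x \<in> elts V \<Longrightarrow> add V x (zer V) = x"
    and add_neg: "x \<in> elts V \<Longrightarrow> dif V x x = zer V"
    and scl_add: "\<lbrakk>x \<in> elts V; y \<in> elts V\<rbrakk> \<Longrightarrow> scl V c (add V x y) = add V (scl V c x) (scl V c y)"
    and add_scl: "x \<in> elts V \<Longrightarrow> scl V (c + d) x = add V (scl V c x) (scl V d x)"
    and scl_scl: "x \<in> elts V \<Longrightarrow> scl V c (scl V d x) = scl V (c * d) x"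
    and scl_one: "x \<in> elts V \<Longrightarrow> scl V 1 x = x"

definition seq_cauchy :: "('e, 'z) cvs_scheme \<Rightarrow> ('e \<Rightarrow> real) \<Rightarrow> (nat \<Rightarrow> 'e) \<Rightarrow> bool" where
  "seq_cauchy V N u \<longleftrightarrow> (\<forall>i. u i \<in> elts V)
     \<and> (\<forall>\<epsilon>>0. \<exists>M. \<forall>i\<ge>M. \<forall>j\<ge>M. N (dif V (u i) (u j)) < \<epsilon>)"

definition seq_lim :: "('e, 'z) cvs_scheme \<Rightarrow> ('e \<Rightarrow> real) \<Rightarrow> (nat \<Rightarrow> 'e) \<Rightarrow> 'e \<Rightarrow> bool" where
  "seq_lim V N u x \<longleftrightarrow> x \<in> elts V \<and> (\<lambda>i. N (dif V (u i) x)) \<longlonglongrightarrow> 0"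

record 'a cstar_data = "'a cvs" +
  mul :: "'a \<Rightarrow> 'a \<Rightarrow> 'a"
  star :: "'a \<Rightarrow> 'a"
  nrm :: "'a \<Rightarrow> real"

locale cstar_algebra = cvspace A for A :: "('a, 'z) cstar_data_scheme" +
  assumes mul_closed: "\<lbrakk>a \<in> elts A; b \<in> elts A\<rbrakk> \<Longrightarrow> mul A a b \<in> elts A"
    and star_closed: "a \<in> elts A \<Longrightarrow> star A a \<in> elts A"
    and mul_assoc: "\<lbrakk>a \<in> elts A; b \<in> elts A; c \<in> elts A\<rbrakk>
      \<Longrightarrow> mul A (mul A a b) c = mul A a (mul A b c)"
    and mul_add: "\<lbrakk>a \<in> elts A; b \<in> elts A; c \<in> elts A\<rbrakk>
      \<Longrightarrow> mul A a (add A b c) = add A (mul A a b) (mul A a c)"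
    and add_mul: "\<lbrakk>a \<in> elts A; b \<in> elts A; c \<in> elts A\<rbrakk>
      \<Longrightarrow> mul A (add A a b) c = add A (mul A a c) (mul A b c)"
    and mul_scl: "\<lbrakk>a \<in> elts A; b \<in> elts A\<rbrakk> \<Longrightarrow> mul A a (scl A z b) = scl A z (mul A a b)"
    and scl_mul: "\<lbrakk>a \<in> elts A; b \<in> elts A\<rbrakk> \<Longrightarrow> mul A (scl A z a) b = scl A z (mul A a b)"
    and star_star: "a \<in> elts A \<Longrightarrow> star A (star A a) = a"
    and star_mul: "\<lbrakk>a \<in> elts A; b \<in> elts A\<rbrakk> \<Longrightarrow> star A (mul A a b) = mul A (star A b) (star A a)"
    and star_add: "\<lbrakk>a \<in> elts A; b \<in> elts A\<rbrakk> \<Longrightarrow> star A (add A a b) = add A (star A a) (star A b)"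
    and star_scl: "a \<in> elts A \<Longrightarrow> star A (scl A z a) = scl A (cnj z) (star A a)"
    and nrm_nonneg: "a \<in> elts A \<Longrightarrow> 0 \<le> nrm A a"
    and nrm_zero_iff: "a \<in> elts A \<Longrightarrow> nrm A a = 0 \<longleftrightarrow> a = zer A"
    and nrm_triangle: "\<lbrakk>a \<in> elts A; b \<in> elts A\<rbrakk> \<Longrightarrow> nrm A (add A a b) \<le> nrm A a + nrm A b"
    and nrm_scl: "a \<in> elts A \<Longrightarrow> nrm A (scl A z a) = cmod z * nrm A a"
    and nrm_mul: "\<lbrakk>a \<in> elts A; b \<in> elts A\<rbrakk> \<Longrightarrow> nrm A (mul A a b) \<le> nrm A a * nrm A b"
    and cstar_identity: "a \<in> elts A \<Longrightarrow> nrm A (mul A (star A a) a) = (nrm A a)\<^sup>2"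
    and nrm_complete: "seq_cauchy A (nrm A) u \<Longrightarrow> \<exists>a. seq_lim A (nrm A) u a"

definition positive :: "('a, 'z) cstar_data_scheme \<Rightarrow> 'a \<Rightarrow> bool" where
  "positive A a \<longleftrightarrow> (\<exists>b\<in>elts A. a = mul A (star A b) b)"

record ('a, 'e) hbimod = "'e cvs" +
  ainner :: "'e \<Rightarrow> 'e \<Rightarrow> 'a"
  ract :: "'e \<Rightarrow> 'a \<Rightarrow> 'e"
  lact :: "'a \<Rightarrow> 'e \<Rightarrow> 'e"

definition hnorm :: "('a, 'z) cstar_data_scheme \<Rightarrow> ('a, 'e) hbimod \<Rightarrow> 'e \<Rightarrow> real" where
  "hnorm A E x = sqrt (nrm A (ainner E x x))"

text \<open>
  A Hilbert \<open>A\<close>-bimodule is a right Hilbert \<open>A\<close>-module together with a left action of \<open>A\<close> by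
  adjointable operators, i.e. a *-homomorphism of \<open>A\<close> into the adjointable operators
  (the axiom \<open>inner_lact\<close> says that the adjoint of the action of \<open>a\<close> is the action of \<open>a*\<close>).
\<close>

locale hilbert_bimodule = cstar_algebra A + cvspace E
  for A :: "('a, 'z) cstar_data_scheme" and E :: "('a, 'e) hbimod" +
  assumes ract_closed: "\<lbrakk>x \<in> elts E; a \<in> elts A\<rbrakk> \<Longrightarrow> ract E x a \<in> elts E"
    and ract_mul: "\<lbrakk>x \<in> elts E; a \<in> elts A; b \<in> elts A\<rbrakk>
      \<Longrightarrow> ract E x (mul A a b) = ract E (ract E x a) b"
    and ract_add: "\<lbrakk>x \<in> elts E; a \<in> elts A; b \<in> elts A\<rbrakk>
      \<Longrightarrow> ract E x (add A a b) = add E (ract E x a) (ract E x b)"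
    and add_ract: "\<lbrakk>x \<in> elts E; y \<in> elts E; a \<in> elts A\<rbrakk>
      \<Longrightarrow> ract E (add E x y) a = add E (ract E x a) (ract E y a)"
    and ract_scl: "\<lbrakk>x \<in> elts E; a \<in> elts A\<rbrakk> \<Longrightarrow> ract E x (scl A z a) = scl E z (ract E x a)"
    and scl_ract: "\<lbrakk>x \<in> elts E; a \<in> elts A\<rbrakk> \<Longrightarrow> ract E (scl E z x) a = scl E z (ract E x a)"
    and inner_closed: "\<lbrakk>x \<in> elts E; y \<in> elts E\<rbrakk> \<Longrightarrow> ainner E x y \<in> elts A"
    and inner_add: "\<lbrakk>x \<in> elts E; y \<in> elts E; w \<in> elts E\<rbrakk>
      \<Longrightarrow> ainner E x (add E y w) = add A (ainner E x y) (ainner E x w)"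
    and inner_scl: "\<lbrakk>x \<in> elts E; y \<in> elts E\<rbrakk> \<Longrightarrow> ainner E x (scl E z y) = scl A z (ainner E x y)"
    and inner_ract: "\<lbrakk>x \<in> elts E; y \<in> elts E; a \<in> elts A\<rbrakk>
      \<Longrightarrow> ainner E x (ract E y a) = mul A (ainner E x y) a"
    and inner_star: "\<lbrakk>x \<in> elts E; y \<in> elts E\<rbrakk> \<Longrightarrow> star A (ainner E x y) = ainner E y x"
    and inner_positive: "x \<in> elts E \<Longrightarrow> positive A (ainner E x x)"
    and inner_definite: "\<lbrakk>x \<in> elts E; ainner E x x = zer A\<rbrakk> \<Longrightarrow> x = zer E"
    and hnorm_complete: "seq_cauchy E (hnorm A E) u \<Longrightarrow> \<exists>x. seq_lim E (hnorm A E) u x"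
    and lact_closed: "\<lbrakk>a \<in> elts A; x \<in> elts E\<rbrakk> \<Longrightarrow> lact E a x \<in> elts E"
    and lact_mul: "\<lbrakk>a \<in> elts A; b \<in> elts A; x \<in> elts E\<rbrakk>
      \<Longrightarrow> lact E (mul A a b) x = lact E a (lact E b x)"
    and add_lact: "\<lbrakk>a \<in> elts A; b \<in> elts A; x \<in> elts E\<rbrakk>
      \<Longrightarrow> lact E (add A a b) x = add E (lact E a x) (lact E b x)"
    and scl_lact: "\<lbrakk>a \<in> elts A; x \<in> elts E\<rbrakk> \<Longrightarrow> lact E (scl A z a) x = scl E z (lact E a x)"
    and lact_add: "\<lbrakk>a \<in> elts A; x \<in> elts E; y \<in> elts E\<rbrakk>
      \<Longrightarrow> lact E a (add E x y) = add E (lact E a x) (lact E a y)"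
    and lact_scl: "\<lbrakk>a \<in> elts A; x \<in> elts E\<rbrakk> \<Longrightarrow> lact E a (scl E z x) = scl E z (lact E a x)"
    and lact_ract: "\<lbrakk>a \<in> elts A; x \<in> elts E; b \<in> elts A\<rbrakk>
      \<Longrightarrow> lact E a (ract E x b) = ract E (lact E a x) b"
    and inner_lact: "\<lbrakk>a \<in> elts A; x \<in> elts E; y \<in> elts E\<rbrakk>
      \<Longrightarrow> ainner E (lact E a x) y = ainner E x (lact E (star A a) y)"

definition hb_iso ::
  "('a, 'z) cstar_data_scheme \<Rightarrow> ('a, 'e) hbimod \<Rightarrow> ('a, 'f) hbimod \<Rightarrow> ('e \<Rightarrow> 'f) \<Rightarrow> bool" where
  "hb_iso A E F \<Phi> \<longleftrightarrow> bij_betw \<Phi> (elts E) (elts F)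
     \<and> (\<forall>x\<in>elts E. \<forall>y\<in>elts E. \<Phi> (add E x y) = add F (\<Phi> x) (\<Phi> y)
          \<and> ainner F (\<Phi> x) (\<Phi> y) = ainner E x y)
     \<and> (\<forall>x\<in>elts E. \<forall>c. \<Phi> (scl E c x) = scl F c (\<Phi> x))
     \<and> (\<forall>x\<in>elts E. \<forall>a\<in>elts A. \<Phi> (ract E x a) = ract F (\<Phi> x) a
          \<and> \<Phi> (lact E a x) = lact F a (\<Phi> x))"

text \<open>\<open>A\<close> as a Hilbert bimodule over itself.\<close>

definition self_bimod :: "('a, 'z) cstar_data_scheme \<Rightarrow> ('a, 'a) hbimod" where
  "self_bimod A = \<lparr>elts = elts A, zer = zer A, add = add A, scl = scl A,
     ainner = (\<lambda>a b. mul A (star A a) b), ract = mul A, lact = mul A\<rparr>"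


section \<open>The internal tensor product\<close>

text \<open>
  Hausdorff completion of a semi-inner-product bimodule \<open>P\<close>: Cauchy sequences for the seminorm
  \<open>hnorm A P\<close>, modulo sequences at distance tending to zero.  The operations are evaluated on
  representatives, inner products being limits in \<open>A\<close>.
\<close>

definition cls :: "('a, 'z) cstar_data_scheme \<Rightarrow> ('a, 'e) hbimod \<Rightarrow> (nat \<Rightarrow> 'e) \<Rightarrow> (nat \<Rightarrow> 'e) set" where
  "cls A P u = {v. seq_cauchy P (hnorm A P) v \<and> (\<lambda>i. hnorm A P (dif P (u i) (v i))) \<longlonglongrightarrow> 0}"

definition rep :: "(nat \<Rightarrow> 'e) set \<Rightarrow> nat \<Rightarrow> 'e" where
  "rep U = (SOME u. u \<in> U)"

definition completion ::
  "('a, 'z) cstar_data_scheme \<Rightarrow> ('a, 'e) hbimod \<Rightarrow> ('a, (nat \<Rightarrow> 'e) set) hbimod" where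
  "completion A P = \<lparr>elts = cls A P ` {u. seq_cauchy P (hnorm A P) u},
     zer = cls A P (\<lambda>i. zer P),
     add = (\<lambda>U V. cls A P (\<lambda>i. add P (rep U i) (rep V i))),
     scl = (\<lambda>c U. cls A P (\<lambda>i. scl P c (rep U i))),
     ainner = (\<lambda>U V. THE a. seq_lim A (nrm A) (\<lambda>i. ainner P (rep U i) (rep V i)) a),
     ract = (\<lambda>U a. cls A P (\<lambda>i. ract P (rep U i) a)),
     lact = (\<lambda>a U. cls A P (\<lambda>i. lact P a (rep U i)))\<rparr>"

text \<open>
  A list \<open>[(x\<^sub>1, y\<^sub>1), \<dots>, (x\<^sub>r, y\<^sub>r)]\<close> stands for \<open>x\<^sub>1 \<otimes> y\<^sub>1 + \<dots> + x\<^sub>r \<otimes> y\<^sub>r\<close>, with the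
  semi-inner product determined by \<open>\<langle>x \<otimes> y, x' \<otimes> y'\<rangle> = \<langle>y, \<langle>x, x'\<rangle> \<cdot> y'\<rangle>\<close>.  Two lists that
  represent the same element of the algebraic balanced tensor product over \<open>A\<close> differ by an
  element of length zero, so they are identified in the Hausdorff completion \<open>tensor A E F\<close>, which
  is therefore the usual internal tensor product.
\<close>

definition formal_tensors ::
  "('a, 'z) cstar_data_scheme \<Rightarrow> ('a, 'e) hbimod \<Rightarrow> ('a, 'f) hbimod \<Rightarrow> ('a, ('e \<times> 'f) list) hbimod" where
  "formal_tensors A E F = \<lparr>elts = lists (elts E \<times> elts F), zer = [], add = (@),
     scl = (\<lambda>c. map (\<lambda>(x, y). (scl E c x, y))),
     ainner = (\<lambda>us vs. foldr (add A)
        [ainner F y (lact F (ainner E x x') y'). (x, y) \<leftarrow> us, (x', y') \<leftarrow> vs] (zer A)),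
     ract = (\<lambda>us a. map (\<lambda>(x, y). (x, ract F y a)) us),
     lact = (\<lambda>a. map (\<lambda>(x, y). (lact E a x, y)))\<rparr>"

definition tensor ::
  "('a, 'z) cstar_data_scheme \<Rightarrow> ('a, 'e) hbimod \<Rightarrow> ('a, 'f) hbimod
    \<Rightarrow> ('a, (nat \<Rightarrow> ('e \<times> 'f) list) set) hbimod" where
  "tensor A E F = completion A (formal_tensors A E F)"

definition elem_tensor ::
  "('a, 'z) cstar_data_scheme \<Rightarrow> ('a, 'e) hbimod \<Rightarrow> ('a, 'f) hbimod
    \<Rightarrow> 'e \<Rightarrow> 'f \<Rightarrow> (nat \<Rightarrow> ('e \<times> 'f) list) set" where
  "elem_tensor A E F x y = cls A (formal_tensors A E F) (\<lambda>i. [(x, y)])"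


section \<open>Product systems\<close>

text \<open>
  The disjoint union of the \<open>X n\<close> is the set of pairs \<open>(n, x)\<close> with \<open>x\<close> in \<open>X n\<close>.  The equality
  \<open>X\<^sub>0 = A\<close> is an equality of Hilbert bimodules: the identity map is an isomorphism from \<open>A\<close> to
  \<open>X 0\<close>, in particular both have the same elements.
\<close>

definition graded :: "('p \<Rightarrow> ('a, 'e) hbimod) \<Rightarrow> ('p \<times> 'e) set" where
  "graded X = Sigma UNIV (\<lambda>n. elts (X n))"

locale product_system =
  fixes A :: "('a, 'z) cstar_data_scheme"
    and X :: "('k::finite \<Rightarrow> nat) \<Rightarrow> ('a, 'a) hbimod"
    and mult :: "('k \<Rightarrow> nat) \<times> 'a \<Rightarrow> ('k \<Rightarrow> nat) \<times> 'a \<Rightarrow> ('k \<Rightarrow> nat) \<times> 'a"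
  assumes bimodules: "hilbert_bimodule A (X n)"
    and X_zero: "hb_iso A (self_bimod A) (X 0) id"
    and mult_closed: "\<lbrakk>\<xi> \<in> graded X; \<eta> \<in> graded X\<rbrakk> \<Longrightarrow> mult \<xi> \<eta> \<in> graded X"
    and mult_assoc: "\<lbrakk>\<xi> \<in> graded X; \<eta> \<in> graded X; \<zeta> \<in> graded X\<rbrakk>
      \<Longrightarrow> mult (mult \<xi> \<eta>) \<zeta> = mult \<xi> (mult \<eta> \<zeta>)"
    and mult_degree: "\<lbrakk>x \<in> elts (X m); y \<in> elts (X n)\<rbrakk> \<Longrightarrow> fst (mult (m, x) (n, y)) = m + n"
    and mult_tensor: "\<exists>\<Phi>. hb_iso A (tensor A (X m) (X n)) (X (m + n)) \<Phi>
      \<and> (\<forall>x\<in>elts (X m). \<forall>y\<in>elts (X n).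
            \<Phi> (elem_tensor A (X m) (X n) x y) = snd (mult (m, x) (n, y)))"
    and mult_left: "\<lbrakk>a \<in> elts A; x \<in> elts (X n)\<rbrakk> \<Longrightarrow> mult (0, a) (n, x) = (n, lact (X n) a x)"
    and mult_right: "\<lbrakk>x \<in> elts (X n); a \<in> elts A\<rbrakk> \<Longrightarrow> mult (n, x) (0, a) = (n, ract (X n) x a)"


section \<open>The bimodules of a finitely aligned k-graph\<close>

text \<open>
  Functions on a subset of the space of a topology are extended by zero to the whole type; in
  particular the supremum in \<open>nrm\<close> below is the one over the space of \<open>T\<close>.
\<close>

definition C0 :: "'x topology \<Rightarrow> ('x \<Rightarrow> complex) cstar_data" where
  "C0 T = \<lparr>elts = {a. continuous_map T euclidean a \<and> (\<forall>x. x \<notin> topspace T \<longrightarrow> a x = 0)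
        \<and> (\<forall>\<epsilon>>0. compactin T {x \<in> topspace T. \<epsilon> \<le> cmod (a x)})},
     zer = (\<lambda>x. 0), add = (\<lambda>a b x. a x + b x), scl = (\<lambda>c a x. c * a x),
     mul = (\<lambda>a b x. a x * b x), star = (\<lambda>a x. cnj (a x)), nrm = (\<lambda>a. SUP x. cmod (a x))\<rparr>"

definition Cc :: "'x topology \<Rightarrow> ('x \<Rightarrow> complex) set" where
  "Cc T = {f. continuous_map T euclidean f \<and> (\<forall>x. x \<notin> topspace T \<longrightarrow> f x = 0)
      \<and> compactin T (T closure_of {x \<in> topspace T. f x \<noteq> 0})}"

definition Cc_ge :: "('m, 'k) kgraph_data \<Rightarrow> ('k \<Rightarrow> nat) \<Rightarrow> (('m, 'k) path \<Rightarrow> complex) set" where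
  "Cc_ge L n = Cc (subtopology (bpath_topology L) (bpaths_ge L n))"

definition fibre :: "('m, 'k) kgraph_data \<Rightarrow> ('k \<Rightarrow> nat) \<Rightarrow> ('m, 'k) path \<Rightarrow> ('m, 'k) path set" where
  "fibre L n x = {y \<in> bpaths_ge L n. shift n y = x}"

text \<open>
  \<open>norm_le L n f c\<close> says \<open>\<parallel>f\<parallel>\<^sub>n \<le> c\<close> for \<open>\<parallel>f\<parallel>\<^sub>n\<^sup>2 = sup\<^sub>x \<Sum>\<^bsub>shift n y = x\<^esub> |f y|\<^sup>2\<close>,
  for an arbitrary function \<open>f\<close> (whose norm may be infinite).
\<close>

definition norm_le ::
  "('m, 'k) kgraph_data \<Rightarrow> ('k \<Rightarrow> nat) \<Rightarrow> (('m, 'k) path \<Rightarrow> complex) \<Rightarrow> real \<Rightarrow> bool" where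
  "norm_le L n f c \<longleftrightarrow> (\<forall>x S. finite S \<longrightarrow> S \<subseteq> fibre L n x \<longrightarrow> (\<Sum>y\<in>S. (cmod (f y))\<^sup>2) \<le> c\<^sup>2)"

text \<open>
  The functions of finite norm that vanish off \<open>bpaths_ge L n\<close> form a Banach space, and the
  completion of \<open>Cc_ge L n\<close> is realised as its closure in that space.  Elements
  of \<open>X\<^sub>n\<close> are thus functions on which the continuous extensions of the inner product and of
  the actions are given by the same formulas as on \<open>Cc_ge L n\<close>, the sums over fibres now being
  possibly infinite but absolutely convergent.
\<close>

definition Xmod :: "('m, 'k) kgraph_data \<Rightarrow> ('k \<Rightarrow> nat)
    \<Rightarrow> (('m, 'k) path \<Rightarrow> complex, ('m, 'k) path \<Rightarrow> complex) hbimod" where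
  "Xmod L n = \<lparr>elts = {f. (\<forall>x. x \<notin> bpaths_ge L n \<longrightarrow> f x = 0)
        \<and> (\<forall>\<epsilon>>0. \<exists>g\<in>Cc_ge L n. norm_le L n (\<lambda>y. f y - g y) \<epsilon>)},
     zer = (\<lambda>x. 0), add = (\<lambda>f g x. f x + g x), scl = (\<lambda>c f x. c * f x),
     ainner = (\<lambda>f g x. \<Sum>\<^sub>\<infinity>y\<in>fibre L n x. cnj (f y) * g y),
     ract = (\<lambda>f a x. f x * a (shift n x)),
     lact = (\<lambda>a f x. a x * f x)\<rparr>"

lemma norm_le_triangle:
  assumes "norm_le L n f a" "norm_le L n g b" "0 \<le> a" "0 \<le> b"
  shows "norm_le L n (\<lambda>y. f y + g y) (a + b)"
  unfolding norm_le_def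
proof (intro allI impI)
  fix x S assume S: "finite S" "S \<subseteq> fibre L n x"
  have "L2_set (\<lambda>y. cmod (f y + g y)) S \<le> L2_set (\<lambda>y. cmod (f y) + cmod (g y)) S"
    by (intro L2_set_mono norm_triangle_ineq) auto
  also have "\<dots> \<le> L2_set (\<lambda>y. cmod (f y)) S + L2_set (\<lambda>y. cmod (g y)) S"
    by (rule L2_set_triangle_ineq)
  also have "\<dots> \<le> a + b"
    using assms S unfolding norm_le_def L2_set_def by (intro add_mono real_le_lsqrt) blast+
  finally have "(L2_set (\<lambda>y. cmod (f y + g y)) S)\<^sup>2 \<le> (a + b)\<^sup>2"
    by (intro power_mono) auto
  then show "(\<Sum>y\<in>S. (cmod (f y + g y))\<^sup>2) \<le> (a + b)\<^sup>2"
    by (simp add: L2_set_def sum_nonneg)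
qed

text \<open>\<open>Cc_ge L n\<close> is dense in \<open>X\<^sub>n\<close> by definition; \<open>X\<^sub>n\<close> is complete.\<close>

lemma Xmod_complete:
  fixes u :: "nat \<Rightarrow> ('m, 'k) path \<Rightarrow> complex"
  assumes u: "\<And>i. u i \<in> elts (Xmod L n)"
    and cauchy: "\<And>\<epsilon>. \<epsilon> > 0 \<Longrightarrow> \<exists>M. \<forall>i\<ge>M. \<forall>j\<ge>M. norm_le L n (\<lambda>y. u i y - u j y) \<epsilon>"
  shows "\<exists>f\<in>elts (Xmod L n). \<forall>\<epsilon>>0. \<exists>M. \<forall>i\<ge>M. norm_le L n (\<lambda>y. u i y - f y) \<epsilon>"
proof -
  have conv: "convergent (\<lambda>i. u i y)" for y
  proof (cases "y \<in> bpaths_ge L n")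
    case False
    then have "u i y = 0" for i using u[of i] by (cases y) (simp add: Xmod_def)
    then show ?thesis by (simp add: convergent_const)
  next
    case True
    have "Cauchy (\<lambda>i. u i y)"
    proof (rule metric_CauchyI)
      fix e :: real assume "e > 0"
      then obtain M where M: "\<And>i j. i \<ge> M \<Longrightarrow> j \<ge> M \<Longrightarrow> norm_le L n (\<lambda>y. u i y - u j y) (e/2)"
        using cauchy[of "e/2"] by auto
      have "dist (u i y) (u j y) < e" if "i \<ge> M" "j \<ge> M" for i j
      proof -
        have "finite {y}" "{y} \<subseteq> fibre L n (shift n y)" using True by (auto simp: fibre_def)
        then have "(\<Sum>y\<in>{y}. (cmod (u i y - u j y))\<^sup>2) \<le> (e/2)\<^sup>2"
          using M[OF that] unfolding norm_le_def by blast
        then have "cmod (u i y - u j y) \<le> e/2"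
          using \<open>e > 0\<close> by (simp add: power2_le_iff_abs_le)
        then show ?thesis using \<open>e > 0\<close> by (simp add: dist_norm)
      qed
      then show "\<exists>M. \<forall>i\<ge>M. \<forall>j\<ge>M. dist (u i y) (u j y) < e" by blast
    qed
    then show ?thesis by (rule Cauchy_convergent)
  qed
  define f where "f y = lim (\<lambda>i. u i y)" for y
  have lim: "(\<lambda>i. u i y) \<longlonglongrightarrow> f y" for y
    using conv[of y] by (simp add: f_def convergent_LIMSEQ_iff)
  have close: "\<exists>M. \<forall>i\<ge>M. norm_le L n (\<lambda>y. u i y - f y) \<epsilon>" if "\<epsilon> > 0" for \<epsilon>
  proof -
    obtain M where M: "\<And>i j. i \<ge> M \<Longrightarrow> j \<ge> M \<Longrightarrow> norm_le L n (\<lambda>y. u i y - u j y) \<epsilon>"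
      using cauchy[OF \<open>\<epsilon> > 0\<close>] by auto
    have "norm_le L n (\<lambda>y. u i y - f y) \<epsilon>" if "i \<ge> M" for i
      unfolding norm_le_def
    proof (intro allI impI)
      fix x S assume S: "finite S" "S \<subseteq> fibre L n x"
      have "(\<lambda>j. \<Sum>y\<in>S. (cmod (u i y - u j y))\<^sup>2) \<longlonglongrightarrow> (\<Sum>y\<in>S. (cmod (u i y - f y))\<^sup>2)"
        by (intro tendsto_intros lim)
      moreover have "\<forall>j\<ge>M. (\<Sum>y\<in>S. (cmod (u i y - u j y))\<^sup>2) \<le> \<epsilon>\<^sup>2"
        using M[OF that] S unfolding norm_le_def by blast
      ultimately show "(\<Sum>y\<in>S. (cmod (u i y - f y))\<^sup>2) \<le> \<epsilon>\<^sup>2"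
        by (blast intro: LIMSEQ_le_const2)
    qed
    then show ?thesis by blast
  qed
  have "f \<in> elts (Xmod L n)"
  proof -
    have "f y = 0" if "y \<notin> bpaths_ge L n" for y
    proof -
      have "u i y = 0" for i using u[of i] that by (cases y) (simp add: Xmod_def)
      then show ?thesis using lim[of y] by (simp add: LIMSEQ_const_iff)
    qed
    moreover have "\<exists>g\<in>Cc_ge L n. norm_le L n (\<lambda>y. f y - g y) \<epsilon>" if "\<epsilon> > 0" for \<epsilon>
    proof -
      obtain i where i: "norm_le L n (\<lambda>y. u i y - f y) (\<epsilon>/2)"
        using close[of "\<epsilon>/2"] \<open>\<epsilon> > 0\<close> by auto
      have "\<forall>\<delta>>0. \<exists>g\<in>Cc_ge L n. norm_le L n (\<lambda>y. u i y - g y) \<delta>"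
        using u[of i] by (simp add: Xmod_def)
      then obtain g where g: "g \<in> Cc_ge L n" "norm_le L n (\<lambda>y. u i y - g y) (\<epsilon>/2)"
        using half_gt_zero[OF \<open>\<epsilon> > 0\<close>] by blast
      have fu: "norm_le L n (\<lambda>y. f y - u i y) (\<epsilon>/2)"
        using i unfolding norm_le_def norm_minus_commute[of "f _"] .
      have "norm_le L n (\<lambda>y. (f y - u i y) + (u i y - g y)) (\<epsilon>/2 + \<epsilon>/2)"
        using \<open>\<epsilon> > 0\<close> by (intro norm_le_triangle[OF fu g(2)]) simp_all
      then have "norm_le L n (\<lambda>y. f y - g y) \<epsilon>" by simp
      with g(1) show ?thesis by blast
    qed
    ultimately show ?thesis unfolding Xmod_def by simp
  qed
  with close show ?thesis by blast
qed

definition Xpi :: "('m, 'k) kgraph_data \<Rightarrow> ('k \<Rightarrow> nat) \<Rightarrow> ('k \<Rightarrow> nat)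
    \<Rightarrow> (nat \<Rightarrow> ((('m, 'k) path \<Rightarrow> complex) \<times> (('m, 'k) path \<Rightarrow> complex)) list) set
    \<Rightarrow> ('m, 'k) path \<Rightarrow> complex" where
  "Xpi L m n = (let A = C0 (bpath_topology L) in
     SOME \<Phi>. hb_iso A (tensor A (Xmod L m) (Xmod L n)) (Xmod L (m + n)) \<Phi>
       \<and> (\<forall>f\<in>Cc_ge L m. \<forall>g\<in>Cc_ge L n.
            \<Phi> (elem_tensor A (Xmod L m) (Xmod L n) f g) = (\<lambda>x. f x * g (shift m x))))"

definition Xmult :: "('m, 'k) kgraph_data
    \<Rightarrow> ('k \<Rightarrow> nat) \<times> (('m, 'k) path \<Rightarrow> complex) \<Rightarrow> ('k \<Rightarrow> nat) \<times> (('m, 'k) path \<Rightarrow> complex)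
    \<Rightarrow> ('k \<Rightarrow> nat) \<times> (('m, 'k) path \<Rightarrow> complex)" where
  "Xmult L = (\<lambda>(m, f) (n, g). (m + n,
     Xpi L m n (elem_tensor (C0 (bpath_topology L)) (Xmod L m) (Xmod L n) f g)))"

end

theory Submission
  imports Defs
begin

text \<open>
  For \<open>d(\<lambda>) = n\<close> the shift \<open>\<sigma>\<^sub>n\<close> restricts to a homeomorphism from the clopen set \<open>D\<^sub>\<lambda>\<close> onto the
  clopen set \<open>D\<^bsub>s(\<lambda>)\<^esub>\<close>, with inverse \<open>x \<mapsto> \<lambda>x\<close>; this is where finite alignment enters.  Hence the inner
  product of two compactly supported functions is a finite sum of continuous functions, and the
  general case follows by uniform approximation.  The map \<open>f \<otimes> g \<mapsto> f \<cdot> (g \<circ> \<sigma>\<^sub>m)\<close> preserves inner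
  products, because a sum over a fibre of \<open>\<sigma>\<^bsub>m+n\<^esub> = \<sigma>\<^sub>n \<circ> \<sigma>\<^sub>m\<close> is an iterated sum.  Its range is dense,
  because a compactly supported \<open>h\<close> that vanishes off some \<open>D\<^sub>\<lambda>\<close> with \<open>d(\<lambda>) = m\<close> is itself the product
  of \<open>h / \<bar>h\<bar>\<^sup>1\<^sup>/\<^sup>2\<close> and \<open>y \<mapsto> \<bar>h(\<lambda>y)\<bar>\<^sup>1\<^sup>/\<^sup>2\<close>.  An isomorphism that has this form on compactly supported
  functions has it on all of \<open>X\<^sub>m \<times> X\<^sub>n\<close>, and associativity is then \<open>\<sigma>\<^sub>n \<circ> \<sigma>\<^sub>m = \<sigma>\<^bsub>m+n\<^esub>\<close>.
\<close>

section \<open>Paths in higher-rank graphs\<close>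

text \<open>Finite alignment acts at two points of the local inverse x -> lx: it keeps transported
  exhaustive sets finite, so that lx is again a boundary path, and it makes the preimage of a
  cylinder a finite union of cylinders, hence clopen. Elements of X_n are functions whose fibre sums
  may be infinite. Estimates are therefore made on finite partial sums, in the form of
  \<open>norm_le\<close>; compactly supported functions enter through approximation in this norm.
  The internal tensor product is a completion of formal lists. It is reached through an
  inner-product preserving map with dense range into a space that is already complete, so that its
  elements become limits of concrete functions and lists at distance zero get the same limit. The
  map \<open>Xpi\<close> is a choice among isomorphisms that are prescribed on compactly supported
  functions only. One such isomorphism is constructed; the value of the chosen one elsewhere is then
  read off from inner products with products of compactly supported functions. These detect every
  nonzero element, because a cutoff to a cylinder isolates a single point of a fibre.\<close>

lemma le_ext_mono: "le_ext n m \<Longrightarrow> p \<le> n \<Longrightarrow> le_ext p m"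
  unfolding le_ext_def le_fun_def by (meson enat_ord_simps(1) order_trans)

lemma le_ext_sup: "le_ext p m \<Longrightarrow> le_ext q m \<Longrightarrow> le_ext (sup p q) m"
  unfolding le_ext_def by (simp add: sup_max max_def)

lemma le_ext_0 [simp]: "le_ext 0 m"
  by (simp add: le_ext_def flip: zero_enat_def)

text \<open>Subtraction in \<open>enat\<close> truncates at 0: for \<open>m i < n i\<close> and
  \<open>p i = 0\<close> the right side would hold at i and the left side fail. The premise excludes
  this.\<close>

lemma le_ext_add_iff:
  assumes "le_ext n m"
  shows "le_ext (n + p) m \<longleftrightarrow> le_ext p (\<lambda>i. m i - enat (n i))"
proof -
  have "enat (n i + p i) \<le> m i \<longleftrightarrow> enat (p i) \<le> m i - enat (n i)" for i
    using assms unfolding le_ext_def by (cases "m i") (auto dest: spec[of _ i])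
  then show ?thesis by (simp add: le_ext_def)
qed

text \<open>Testing with multiples of a unit vector reduces this to one coordinate. There a finite
  value is separated from every larger one, infinity included, by its successor.\<close>

lemma le_ext_inject:
  assumes "\<And>n. le_ext n m \<longleftrightarrow> le_ext n m'"
  shows "m = m'"
proof
  fix i
  have *: "enat j \<le> m i \<longleftrightarrow> enat j \<le> m' i" for j
    using assms[of "\<lambda>i'. if i' = i then j else 0"]
    by (auto simp: le_ext_def zero_enat_def[symmetric] dest: spec[of _ i] split: if_splits)
  show "m i = m' i"
    using *[of "the_enat (m i)"] *[of "Suc (the_enat (m i))"] *[of "Suc (the_enat (m' i))"]
    by (cases "m i"; cases "m' i") auto
qed

lemma add_diff_fun [simp]: "p \<le> q \<Longrightarrow> p + (q - p) = (q :: 'k \<Rightarrow> nat)"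
  by (rule ext) (simp add: le_fun_def)

lemma le_add_fun [simp]: "p \<le> p + (q :: 'k \<Rightarrow> nat)"  "p \<le> q + (p :: 'k \<Rightarrow> nat)"
  by (simp_all add: le_fun_def)

lemma add_fun_le_iff [simp]:
  "p + n \<le> q + n \<longleftrightarrow> p \<le> (q :: 'k \<Rightarrow> nat)"  "n + p \<le> n + q \<longleftrightarrow> p \<le> (q :: 'k \<Rightarrow> nat)"
  by (simp_all add: le_fun_def)

lemma zero_fun_le [simp]: "0 \<le> (p :: 'k \<Rightarrow> nat)"
  by (simp add: le_fun_def)

context kgraph
begin

section \<open>Factorisation of morphisms\<close>

lemma deg_src: "l \<in> Mor L \<Longrightarrow> deg L (src L l) = 0"
  by (metis deg_rng rng_src src_closed)

text \<open>The axiom compares factorisations in which both degrees are prescribed. Here only the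
  first degree is given; cancellation in the total degree supplies the second.\<close>

lemma factorisation_unique:
  assumes "\<mu> \<in> Mor L" "\<nu> \<in> Mor L" "src L \<mu> = rng L \<nu>"
    and "\<mu>' \<in> Mor L" "\<nu>' \<in> Mor L" "src L \<mu>' = rng L \<nu>'"
    and eq: "cmp L \<mu> \<nu> = cmp L \<mu>' \<nu>'" and d: "deg L \<mu> = deg L \<mu>'"
  shows "\<mu> = \<mu>'" "\<nu> = \<nu>'"
proof -
  have "deg L (cmp L \<mu> \<nu>) = deg L \<mu> + deg L \<nu>" "deg L (cmp L \<mu> \<nu>) = deg L \<mu>' + deg L \<nu>'"
    using deg_cmp[OF assms(1-3)] deg_cmp[OF assms(4-6)] eq by simp_all
  then have d': "deg L \<nu> = deg L \<nu>'" by (metis add_left_cancel d)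
  let ?Q = "\<lambda>(\<mu>1, \<nu>1). \<mu>1 \<in> Mor L \<and> \<nu>1 \<in> Mor L \<and> src L \<mu>1 = rng L \<nu>1
            \<and> deg L \<mu>1 = deg L \<mu> \<and> deg L \<nu>1 = deg L \<nu> \<and> cmp L \<mu> \<nu> = cmp L \<mu>1 \<nu>1"
  have ex: "\<exists>!z. ?Q z"
    using assms(1-3) deg_cmp[OF assms(1-3)] by (intro factorisation) (simp_all add: cmp_closed)
  have "?Q (\<mu>, \<nu>)" using assms(1-3) by simp
  moreover have "?Q (\<mu>', \<nu>')" using assms(4-6) eq d d' by simp
  ultimately have "(\<mu>, \<nu>) = (\<mu>', \<nu>')"
    by (rule trans[OF the1_equality[OF ex, symmetric] the1_equality[OF ex]])
  then show "\<mu> = \<mu>'" "\<nu> = \<nu>'" by simp_all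
qed

text \<open>In path notation \<open>init l p\<close> is l(0, p) and \<open>final l p\<close> is l(p,
  d(l)), for p below d(l). The second choice refers to the first, so that the two pieces compose to
  l.\<close>

definition init :: "'m \<Rightarrow> ('k \<Rightarrow> nat) \<Rightarrow> 'm" where
  "init l p = (SOME \<mu>. \<mu> \<in> Mor L \<and> deg L \<mu> = p
     \<and> (\<exists>\<nu>\<in>Mor L. src L \<mu> = rng L \<nu> \<and> l = cmp L \<mu> \<nu>))"

definition final :: "'m \<Rightarrow> ('k \<Rightarrow> nat) \<Rightarrow> 'm" where
  "final l p = (SOME \<nu>. \<nu> \<in> Mor L \<and> src L (init l p) = rng L \<nu> \<and> l = cmp L (init l p) \<nu>)"

lemma
  assumes "l \<in> Mor L" "p \<le> deg L l"
  shows init_closed: "init l p \<in> Mor L" and deg_init: "deg L (init l p) = p"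
    and final_closed: "final l p \<in> Mor L" and rng_final: "rng L (final l p) = src L (init l p)"
    and init_final: "cmp L (init l p) (final l p) = l"
proof -
  have "\<exists>!(\<mu>, \<nu>). \<mu> \<in> Mor L \<and> \<nu> \<in> Mor L \<and> src L \<mu> = rng L \<nu>
            \<and> deg L \<mu> = p \<and> deg L \<nu> = deg L l - p \<and> l = cmp L \<mu> \<nu>"
    using assms by (intro factorisation) simp_all
  then have "\<exists>\<mu>. \<mu> \<in> Mor L \<and> deg L \<mu> = p \<and> (\<exists>\<nu>\<in>Mor L. src L \<mu> = rng L \<nu> \<and> l = cmp L \<mu> \<nu>)"
    by blast
  from someI_ex[OF this]
  have i: "init l p \<in> Mor L" "deg L (init l p) = p"
    "\<exists>\<nu>\<in>Mor L. src L (init l p) = rng L \<nu> \<and> l = cmp L (init l p) \<nu>"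
    unfolding init_def[symmetric] by blast+
  from i(3) have "\<exists>\<nu>. \<nu> \<in> Mor L \<and> src L (init l p) = rng L \<nu> \<and> l = cmp L (init l p) \<nu>" by blast
  from someI_ex[OF this] show "init l p \<in> Mor L" "deg L (init l p) = p"
    "final l p \<in> Mor L" "rng L (final l p) = src L (init l p)"
    "cmp L (init l p) (final l p) = l"
    unfolding final_def[symmetric] using i by auto
qed

lemma src_final: "l \<in> Mor L \<Longrightarrow> p \<le> deg L l \<Longrightarrow> src L (final l p) = src L l"
  by (metis final_closed init_closed init_final rng_final src_cmp)

lemma deg_final: "l \<in> Mor L \<Longrightarrow> p \<le> deg L l \<Longrightarrow> deg L (final l p) = deg L l - p"
  by (metis add_diff_cancel_left' deg_cmp deg_init final_closed init_closed init_final rng_final)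

lemma
  assumes "\<mu> \<in> Mor L" "\<nu> \<in> Mor L" "src L \<mu> = rng L \<nu>"
  shows init_cmp: "init (cmp L \<mu> \<nu>) (deg L \<mu>) = \<mu>" and final_cmp: "final (cmp L \<mu> \<nu>) (deg L \<mu>) = \<nu>"
proof -
  let ?l = "cmp L \<mu> \<nu>" and ?p = "deg L \<mu>"
  have l: "?l \<in> Mor L" "?p \<le> deg L ?l" using assms by (simp_all add: cmp_closed deg_cmp)
  show "init ?l ?p = \<mu>"
    by (rule factorisation_unique(1)[OF init_closed[OF l] final_closed[OF l] _ assms])
       (simp_all add: l init_final rng_final deg_init)
  show "final ?l ?p = \<nu>"
    by (rule factorisation_unique(2)[OF init_closed[OF l] final_closed[OF l] _ assms])
       (simp_all add: l init_final rng_final deg_init)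
qed

lemma init_cmp_le:
  assumes "\<mu> \<in> Mor L" "\<nu> \<in> Mor L" "src L \<mu> = rng L \<nu>" "p \<le> deg L \<mu>"
  shows "init (cmp L \<mu> \<nu>) p = init \<mu> p"
proof -
  have "cmp L \<mu> \<nu> = cmp L (init \<mu> p) (cmp L (final \<mu> p) \<nu>)"
    using assms by (metis cmp_assoc final_closed init_closed init_final rng_final src_final)
  moreover have "deg L (init \<mu> p) = p" using assms by (simp add: deg_init)
  ultimately show ?thesis
    using assms init_cmp[of "init \<mu> p" "cmp L (final \<mu> p) \<nu>"]
    by (simp add: init_closed final_closed cmp_closed src_final rng_cmp rng_final)
qed

lemma init_init:
  assumes "l \<in> Mor L" "p \<le> q" "q \<le> deg L l"
  shows "init (init l q) p = init l p"
  using init_cmp_le[of "init l q" "final l q" p] assms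
  by (simp add: init_closed final_closed rng_final deg_init init_final)

lemma init_deg: "l \<in> Mor L \<Longrightarrow> init l (deg L l) = l"
  by (metis cmp_src init_cmp rng_src src_closed)

lemma final_deg: "l \<in> Mor L \<Longrightarrow> final l (deg L l) = src L l"
  by (metis cmp_src final_cmp rng_src src_closed)

text \<open>A common extension of l and m has degree at least the join of their degrees. Its initial
  segment of that degree is a minimal common extension, and the rest is the common tail
  \<tau>.\<close>

lemma Lmin_nonemptyI:
  assumes "l \<in> Mor L" "m \<in> Mor L" "\<alpha> \<in> Mor L" "\<beta> \<in> Mor L" "src L l = rng L \<alpha>" "src L m = rng L \<beta>"
    and eq: "cmp L l \<alpha> = cmp L m \<beta>"
  obtains \<alpha>' \<beta>' \<tau> where "(\<alpha>', \<beta>') \<in> Lmin L l m" "\<tau> \<in> Mor L" "src L \<alpha>' = rng L \<tau>" "src L \<beta>' = rng L \<tau>"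
    "\<alpha> = cmp L \<alpha>' \<tau>" "\<beta> = cmp L \<beta>' \<tau>"
proof -
  let ?x = "cmp L l \<alpha>" and ?d = "sup (deg L l) (deg L m)"
  have x: "?x \<in> Mor L" using assms by (simp add: cmp_closed)
  have "deg L l \<le> deg L ?x" using deg_cmp[OF assms(1,3,5)] by simp
  moreover have "deg L m \<le> deg L ?x" unfolding eq using assms by (simp add: deg_cmp)
  ultimately
  have d: "?d \<le> deg L ?x" by simp
  define t where "t = init ?x ?d"
  define \<tau> where "\<tau> = final ?x ?d"
  have t: "t \<in> Mor L" "deg L t = ?d" "cmp L t \<tau> = ?x" "\<tau> \<in> Mor L" "src L t = rng L \<tau>"
    unfolding t_def \<tau>_def using x d by (simp_all add: init_closed deg_init init_final final_closed rng_final)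
  \<comment> \<open>Cutting t at d(a) gives a second factorisation of the common extension with
    first degree d(a); uniqueness identifies the two. This is applied to (l, \<alpha>) and to (m,
    \<beta>).\<close>
  have *: "a = init t (deg L a) \<and> b = cmp L (final t (deg L a)) \<tau>"
    if "a \<in> Mor L" "b \<in> Mor L" "src L a = rng L b" "?x = cmp L a b" "deg L a \<le> ?d" for a b
  proof -
    have a: "deg L a \<le> deg L t" using that t by simp
    note ia = init_closed[OF t(1) a] final_closed[OF t(1) a] rng_final[OF t(1) a]
      init_final[OF t(1) a] deg_init[OF t(1) a]
    have st: "src L (final t (deg L a)) = rng L \<tau>" using src_final[OF t(1) a] t(5) by simp
    have "cmp L a b = cmp L (init t (deg L a)) (cmp L (final t (deg L a)) \<tau>)"
      using cmp_assoc[OF ia(1,2) t(4) ia(3)[symmetric] st] ia(4) t(3) that(4) by simp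
    from factorisation_unique[OF that(1-3) ia(1) cmp_closed[OF ia(2) t(4) st] _ this]
    show ?thesis using rng_cmp[OF ia(2) t(4) st] ia by simp
  qed
  have l: "init t (deg L l) = l" "cmp L (final t (deg L l)) \<tau> = \<alpha>"
    using *[of l \<alpha>] assms(1,3,5) by simp_all
  have m: "init t (deg L m) = m" "cmp L (final t (deg L m)) \<tau> = \<beta>"
    using *[OF assms(2,4,6) eq] by simp_all
  have lt: "deg L l \<le> deg L t" "deg L m \<le> deg L t" using t by simp_all
  have cl: "cmp L l (final t (deg L l)) = t" "cmp L m (final t (deg L m)) = t"
    using init_final[OF t(1) lt(1)] init_final[OF t(1) lt(2)] l m by simp_all
  have rl: "rng L (final t (deg L l)) = src L l" "rng L (final t (deg L m)) = src L m"
    using rng_final[OF t(1) lt(1)] rng_final[OF t(1) lt(2)] l m by simp_all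
  have "(final t (deg L l), final t (deg L m)) \<in> Lmin L l m"
    unfolding Lmin_def from_vertex_def using cl rl t(2) final_closed[OF t(1)] lt by simp
  then show ?thesis
    by (rule that[OF _ t(4) _ _ l(2)[symmetric] m(2)[symmetric]])
       (simp_all add: src_final[OF t(1) lt(1)] src_final[OF t(1) lt(2)] t(5))
qed

section \<open>Paths as functors and their initial segments\<close>

definition is_path :: "('m, 'k) path \<Rightarrow> bool" where
  "is_path x \<longleftrightarrow> graph_morphism (Omega (fst x)) L (snd x)"

lemma bpaths_is_path: "x \<in> bpaths L \<Longrightarrow> is_path x"
  by (simp add: bpaths_def is_path_def)

context
  fixes x assumes x: "is_path x"
begin

lemma path_extensional: "snd x \<in> extensional (Mor (Omega (fst x)))"
  using x unfolding is_path_def graph_morphism_def PiE_def by (elim conjE IntE)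

lemma path_closed: "p \<le> q \<Longrightarrow> le_ext q (fst x) \<Longrightarrow> snd x (p, q) \<in> Mor L"
proof -
  assume "p \<le> q" "le_ext q (fst x)"
  then have "(p, q) \<in> Mor (Omega (fst x))" by (simp add: Omega_def)
  moreover have "snd x \<in> Mor (Omega (fst x)) \<rightarrow>\<^sub>E Mor L"
    using x unfolding is_path_def graph_morphism_def by (rule conjunct1)
  ultimately show ?thesis by (rule PiE_mem[rotated])
qed

lemma
  assumes "p \<le> q" "le_ext q (fst x)"
  shows path_rng: "rng L (snd x (p, q)) = snd x (p, p)"
    and path_src: "src L (snd x (p, q)) = snd x (q, q)"
    and path_deg: "deg L (snd x (p, q)) = q - p"
proof -
  have "(p, q) \<in> Mor (Omega (fst x))" using assms by (simp add: Omega_def)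
  moreover have "\<forall>a\<in>Mor (Omega (fst x)). snd x (rng (Omega (fst x)) a) = rng L (snd x a)
      \<and> snd x (src (Omega (fst x)) a) = src L (snd x a) \<and> deg L (snd x a) = deg (Omega (fst x)) a"
    using x unfolding is_path_def graph_morphism_def by (elim conjE)
  ultimately have "snd x (rng (Omega (fst x)) (p, q)) = rng L (snd x (p, q))
      \<and> snd x (src (Omega (fst x)) (p, q)) = src L (snd x (p, q))
      \<and> deg L (snd x (p, q)) = deg (Omega (fst x)) (p, q)" by (rule bspec[rotated])
  then show "rng L (snd x (p, q)) = snd x (p, p)" "src L (snd x (p, q)) = snd x (q, q)"
    "deg L (snd x (p, q)) = q - p"
    by (simp_all add: Omega_def)
qed

lemma path_cmp:
  assumes "p \<le> q" "q \<le> t" "le_ext t (fst x)"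
  shows "cmp L (snd x (p, q)) (snd x (q, t)) = snd x (p, t)"
proof -
  have "(p, q) \<in> Mor (Omega (fst x))" "(q, t) \<in> Mor (Omega (fst x))"
    using assms le_ext_mono[OF assms(3,2)] by (auto simp: Omega_def)
  moreover have "src (Omega (fst x)) (p, q) = rng (Omega (fst x)) (q, t)"
    by (simp add: Omega_def)
  moreover have "\<forall>a\<in>Mor (Omega (fst x)). \<forall>b\<in>Mor (Omega (fst x)).
      src (Omega (fst x)) a = rng (Omega (fst x)) b
      \<longrightarrow> snd x (cmp (Omega (fst x)) a b) = cmp L (snd x a) (snd x b)"
    using x unfolding is_path_def graph_morphism_def by (elim conjE)
  ultimately have "snd x (cmp (Omega (fst x)) (p, q) (q, t)) = cmp L (snd x (p, q)) (snd x (q, t))"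
    by blast
  then show ?thesis by (simp add: Omega_def)
qed

lemma path_init: "p \<le> q \<Longrightarrow> le_ext q (fst x) \<Longrightarrow> init (snd x (0, q)) p = snd x (0, p)"
  using init_cmp[of "snd x (0, p)" "snd x (p, q)"] le_ext_mono[of q "fst x" p]
  by (simp add: path_closed path_src path_rng path_deg path_cmp)

lemma path_final: "p \<le> q \<Longrightarrow> le_ext q (fst x) \<Longrightarrow> final (snd x (0, q)) p = snd x (p, q)"
  using final_cmp[of "snd x (0, p)" "snd x (p, q)"] le_ext_mono[of q "fst x" p]
  by (simp add: path_closed path_src path_rng path_deg path_cmp)

end

text \<open>The segment x(p, q) is what remains of x(0, q) after its part of degree p, and off the
  domain both functors are \<open>undefined\<close>.\<close>

lemma path_eqI:
  assumes x: "is_path x" and y: "is_path y" and d: "fst x = fst y"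
    and eq: "\<And>q. le_ext q (fst x) \<Longrightarrow> snd x (0, q) = snd y (0, q)"
  shows "x = y"
proof -
  have "snd x a = snd y a" for a
  proof (cases "a \<in> Mor (Omega (fst x))")
    case True
    then obtain p q where "a = (p, q)" "p \<le> q" "le_ext q (fst x)" by (auto simp: Omega_def)
    then show ?thesis using path_final[OF x] path_final[OF y] d eq by metis
  next
    case False
    have "snd x \<in> extensional (Mor (Omega (fst x)))" "snd y \<in> extensional (Mor (Omega (fst x)))"
      using path_extensional[OF x] path_extensional[OF y] d by simp_all
    then show ?thesis using False by (metis extensional_arb)
  qed
  then show ?thesis using d by (simp add: prod_eq_iff fun_eq_iff)
qed

lemma is_path_intro:
  assumes ext: "f \<in> extensional (Mor (Omega d))"
    and f: "\<And>p q. p \<le> q \<Longrightarrow> le_ext q d \<Longrightarrow> f (p, q) \<in> Mor L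
      \<and> rng L (f (p, q)) = f (p, p) \<and> src L (f (p, q)) = f (q, q) \<and> deg L (f (p, q)) = q - p"
    and c: "\<And>p q t. p \<le> q \<Longrightarrow> q \<le> t \<Longrightarrow> le_ext t d \<Longrightarrow> f (p, t) = cmp L (f (p, q)) (f (q, t))"
  shows "is_path (d, f)"
proof -
  let ?O = "Omega d"
  have f': "f a \<in> Mor L \<and> f (rng ?O a) = rng L (f a) \<and> f (src ?O a) = src L (f a)
      \<and> deg L (f a) = deg ?O a" if "a \<in> Mor ?O" for a
    using that f[of "fst a" "snd a"] by (cases a) (simp add: Omega_def)
  have c': "f (cmp ?O a b) = cmp L (f a) (f b)" if "a \<in> Mor ?O" "b \<in> Mor ?O" "src ?O a = rng ?O b" for a b
    using that c[of "fst a" "snd a" "snd b"] by (cases a; cases b) (simp add: Omega_def)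
  show ?thesis unfolding is_path_def graph_morphism_def PiE_iff fst_conv snd_conv
    using ext f' c' by blast
qed

text \<open>A coherent family of initial segments is a path: the segment from p to q is the rest of
  \<open>P q\<close> after degree p. Functoriality follows by comparing two factorisations of
  \<open>P t\<close> that both begin with \<open>P p\<close>.\<close>

lemma is_pathI:
  assumes closed: "\<And>q. le_ext q d \<Longrightarrow> P q \<in> Mor L"
    and deg: "\<And>q. le_ext q d \<Longrightarrow> deg L (P q) = q"
    and coh: "\<And>p q. p \<le> q \<Longrightarrow> le_ext q d \<Longrightarrow> init (P q) p = P p"
  shows "is_path (d, restrict (\<lambda>(p, q). final (P q) p) (Mor (Omega d)))"
proof -
  have dle: "p \<le> deg L (P q)" if "p \<le> q" "le_ext q d" for p q using deg that by simp
  have pq: "final (P q) p \<in> Mor L" "rng L (final (P q) p) = src L (P p)"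
      "src L (final (P q) p) = src L (P q)" "deg L (final (P q) p) = q - p"
    if "p \<le> q" "le_ext q d" for p q
    using that closed[OF that(2)] dle[OF that] coh[OF that]
    by (simp_all add: final_closed rng_final src_final deg_final deg)
  \<comment> \<open>The object of the path at p: after the whole of \<open>P p\<close> is removed,
    its source remains.\<close>
  have pp: "final (P p) p = src L (P p)" if "le_ext p d" for p
    using final_deg[OF closed[OF that]] deg[OF that] by simp
  have fc: "final (P t) p = cmp L (final (P q) p) (final (P t) q)"
    if "p \<le> q" "q \<le> t" "le_ext t d" for p q t
  proof -
    have q: "le_ext q d" and p: "le_ext p d" using that le_ext_mono order_trans by blast+
    have Pq: "P q = cmp L (P p) (final (P q) p)"
      using init_final[OF closed[OF q] dle[OF that(1) q]] coh[OF that(1) q] by simp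
    have "P t = cmp L (P q) (final (P t) q)"
      using init_final[OF closed[OF that(3)] dle[OF that(2,3)]] coh[OF that(2,3)] by simp
    then have "P t = cmp L (P p) (cmp L (final (P q) p) (final (P t) q))"
      using Pq pq[OF that(1) q] pq[OF that(2,3)] closed[OF p] by (metis cmp_assoc)
    moreover have "src L (P p) = rng L (cmp L (final (P q) p) (final (P t) q))"
      using pq[OF that(1) q] pq[OF that(2,3)] by (simp add: rng_cmp)
    ultimately show ?thesis
      using final_cmp[of "P p" "cmp L (final (P q) p) (final (P t) q)"]
        closed[OF p] deg[OF p] pq[OF that(1) q] pq[OF that(2,3)] by (simp add: cmp_closed)
  qed
  have r: "restrict (\<lambda>(p, q). final (P q) p) (Mor (Omega d)) (p, q) = final (P q) p"
    if "p \<le> q" "le_ext q d" for p q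
    using that by (simp add: Omega_def)
  show ?thesis
  proof (rule is_path_intro)
    fix p q assume a: "p \<le> q" "le_ext q d"
    then have p: "le_ext p d" using le_ext_mono by blast
    show "restrict (\<lambda>(p, q). final (P q) p) (Mor (Omega d)) (p, q) \<in> Mor L
      \<and> rng L (restrict (\<lambda>(p, q). final (P q) p) (Mor (Omega d)) (p, q))
        = restrict (\<lambda>(p, q). final (P q) p) (Mor (Omega d)) (p, p)
      \<and> src L (restrict (\<lambda>(p, q). final (P q) p) (Mor (Omega d)) (p, q))
        = restrict (\<lambda>(p, q). final (P q) p) (Mor (Omega d)) (q, q)
      \<and> deg L (restrict (\<lambda>(p, q). final (P q) p) (Mor (Omega d)) (p, q)) = q - p"
      unfolding r[OF a] r[OF order_refl a(2)] r[OF order_refl p]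
      using pq[OF a] pp[OF p] pp[OF a(2)] by simp
  next
    fix p q t assume a: "p \<le> q" "q \<le> t" "le_ext t d"
    then have q: "le_ext q d" using le_ext_mono by blast
    show "restrict (\<lambda>(p, q). final (P q) p) (Mor (Omega d)) (p, t)
      = cmp L (restrict (\<lambda>(p, q). final (P q) p) (Mor (Omega d)) (p, q))
          (restrict (\<lambda>(p, q). final (P q) p) (Mor (Omega d)) (q, t))"
      unfolding r[OF a(1) q] r[OF a(2,3)] r[OF order_trans[OF a(1,2)] a(3)] by (rule fc[OF a])
  qed simp
qed

section \<open>Shifts, segments and concatenation of paths\<close>

lemma fst_shift: "fst (shift n x) = (\<lambda>i. fst x i - enat (n i))"
  by (simp add: shift_def Let_def)

lemma snd_shift:
  "p \<le> q \<Longrightarrow> le_ext n (fst x) \<Longrightarrow> le_ext (n + q) (fst x) \<Longrightarrow> snd (shift n x) (p, q) = snd x (n + p, n + q)"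
  by (simp add: shift_def Let_def Omega_def le_ext_add_iff add.commute)

lemma le_ext_shift: "le_ext n (fst x) \<Longrightarrow> le_ext q (fst (shift n x)) \<longleftrightarrow> le_ext (n + q) (fst x)"
  by (simp add: fst_shift le_ext_add_iff)

lemma is_path_shift:
  assumes x: "is_path x" and n: "le_ext n (fst x)"
  shows "is_path (shift n x)"
proof -
  have q: "le_ext (n + q) (fst x)" if "le_ext q (fst (shift n x))" for q
    using that n by (simp add: le_ext_shift)
  have ext: "snd (shift n x) \<in> extensional (Mor (Omega (fst (shift n x))))"
    unfolding shift_def Let_def by simp
  have s: "snd (shift n x) (p, q) = snd x (n + p, n + q)"
    if "p \<le> q" "le_ext q (fst (shift n x))" for p q
    using snd_shift[OF that(1) n] that(2) n by (simp add: le_ext_shift)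
  have d: "n + q' - (n + p) = q' - p" for p q' :: "'k \<Rightarrow> nat" by (simp add: fun_eq_iff)
  have "is_path (fst (shift n x), snd (shift n x))"
  proof (rule is_path_intro[OF ext])
    fix p q assume pq: "p \<le> q" and q': "le_ext q (fst (shift n x))"
    have p': "le_ext p (fst (shift n x))" using le_ext_mono[OF q' pq] .
    note np = add_fun_le_iff(2)[THEN iffD2, OF pq, of n]
    show "snd (shift n x) (p, q) \<in> Mor L \<and> rng L (snd (shift n x) (p, q)) = snd (shift n x) (p, p)
      \<and> src L (snd (shift n x) (p, q)) = snd (shift n x) (q, q) \<and> deg L (snd (shift n x) (p, q)) = q - p"
      unfolding s[OF pq q'] s[OF order_refl q'] s[OF order_refl p']
      using path_closed[OF x np q[OF q']] path_rng[OF x np q[OF q']] path_src[OF x np q[OF q']]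
        path_deg[OF x np q[OF q']] by (simp add: d)
  next
    fix p q t assume pq: "p \<le> q" "q \<le> t" and t: "le_ext t (fst (shift n x))"
    have q': "le_ext q (fst (shift n x))" using le_ext_mono[OF t pq(2)] .
    show "snd (shift n x) (p, t) = cmp L (snd (shift n x) (p, q)) (snd (shift n x) (q, t))"
      unfolding s[OF pq(1) q'] s[OF pq(2) t] s[OF order_trans[OF pq] t]
      using path_cmp[OF x _ _ q[OF t], of "n + p" "n + q"] pq by simp
  qed
  then show ?thesis by simp
qed

lemma has_segment_shift:
  "le_ext n (fst x) \<Longrightarrow> has_segment L (shift n x) p l \<longleftrightarrow> has_segment L x (n + p) l"
  unfolding has_segment_def le_ext_shift using snd_shift[of p "p + deg L l" n x]
  by (auto simp: add.assoc)

lemma has_segment_mor: "is_path x \<Longrightarrow> has_segment L x n l \<Longrightarrow> l \<in> Mor L \<and> rng L l = snd x (n, n)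
    \<and> src L l = snd x (n + deg L l, n + deg L l)"
  using path_closed[of x n "n + deg L l"] path_rng[of x n "n + deg L l"] path_src[of x n "n + deg L l"]
  unfolding has_segment_def by auto

text \<open>Functoriality splits the segment of degree d(l) + d(m) at n + d(l), and unique
  factorisation identifies the pieces with l and m.\<close>

lemma has_segment_cmp:
  assumes x: "is_path x" and "l \<in> Mor L" "m \<in> Mor L" "src L l = rng L m"
  shows "has_segment L x n (cmp L l m) \<longleftrightarrow> has_segment L x n l \<and> has_segment L x (n + deg L l) m"
proof
  let ?p = "n + deg L l" and ?q = "n + deg L l + deg L m"
  assume "has_segment L x n (cmp L l m)"
  then have q: "le_ext ?q (fst x)" and eq: "snd x (n, ?q) = cmp L l m"
    using assms by (simp_all add: has_segment_def deg_cmp add.assoc)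
  have p: "le_ext ?p (fst x)" by (rule le_ext_mono[OF q]) simp
  have np: "n \<le> ?q" by (simp add: add.assoc)
  have "cmp L (snd x (n, ?p)) (snd x (?p, ?q)) = cmp L l m"
    using path_cmp[OF x _ _ q, of n ?p] eq by simp
  with factorisation_unique[OF _ _ _ assms(2-4) this] p q assms(2) path_src[OF x, of n ?p]
  show "has_segment L x n l \<and> has_segment L x ?p m"
    by (simp add: has_segment_def path_closed[OF x] path_src[OF x] path_rng[OF x] path_deg[OF x])
next
  let ?p = "n + deg L l" and ?q = "n + deg L l + deg L m"
  assume "has_segment L x n l \<and> has_segment L x ?p m"
  then have "le_ext ?q (fst x)" "snd x (n, ?p) = l" "snd x (?p, ?q) = m"
    by (simp_all add: has_segment_def)
  then show "has_segment L x n (cmp L l m)"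
    unfolding has_segment_def deg_cmp[OF assms(2-4)] using path_cmp[OF x, of n ?p ?q]
    by (simp flip: add.assoc)
qed

lemma has_segment_init:
  assumes x: "is_path x" and "le_ext (n + p) (fst x)"
  shows "has_segment L x n (snd x (n, n + p))"
  using assms path_deg[OF x, of n "n + p"] by (simp add: has_segment_def)

lemma is_path_unique:
  assumes x: "is_path x" and y: "is_path y" and xl: "has_segment L x 0 l" and yl: "has_segment L y 0 l"
    and eq: "shift (deg L l) x = shift (deg L l) y"
  shows "x = y"
proof (rule path_eqI[OF x y])
  let ?n = "deg L l"
  have n: "le_ext ?n (fst x)" "le_ext ?n (fst y)" using xl yl by (simp_all add: has_segment_def)
  have l: "snd x (0, ?n) = l" "snd y (0, ?n) = l" using xl yl by (simp_all add: has_segment_def)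
  have d: "fst x i - enat (?n i) = fst y i - enat (?n i)" for i
    using arg_cong[OF eq, of fst] by (simp add: fst_shift fun_eq_iff)
  show d': "fst x = fst y"
  proof
    fix i show "fst x i = fst y i"
      using d[of i] n unfolding le_ext_def
      by (cases "fst x i"; cases "fst y i") (auto dest!: spec[of _ i])
  qed
  fix q assume q: "le_ext q (fst x)"
  \<comment> \<open>The degree q need not dominate d(l). At the join of the two, the initial segment
    is l followed by a segment of the shifted path; it is cut back to degree q at the end.\<close>
  define t where "t = sup q ?n - ?n"
  have nt: "?n + t = sup q ?n" unfolding t_def by simp
  have t: "le_ext (?n + t) (fst x)" "le_ext (?n + t) (fst y)"
    using le_ext_sup[OF q n(1)] d' by (simp_all add: nt)
  have "snd z (0, ?n + t) = cmp L l (snd (shift ?n z) (0, t))"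
    if "is_path z" "le_ext (?n + t) (fst z)" "snd z (0, ?n) = l" "le_ext ?n (fst z)" for z
    using path_cmp[OF that(1) _ _ that(2), of 0 ?n] that by (simp add: snd_shift)
  from this[OF x t(1) l(1) n(1)] this[OF y t(2) l(2) n(2)] eq
  have "snd x (0, ?n + t) = snd y (0, ?n + t)" by simp
  then have "snd x (0, sup q ?n) = snd y (0, sup q ?n)" by (simp only: nt)
  then show "snd x (0, q) = snd y (0, q)"
    using path_init[OF x, of q "sup q ?n"] path_init[OF y, of q "sup q ?n"] t by (simp add: nt)
qed

lemma is_path_concat:
  assumes x: "is_path x" and l: "l \<in> Mor L" and lx: "src L l = snd x (0, 0)"
  obtains y where "is_path y" "has_segment L y 0 l" "shift (deg L l) y = x"
proof -
  let ?n = "deg L l"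
  define d where "d i = fst x i + enat (?n i)" for i
  have dn: "le_ext ?n d" by (simp add: le_ext_def d_def)
  have dx: "(\<lambda>i. d i - enat (?n i)) = fst x"
  proof
    fix i show "d i - enat (?n i) = fst x i" by (cases "fst x i") (simp_all add: d_def)
  qed
  have led: "le_ext (?n + q) d \<longleftrightarrow> le_ext q (fst x)" for q using le_ext_add_iff[OF dn] dx by simp
  \<comment> \<open>For q not above d(l) the initial segment of lx of degree q has no direct
    description. \<open>Q q\<close> is the one of degree q \<or> d(l) (the join), which does begin
    with l, and \<open>P q\<close> below is its initial part of degree q.\<close>
  define Q where "Q q = cmp L l (snd x (0, sup q ?n - ?n))" for q
  have su: "le_ext (sup q ?n - ?n) (fst x)" if "le_ext q d" for q
    using le_ext_sup[OF that dn] led[of "sup q ?n - ?n"] by simp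
  have x0: "src L l = rng L (snd x (0, sup q ?n - ?n))" if "le_ext q d" for q
    using path_rng[OF x _ su[OF that], of 0] lx by simp
  have QM: "Q q \<in> Mor L" "deg L (Q q) = sup q ?n" if "le_ext q d" for q
    using path_closed[OF x _ su[OF that], of 0] path_deg[OF x _ su[OF that], of 0] x0[OF that] l
    by (auto simp: Q_def cmp_closed deg_cmp)
  define P where "P q = init (Q q) q" for q
  \<comment> \<open>Enlarging q prolongs \<open>Q\<close> on the right by a segment of x.\<close>
  have QQ: "init (Q q) (sup p ?n) = Q p" if "p \<le> q" "le_ext q d" for p q
  proof -
    have p: "le_ext p d" using that le_ext_mono by blast
    let ?a = "sup p ?n - ?n" and ?b = "sup q ?n - ?n"
    have ab: "?a \<le> ?b" using that by (auto simp: le_fun_def sup_max intro!: diff_le_mono max.mono)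
    have b: "le_ext ?b (fst x)" using su that by blast
    have m: "snd x (0, ?a) \<in> Mor L" "snd x (?a, ?b) \<in> Mor L" "src L (snd x (0, ?a)) = rng L (snd x (?a, ?b))"
      using ab b su[OF p] by (auto simp: path_closed[OF x] path_src[OF x] path_rng[OF x])
    have "Q q = cmp L (Q p) (snd x (?a, ?b))"
      unfolding Q_def using cmp_assoc[OF l m(1,2) x0[OF p] m(3)] path_cmp[OF x _ ab b, of 0] by simp
    moreover have "src L (Q p) = rng L (snd x (?a, ?b))"
      unfolding Q_def using src_cmp[OF l m(1) x0[OF p]] m(3) by simp
    ultimately show ?thesis using init_cmp[OF QM(1)[OF p] m(2)] QM(2)[OF p] by simp
  qed
  have coh: "init (P q) p = P p" if "p \<le> q" "le_ext q d" for p q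
  proof -
    have p: "le_ext p d" using that le_ext_mono by blast
    have "init (P q) p = init (Q q) p"
      unfolding P_def using that QM by (intro init_init) auto
    also have "\<dots> = init (init (Q q) (sup p ?n)) p"
      using that QM[OF that(2)] by (intro init_init[symmetric]) (auto simp: le_supI1)
    finally show ?thesis using QQ[OF that] by (simp add: P_def)
  qed
  define y where "y = (d, restrict (\<lambda>(p, q). final (P q) p) (Mor (Omega d)))"
  have y: "is_path y" unfolding y_def
    by (rule is_pathI) (use QM in \<open>simp_all add: P_def coh[unfolded P_def] init_closed deg_init\<close>)
  have y0: "snd y (0, q) = P q" if "le_ext q d" for q
  proof -
    have P: "P q \<in> Mor L" unfolding P_def using QM that by (intro init_closed) auto
    have "init (P q) 0 = rng L (P q)"
      using init_cmp[of "rng L (P q)" "P q"] P by (simp add: rng_closed src_rng cmp_rng deg_rng)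
    then have "final (P q) 0 = P q"
      using final_cmp[of "rng L (P q)" "P q"] P by (simp add: rng_closed src_rng cmp_rng deg_rng)
    then show ?thesis using that by (simp add: y_def Omega_def)
  qed
  have fy: "fst y = d" by (simp add: y_def)
  have Pl: "P (?n + q) = cmp L l (snd x (0, q))" if "le_ext q (fst x)" for q
  proof -
    have "P (?n + q) = Q (?n + q)"
      using that led QM[of "?n + q"] init_deg[of "Q (?n + q)"] by (simp add: P_def sup_absorb1)
    then show ?thesis by (simp add: Q_def sup_absorb1)
  qed
  have yl: "snd y (0, ?n) = l"
    using y0[OF dn] Pl[of 0] l lx[symmetric] by (simp add: cmp_src)
  then have seg: "has_segment L y 0 l" by (simp add: has_segment_def fy dn)
  have "shift ?n y = x"
  proof (rule path_eqI[OF is_path_shift[OF y] x])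
    show f: "fst (shift ?n y) = fst x" using dx by (simp add: fst_shift fy)
    fix q assume q: "le_ext q (fst (shift ?n y))"
    then have q': "le_ext q (fst x)" "le_ext (?n + q) d" using f led by simp_all
    then have "snd (shift ?n y) (0, q) = snd y (?n, ?n + q)"
      using snd_shift[of 0 q ?n y] by (simp add: fy dn)
    also have "\<dots> = final (snd y (0, ?n + q)) ?n"
      using path_final[OF y, of ?n "?n + q"] q' by (simp add: fy)
    also have "\<dots> = final (cmp L l (snd x (0, q))) ?n"
      using y0[OF q'(2)] Pl[OF q'(1)] by simp
    also have "\<dots> = snd x (0, q)"
      using q' l lx path_rng[OF x, of 0 q] by (intro final_cmp) (simp_all add: path_closed[OF x])
    finally show "snd (shift ?n y) (0, q) = snd x (0, q)" .
  qed (simp add: fy dn)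
  with y seg show ?thesis by (rule that)
qed

section \<open>Boundary paths under shift and concatenation\<close>

lemma bpathsI:
  assumes "is_path x"
    and "\<And>n E. le_ext n (fst x) \<Longrightarrow> E \<in> FE L (snd x (n, n)) \<Longrightarrow> \<exists>l\<in>E. has_segment L x n l"
  shows "x \<in> bpaths L"
  using assms by (simp add: bpaths_def is_path_def)

lemma bpathsD:
  assumes "x \<in> bpaths L" "le_ext n (fst x)" "E \<in> FE L (snd x (n, n))"
  obtains l where "l \<in> E" "has_segment L x n l"
  using assms unfolding bpaths_def by blast

lemma shift_bpaths:
  assumes x: "x \<in> bpaths L" and n: "le_ext n (fst x)"
  shows "shift n x \<in> bpaths L"
proof (rule bpathsI)
  show "is_path (shift n x)" using is_path_shift[OF bpaths_is_path[OF x] n] .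
  fix p E assume p: "le_ext p (fst (shift n x))" and E: "E \<in> FE L (snd (shift n x) (p, p))"
  have np: "le_ext (n + p) (fst x)" using p n by (simp add: le_ext_shift)
  then have "E \<in> FE L (snd x (n + p, n + p))" using E snd_shift[OF order_refl n np] by simp
  then obtain l where "l \<in> E" "has_segment L x (n + p) l" using bpathsD[OF x np] by blast
  then show "\<exists>l\<in>E. has_segment L (shift n x) p l" using has_segment_shift[OF n] by blast
qed

text \<open>Exhaustive sets are transported along a path by passing to these extensions.\<close>

definition ext_set :: "'m \<Rightarrow> 'm set \<Rightarrow> 'm set" where
  "ext_set \<mu> E = (\<Union>\<nu>\<in>E. fst ` Lmin L \<mu> \<nu>)"

text \<open>Given m at s(\<mu>), some \<nu> in E has a common extension with \<mu>m. This extension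
  of \<mu> and \<nu> factors through a minimal one (\<alpha>', \<beta>'), and then \<alpha>' and m
  have a common extension. Finite alignment keeps the new set finite.\<close>

lemma ext_set_FE:
  assumes fa: "finitely_aligned L" and mu: "\<mu> \<in> Mor L" and E: "E \<in> FE L (rng L \<mu>)"
  shows "ext_set \<mu> E \<in> FE L (src L \<mu>)"
proof -
  have EM: "\<nu> \<in> Mor L" "rng L \<nu> = rng L \<mu>" if "\<nu> \<in> E" for \<nu>
    using E that unfolding FE_def exhaustive_def from_vertex_def by blast+
  have "finite E" using E by (simp add: FE_def)
  then have "finite (ext_set \<mu> E)"
    unfolding ext_set_def using fa mu EM(1) by (simp add: finitely_aligned_def)
  moreover have "ext_set \<mu> E \<subseteq> from_vertex L (src L \<mu>)"
    unfolding ext_set_def Lmin_def by auto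
  moreover have "\<exists>l\<in>ext_set \<mu> E. Lmin L l m \<noteq> {}" if m: "m \<in> from_vertex L (src L \<mu>)" for m
  proof -
    have m': "m \<in> Mor L" "src L \<mu> = rng L m" using m by (simp_all add: from_vertex_def)
    have mm: "cmp L \<mu> m \<in> Mor L" "src L (cmp L \<mu> m) = src L m" "rng L (cmp L \<mu> m) = rng L \<mu>"
      using mu m' by (simp_all add: cmp_closed src_cmp rng_cmp)
    then have "cmp L \<mu> m \<in> from_vertex L (rng L \<mu>)" by (simp add: from_vertex_def)
    then obtain \<nu> where \<nu>: "\<nu> \<in> E" "Lmin L \<nu> (cmp L \<mu> m) \<noteq> {}"
      using E unfolding FE_def exhaustive_def by blast
    then obtain \<alpha> \<beta> where ab: "\<alpha> \<in> Mor L" "rng L \<alpha> = src L \<nu>" "\<beta> \<in> Mor L" "rng L \<beta> = src L m"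
      "cmp L \<nu> \<alpha> = cmp L (cmp L \<mu> m) \<beta>"
      using mm by (auto simp: Lmin_def from_vertex_def)
    have mb: "cmp L m \<beta> \<in> Mor L" "rng L (cmp L m \<beta>) = rng L m"
      using cmp_closed[OF m'(1) ab(3) ab(4)[symmetric]] rng_cmp[OF m'(1) ab(3) ab(4)[symmetric]] by simp_all
    have eq: "cmp L \<mu> (cmp L m \<beta>) = cmp L \<nu> \<alpha>"
      using cmp_assoc[OF mu m'(1) ab(3) m'(2) ab(4)[symmetric]] ab(5) by simp
    have s1: "src L \<mu> = rng L (cmp L m \<beta>)" using mb m' by simp
    obtain \<alpha>' \<beta>' \<tau> where t: "(\<alpha>', \<beta>') \<in> Lmin L \<mu> \<nu>" "\<tau> \<in> Mor L" "src L \<alpha>' = rng L \<tau>"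
      "cmp L m \<beta> = cmp L \<alpha>' \<tau>"
      using Lmin_nonemptyI[OF mu EM(1)[OF \<nu>(1)] mb(1) ab(1) s1 ab(2)[symmetric] eq] by metis
    have a': "\<alpha>' \<in> Mor L" using t(1) by (simp add: Lmin_def from_vertex_def)
    have "Lmin L \<alpha>' m \<noteq> {}"
      using Lmin_nonemptyI[OF a' m'(1) t(2) ab(3) t(3) ab(4)[symmetric] t(4)[symmetric]] by blast
    moreover have "\<alpha>' \<in> ext_set \<mu> E" unfolding ext_set_def using t(1) \<nu>(1) by force
    ultimately show ?thesis by blast
  qed
  ultimately show ?thesis by (simp add: FE_def exhaustive_def)
qed

lemma concat_bpaths:
  assumes fa: "finitely_aligned L"
    and x: "x \<in> bpaths L" and l: "l \<in> Mor L" "src L l = snd x (0, 0)"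
  obtains y where "y \<in> bpaths L" "has_segment L y 0 l" "shift (deg L l) y = x"
proof -
  obtain y where y: "is_path y" "has_segment L y 0 l" "shift (deg L l) y = x"
    using is_path_concat[OF bpaths_is_path[OF x] l] by blast
  let ?d = "deg L l"
  have d: "le_ext ?d (fst y)" using y(2) by (simp add: has_segment_def)
  have "y \<in> bpaths L"
  proof (rule bpathsI[OF y(1)])
    fix n E assume n: "le_ext n (fst y)" and E: "E \<in> FE L (snd y (n, n))"
    \<comment> \<open>The set E sits at n, which may precede d(l) or be incomparable with it,
      whereas the boundary condition is known only on x, that is, beyond d(l). So E is moved along
      \<mu> = y(n, p) to a point of x. The element \<alpha> found there extends \<mu> to
      \<mu>\<alpha> = \<nu>\<beta>, which puts \<nu> on y at n.\<close>
    define p where "p = sup n ?d"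
    have p: "le_ext p (fst y)" "n \<le> p" "?d \<le> p" unfolding p_def using le_ext_sup[OF n d] by simp_all
    define \<mu> where "\<mu> = snd y (n, p)"
    have mu: "\<mu> \<in> Mor L" "rng L \<mu> = snd y (n, n)" "src L \<mu> = snd y (p, p)" "n + deg L \<mu> = p"
      unfolding \<mu>_def using path_closed[OF y(1) p(2,1)] path_rng[OF y(1) p(2,1)]
        path_src[OF y(1) p(2,1)] path_deg[OF y(1) p(2,1)] p(2) by simp_all
    have dp: "?d + (p - ?d) = p" using p by simp
    have px: "le_ext (p - ?d) (fst x)" using le_ext_shift[OF d, of "p - ?d"] p y(3) dp by simp
    have "snd y (p, p) = snd x (p - ?d, p - ?d)"
      using snd_shift[OF order_refl d, of "p - ?d"] p(1) y(3) dp by simp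
    then have "ext_set \<mu> E \<in> FE L (snd x (p - ?d, p - ?d))"
      using ext_set_FE[OF fa mu(1)] E mu by simp
    then obtain \<alpha> where \<alpha>: "\<alpha> \<in> ext_set \<mu> E" "has_segment L x (p - ?d) \<alpha>"
      using bpathsD[OF x px] by blast
    then obtain \<nu> \<beta> where \<nu>: "\<nu> \<in> E" "(\<alpha>, \<beta>) \<in> Lmin L \<mu> \<nu>" by (auto simp: ext_set_def)
    have ab: "\<alpha> \<in> Mor L" "\<beta> \<in> Mor L" "src L \<mu> = rng L \<alpha>" "src L \<nu> = rng L \<beta>" "cmp L \<mu> \<alpha> = cmp L \<nu> \<beta>"
      using \<nu>(2) by (simp_all add: Lmin_def from_vertex_def)
    have \<nu>M: "\<nu> \<in> Mor L" using E \<nu>(1) unfolding FE_def exhaustive_def from_vertex_def by blast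
    have "has_segment L y p \<alpha>"
      using has_segment_shift[OF d, of "p - ?d" \<alpha>] \<alpha>(2) y(3) dp by simp
    moreover have "has_segment L y n \<mu>"
      using has_segment_init[OF y(1), of n "deg L \<mu>"] mu(4) p(1) by (simp add: \<mu>_def)
    ultimately have "has_segment L y n (cmp L \<mu> \<alpha>)"
      using has_segment_cmp[OF y(1) mu(1) ab(1,3)] mu(4) by simp
    then have "has_segment L y n \<nu>"
      using has_segment_cmp[OF y(1) \<nu>M ab(2,4)] ab(5) by simp
    with \<nu>(1) show "\<exists>l\<in>E. has_segment L y n l" by blast
  qed
  with y show ?thesis using that by blast
qed

end

section \<open>The topology of the boundary-path space\<close>

context kgraph
begin

lemma cyl_bpaths: "x \<in> cyl L l \<Longrightarrow> x \<in> bpaths L"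
  by (simp add: cyl_def)

lemma cyl_mor: "x \<in> cyl L l \<Longrightarrow> l \<in> Mor L"
  unfolding cyl_def using has_segment_mor[OF bpaths_is_path] by blast

lemma bpaths_root:
  assumes x: "x \<in> bpaths L"
  shows "snd x (0, 0) \<in> Mor L" "x \<in> cyl L (snd x (0, 0))" "deg L (snd x (0, 0)) = 0"
    "rng L (snd x (0, 0)) = snd x (0, 0)"
  using has_segment_init[OF bpaths_is_path[OF x], of 0 0] path_closed[OF bpaths_is_path[OF x], of 0 0]
    path_deg[OF bpaths_is_path[OF x], of 0 0] path_rng[OF bpaths_is_path[OF x], of 0 0] x
  by (simp_all add: cyl_def)

lemma cyl_rng: "x \<in> cyl L l \<Longrightarrow> rng L l = snd x (0, 0)"
  using has_segment_mor[OF bpaths_is_path, of x 0 l] by (simp add: cyl_def)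

lemma cyl_vertex:
  assumes "l \<in> Mor L"
  shows "x \<in> cyl L (src L l) \<longleftrightarrow> x \<in> bpaths L \<and> snd x (0, 0) = src L l"
  using deg_src[OF assms] by (auto simp: cyl_def has_segment_def)

lemma cyl_cmp:
  assumes "l \<in> Mor L" "m \<in> Mor L" "src L l = rng L m"
  shows "x \<in> cyl L (cmp L l m) \<longleftrightarrow> x \<in> cyl L l \<and> has_segment L x (deg L l) m"
  using has_segment_cmp[OF bpaths_is_path assms, of x 0] by (auto simp: cyl_def)

lemma openin_basic:
  "l \<in> Mor L \<Longrightarrow> finite F \<Longrightarrow> F \<subseteq> from_vertex L (src L l)
    \<Longrightarrow> openin (bpath_topology L) (cyl L l - cyls L l F)"
  unfolding bpath_topology_def by (rule topology_generated_by_Basis) blast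

text \<open>A basic set with F empty. If l is no morphism, no path has it as a segment and the
  cylinder is empty.\<close>

lemma openin_cyl: "openin (bpath_topology L) (cyl L l)"
proof (cases "l \<in> Mor L")
  case True
  then show ?thesis using openin_basic[of l "{}"] by (simp add: cyls_def)
next
  case False
  then have "cyl L l = {}" using cyl_mor by blast
  then show ?thesis by simp
qed

lemma topspace_bpath [simp]: "topspace (bpath_topology L) = bpaths L"
proof
  show "topspace (bpath_topology L) \<subseteq> bpaths L"
    unfolding bpath_topology_def topology_generated_by_topspace by (auto simp: cyl_def)
  show "bpaths L \<subseteq> topspace (bpath_topology L)"
    using openin_subset[OF openin_cyl] bpaths_root(2) by blast
qed

text \<open>A path outside the cylinder of l either starts at r(l), and then lies in the basic open
  set obtained from the cylinder of r(l) by removing that of l, or starts elsewhere, and then the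
  cylinder of its own initial vertex is disjoint from that of l.\<close>

lemma closedin_cyl: "closedin (bpath_topology L) (cyl L l)"
proof (cases "l \<in> Mor L")
  case True
  have "openin (bpath_topology L) (bpaths L - cyl L l)"
  proof (subst openin_subopen, intro ballI)
    fix x assume x: "x \<in> bpaths L - cyl L l"
    let ?v = "rng L l"
    have v: "?v \<in> Mor L" "src L ?v = ?v" "cmp L ?v l = l"
      using True by (simp_all add: rng_closed src_rng cmp_rng)
    show "\<exists>S. openin (bpath_topology L) S \<and> x \<in> S \<and> S \<subseteq> bpaths L - cyl L l"
    proof (cases "snd x (0, 0) = ?v")
      case eq: True
      have "openin (bpath_topology L) (cyl L ?v - cyls L ?v {l})"
        using True v by (intro openin_basic) (simp_all add: from_vertex_def)
      moreover have "cyls L ?v {l} = cyl L l" by (simp add: cyls_def v)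
      moreover have "x \<in> cyl L ?v" using x eq bpaths_root(2)[of x] by simp
      ultimately show ?thesis using x cyl_bpaths by (intro exI[of _ "cyl L ?v - cyl L l"]) auto
    next
      case False
      have "cyl L (snd x (0, 0)) \<subseteq> bpaths L - cyl L l"
        using x False cyl_rng cyl_bpaths bpaths_root(4)[of x] by force
      then show ?thesis using x bpaths_root(2) openin_cyl by blast
    qed
  qed
  then show ?thesis using cyl_bpaths by (auto simp: closedin_def)
next
  case False
  then have "cyl L l = {}" using cyl_mor by blast
  then show ?thesis by simp
qed

text \<open>Generating sets are cylinders minus finitely many cylinders: openness of preimages
  handles the first, closedness the removed ones.\<close>

lemma continuous_map_bpath:
  assumes f: "\<And>x. x \<in> topspace Y \<Longrightarrow> f x \<in> bpaths L"
    and cyl: "\<And>l. l \<in> Mor L \<Longrightarrow> openin Y {x \<in> topspace Y. f x \<in> cyl L l}"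
      "\<And>l. l \<in> Mor L \<Longrightarrow> closedin Y {x \<in> topspace Y. f x \<in> cyl L l}"
  shows "continuous_map Y (bpath_topology L) f"
  unfolding bpath_topology_def continuous_on_generated_topo_iff
proof (intro conjI allI impI)
  fix U assume "U \<in> {cyl L l - cyls L l F |l F. l \<in> Mor L \<and> finite F \<and> F \<subseteq> from_vertex L (src L l)}"
  then obtain l F where U: "U = cyl L l - cyls L l F" "l \<in> Mor L" "finite F" "F \<subseteq> from_vertex L (src L l)"
    by blast
  have "cmp L l \<nu> \<in> Mor L" if "\<nu> \<in> F" for \<nu>
    using cmp_closed[OF U(2), of \<nu>] subsetD[OF U(4) that] by (simp add: from_vertex_def)
  then have "closedin Y (\<Union>\<nu>\<in>F. {x \<in> topspace Y. f x \<in> cyl L (cmp L l \<nu>)})"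
    using U(3) cyl(2) by (intro closedin_Union) auto
  then have "openin Y ({x \<in> topspace Y. f x \<in> cyl L l} - (\<Union>\<nu>\<in>F. {x \<in> topspace Y. f x \<in> cyl L (cmp L l \<nu>)}))"
    by (intro openin_diff cyl(1) U(2))
  moreover have "{x \<in> topspace Y. f x \<in> cyl L l} - (\<Union>\<nu>\<in>F. {x \<in> topspace Y. f x \<in> cyl L (cmp L l \<nu>)})
      = f -` U \<inter> topspace Y"
    by (auto simp: U(1) cyls_def)
  ultimately show "openin Y (f -` U \<inter> topspace Y)" by simp
next
  show "f ` topspace Y \<subseteq> \<Union> {cyl L l - cyls L l F |l F. l \<in> Mor L \<and> finite F \<and> F \<subseteq> from_vertex L (src L l)}"
    using f topspace_bpath unfolding bpath_topology_def topology_generated_by_topspace by blast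
qed

text \<open>The cylinder of x(0, n) records both that n is at most the degree and what the initial
  segment is. Hence the cylinders around x determine d(x) and all initial segments.\<close>

lemma bpaths_separated:
  assumes x: "x \<in> bpaths L" and y: "y \<in> bpaths L" and sub: "\<And>l. l \<in> Mor L \<Longrightarrow> x \<in> cyl L l \<longleftrightarrow> y \<in> cyl L l"
  shows "x = y"
proof -
  have *: "le_ext n (fst z') \<and> snd z' (0, n) = snd z (0, n)"
    if "le_ext n (fst z)" "z \<in> bpaths L" "\<And>l. l \<in> Mor L \<Longrightarrow> z \<in> cyl L l \<Longrightarrow> z' \<in> cyl L l" for z z' n
  proof -
    have "has_segment L z 0 (snd z (0, n))" "snd z (0, n) \<in> Mor L" "deg L (snd z (0, n)) = n"
      using that(1) has_segment_init[OF bpaths_is_path[OF that(2)], of 0 n]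
        path_closed[OF bpaths_is_path[OF that(2)], of 0 n]
        path_deg[OF bpaths_is_path[OF that(2)], of 0 n] by simp_all
    then show ?thesis using that(3)[of "snd z (0, n)"] that(2) by (simp add: cyl_def has_segment_def)
  qed
  have "le_ext n (fst x) \<longleftrightarrow> le_ext n (fst y)" for n
    using *[OF _ x, of n y] *[OF _ y, of n x] sub by blast
  then have "fst x = fst y" by (rule le_ext_inject)
  then show ?thesis
  proof (rule path_eqI[OF bpaths_is_path[OF x] bpaths_is_path[OF y]])
    fix q assume "le_ext q (fst x)"
    then show "snd x (0, q) = snd y (0, q)" using *[OF _ x, of q y] sub by simp
  qed
qed

lemma Hausdorff_bpath: "Hausdorff_space (bpath_topology L)"
  unfolding Hausdorff_space_def topspace_bpath
proof (intro allI impI, elim conjE)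
  fix x y assume x: "x \<in> bpaths L" and y: "y \<in> bpaths L" and ne: "x \<noteq> y"
  obtain l where l: "x \<in> cyl L l \<and> y \<notin> cyl L l \<or> x \<notin> cyl L l \<and> y \<in> cyl L l"
    using bpaths_separated[OF x y] ne by blast
  have "openin (bpath_topology L) (bpaths L - cyl L l)"
    using closedin_cyl by (simp add: closedin_def)
  with l x y openin_cyl[of l]
  show "\<exists>U V. openin (bpath_topology L) U \<and> openin (bpath_topology L) V \<and> x \<in> U \<and> y \<in> V \<and> disjnt U V"
    unfolding disjnt_def by (metis DiffI Diff_disjoint inf_commute)
qed

section \<open>Domains, fibres and continuity of the shift\<close>

lemma bpaths_ge_cyl:
  assumes "x \<in> bpaths_ge L n"
  shows "snd x (0, n) \<in> Mor L" "deg L (snd x (0, n)) = n" "x \<in> cyl L (snd x (0, n))"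
  using assms path_closed[OF bpaths_is_path, of x 0 n] path_deg[OF bpaths_is_path, of x 0 n]
    has_segment_init[OF bpaths_is_path, of x 0 n]
  by (auto simp: bpaths_ge_def cyl_def)

lemma cyl_ge: "x \<in> cyl L l \<Longrightarrow> x \<in> bpaths_ge L (deg L l)"
  by (simp add: cyl_def bpaths_ge_def has_segment_def)

text \<open>Since x determines l from the degree of l, distinct cylinders of equal degree are
  disjoint.\<close>

lemma cyl_eq: "x \<in> cyl L l \<Longrightarrow> snd x (0, deg L l) = l"
  by (simp add: cyl_def has_segment_def)

lemma bpaths_ge_eq_Union: "bpaths_ge L n = (\<Union>l\<in>{l\<in>Mor L. deg L l = n}. cyl L l)"
  using bpaths_ge_cyl cyl_ge by fastforce

lemma bpaths_ge_sub: "bpaths_ge L n \<subseteq> bpaths L"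
  by (auto simp: bpaths_ge_def)

lemma bpaths_ge_0 [simp]: "bpaths_ge L 0 = bpaths L"
  by (auto simp: bpaths_ge_def)

lemma openin_bpaths_ge: "openin (bpath_topology L) (bpaths_ge L n)"
  unfolding bpaths_ge_eq_Union using openin_cyl by blast

lemma shift_in_bpaths: "x \<in> bpaths_ge L n \<Longrightarrow> shift n x \<in> bpaths L"
  using shift_bpaths by (simp add: bpaths_ge_def)

lemma bpaths_ge_add: "x \<in> bpaths_ge L (m + n) \<longleftrightarrow> x \<in> bpaths_ge L m \<and> shift m x \<in> bpaths_ge L n"
  using le_ext_mono[of "m + n" "fst x" m] le_ext_shift[of m x n] shift_in_bpaths[of x m]
  by (auto simp: bpaths_ge_def)

lemma shift_shift:
  assumes "x \<in> bpaths_ge L (m + n)"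
  shows "shift n (shift m x) = shift (m + n) x"
proof (rule path_eqI)
  have m: "x \<in> bpaths_ge L m" "shift m x \<in> bpaths_ge L n" using assms bpaths_ge_add by blast+
  show "is_path (shift n (shift m x))" "is_path (shift (m + n) x)"
    using bpaths_is_path shift_in_bpaths assms m by blast+
  have "a - enat j - enat k = a - enat (j + k)" for a j k by (cases a) simp_all
  then show d: "fst (shift n (shift m x)) = fst (shift (m + n) x)" by (simp add: fst_shift)
  have le: "le_ext m (fst x)" "le_ext n (fst (shift m x))" "le_ext (m + n) (fst x)"
    using m assms by (simp_all add: bpaths_ge_def)
  fix q assume "le_ext q (fst (shift n (shift m x)))"
  then have q: "le_ext (n + q) (fst (shift m x))" using le_ext_shift[of n "shift m x" q] le(2) by blast
  then have q': "le_ext (m + (n + q)) (fst x)" using le_ext_shift[of m x "n + q"] le(1) by blast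
  show "snd (shift n (shift m x)) (0, q) = snd (shift (m + n) x) (0, q)"
    using snd_shift[of 0 q n "shift m x"] snd_shift[of n "n + q" m x] snd_shift[of 0 q "m + n" x] q q' le
    by (simp add: add.assoc)
qed

lemma shift_0: "x \<in> bpaths L \<Longrightarrow> shift 0 x = x"
  using is_path_shift[of x 0] bpaths_is_path[of x] snd_shift[of 0 _ 0 x]
  by (intro path_eqI) (simp_all add: fst_shift flip: zero_enat_def)

text \<open>Source of the iterated sums: it partitions a fibre of \<open>shift (m + n)\<close> into
  fibres of \<open>shift m\<close> over the points of a fibre of \<open>shift n\<close>.\<close>

lemma fibre_add: "y \<in> fibre L (m + n) x \<longleftrightarrow> y \<in> bpaths_ge L m \<and> shift m y \<in> fibre L n x"
  using bpaths_ge_add[of y m n] shift_shift[of y m n] by (auto simp: fibre_def)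

lemma shift_cyl_iff:
  assumes l: "l \<in> Mor L" and x: "x \<in> bpaths_ge L n"
  shows "shift n x \<in> cyl L l \<longleftrightarrow> src L (snd x (0, n)) = rng L l \<and> x \<in> cyl L (cmp L (snd x (0, n)) l)"
proof -
  note s = bpaths_ge_cyl[OF x]
  have xb: "x \<in> bpaths L" "le_ext n (fst x)" using x by (simp_all add: bpaths_ge_def)
  have *: "src L (snd x (0, n)) = snd x (n, n)"
    using path_src[OF bpaths_is_path[OF xb(1)], of 0 n] xb by simp
  have "shift n x \<in> cyl L l \<longleftrightarrow> has_segment L x n l"
    using has_segment_shift[OF xb(2), of 0 l] shift_in_bpaths[OF x] by (simp add: cyl_def)
  moreover have "rng L l = snd x (n, n)" if "has_segment L x n l"
    using has_segment_mor[OF bpaths_is_path[OF xb(1)] that] by simp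
  ultimately show ?thesis using cyl_cmp[OF s(1) l, of x] s * by auto
qed

lemma continuous_shift:
  "continuous_map (subtopology (bpath_topology L) (bpaths_ge L n)) (bpath_topology L) (shift n)"
proof (rule continuous_map_bpath)
  have top: "topspace (subtopology (bpath_topology L) (bpaths_ge L n)) = bpaths_ge L n"
    using bpaths_ge_sub by auto
  show "shift n x \<in> bpaths L" if "x \<in> topspace (subtopology (bpath_topology L) (bpaths_ge L n))" for x
    using that shift_in_bpaths by auto
  fix l assume l: "l \<in> Mor L"
  let ?V = "{x \<in> bpaths_ge L n. shift n x \<in> cyl L l}"
  let ?I = "{m \<in> Mor L. deg L m = n}"
  have mem: "x \<in> ?V \<longleftrightarrow> x \<in> bpaths_ge L n \<and> src L (snd x (0, n)) = rng L l \<and> x \<in> cyl L (cmp L (snd x (0, n)) l)" for x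
    using shift_cyl_iff[OF l] by blast
  have key: "snd x (0, n) = m \<and> x \<in> bpaths_ge L n" if "x \<in> cyl L m" "deg L m = n" for x m
    using cyl_eq[OF that(1)] cyl_ge[OF that(1)] that(2) by simp
  have V: "?V = (\<Union>m\<in>{m\<in>?I. src L m = rng L l}. cyl L m \<inter> cyl L (cmp L m l))"
  proof (intro set_eqI iffI)
    fix x assume "x \<in> ?V"
    with mem[of x] bpaths_ge_cyl[of x n] show "x \<in> (\<Union>m\<in>{m\<in>?I. src L m = rng L l}. cyl L m \<inter> cyl L (cmp L m l))"
      by (intro UN_I[of "snd x (0, n)"]) simp_all
  next
    fix x assume "x \<in> (\<Union>m\<in>{m\<in>?I. src L m = rng L l}. cyl L m \<inter> cyl L (cmp L m l))"
    then obtain m where "deg L m = n" "src L m = rng L l" "x \<in> cyl L m" "x \<in> cyl L (cmp L m l)" by blast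
    with mem[of x] key[of x m] show "x \<in> ?V" by simp
  qed
  \<comment> \<open>An infinite union of clopen sets such as the one in V need not be closed, so its
    complement is also written as a union of open sets. On each cylinder of degree n, membership is
    decided by one clopen cylinder or fails altogether.\<close>
  have W: "bpaths_ge L n - ?V = (\<Union>m\<in>?I. if src L m = rng L l then cyl L m - cyl L (cmp L m l) else cyl L m)"
    (is "_ = (\<Union>m\<in>?I. ?W m)")
  proof (intro set_eqI iffI)
    fix x assume "x \<in> bpaths_ge L n - ?V"
    with mem[of x] bpaths_ge_cyl[of x n] show "x \<in> (\<Union>m\<in>?I. ?W m)"
      by (intro UN_I[of "snd x (0, n)"]) simp_all
  next
    fix x assume "x \<in> (\<Union>m\<in>?I. ?W m)"
    then obtain m where m: "deg L m = n" "x \<in> ?W m" by blast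
    then have "x \<in> cyl L m" by (simp split: if_splits)
    with mem[of x] key[of x m] m show "x \<in> bpaths_ge L n - ?V" by (simp split: if_splits)
  qed
  have "openin (bpath_topology L) ?V" unfolding V using openin_cyl by blast
  then show "openin (subtopology (bpath_topology L) (bpaths_ge L n))
      {x \<in> topspace (subtopology (bpath_topology L) (bpaths_ge L n)). shift n x \<in> cyl L l}"
    unfolding top by (auto simp: openin_open_subtopology openin_bpaths_ge)
  have "openin (bpath_topology L) (bpaths_ge L n - ?V)"
    unfolding W using openin_cyl openin_diff[OF openin_cyl closedin_cyl] by (intro openin_Union) auto
  then show "closedin (subtopology (bpath_topology L) (bpaths_ge L n))
      {x \<in> topspace (subtopology (bpath_topology L) (bpaths_ge L n)). shift n x \<in> cyl L l}"
    unfolding top closedin_def by (auto simp: openin_open_subtopology openin_bpaths_ge)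
qed

end

section \<open>Concatenation as the local inverse of the shift\<close>

locale fa_kgraph = kgraph L for L :: "('m, 'k::finite) kgraph_data" +
  assumes fa: "finitely_aligned L"
begin

text \<open>The concatenation lx. It is specified only for x in the cylinder of s(l);
  \<open>push\<close> supplies zero elsewhere.\<close>

definition glue :: "'m \<Rightarrow> ('m, 'k) path \<Rightarrow> ('m, 'k) path" where
  "glue l x = (SOME y. y \<in> cyl L l \<and> shift (deg L l) y = x)"

lemma
  assumes l: "l \<in> Mor L" and x: "x \<in> cyl L (src L l)"
  shows glue_cyl: "glue l x \<in> cyl L l" and shift_glue: "shift (deg L l) (glue l x) = x"
proof -
  have x': "x \<in> bpaths L" "src L l = snd x (0, 0)"
    using x by (simp_all add: cyl_vertex[OF l])
  obtain y where "y \<in> bpaths L" "has_segment L y 0 l" "shift (deg L l) y = x"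
    using concat_bpaths[OF fa x'(1) l x'(2)] .
  then have "\<exists>y. y \<in> cyl L l \<and> shift (deg L l) y = x" unfolding cyl_def by blast
  from someI_ex[OF this] show "glue l x \<in> cyl L l" "shift (deg L l) (glue l x) = x"
    unfolding glue_def by blast+
qed

lemma shift_cyl:
  assumes "y \<in> cyl L l"
  shows "shift (deg L l) y \<in> cyl L (src L l)"
proof -
  have l: "l \<in> Mor L" using assms cyl_mor by blast
  have "src L l = rng L (src L l)" "cmp L l (src L l) = l" using l by (simp_all add: rng_src cmp_src)
  then show ?thesis
    using shift_cyl_iff[OF src_closed[OF l] cyl_ge[OF assms]] cyl_eq[OF assms] assms by simp
qed

lemma glue_shift:
  assumes "y \<in> cyl L l"
  shows "glue l (shift (deg L l) y) = y"
proof -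
  have l: "l \<in> Mor L" using assms cyl_mor by blast
  note g = glue_cyl[OF l shift_cyl[OF assms]] shift_glue[OF l shift_cyl[OF assms]]
  show ?thesis
  proof (rule is_path_unique[OF bpaths_is_path bpaths_is_path])
    show "has_segment L (glue l (shift (deg L l) y)) 0 l" "has_segment L y 0 l"
      using g(1) assms by (simp_all add: cyl_def)
  qed (use g assms cyl_bpaths in blast)+
qed

text \<open>Injectivity of the shift on a cylinder: this is what makes fibre sums finite once the
  support is covered by finitely many cylinders.\<close>

lemma fibre_cyl:
  assumes l: "l \<in> Mor L"
  shows "fibre L (deg L l) x \<inter> cyl L l = (if x \<in> cyl L (src L l) then {glue l x} else {})"
proof (intro set_eqI iffI)
  fix y assume "y \<in> fibre L (deg L l) x \<inter> cyl L l"
  then have "y \<in> cyl L l" "shift (deg L l) y = x" by (simp_all add: fibre_def)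
  then show "y \<in> (if x \<in> cyl L (src L l) then {glue l x} else {})"
    using glue_shift[of y l] shift_cyl[of y l] by simp
next
  fix y assume "y \<in> (if x \<in> cyl L (src L l) then {glue l x} else {})"
  then have "x \<in> cyl L (src L l)" "y = glue l x" by (simp_all split: if_splits)
  then show "y \<in> fibre L (deg L l) x \<inter> cyl L l"
    using glue_cyl[OF l, of x] shift_glue[OF l, of x] cyl_ge[of "glue l x" l] by (simp add: fibre_def)
qed

text \<open>If lx begins with m, its initial segment of degree d(l) \<or> d(m) (the join) is a
  minimal common extension of l and m, and x begins with the part after l.\<close>

lemma glue_cyl_iff:
  assumes l: "l \<in> Mor L" and m: "m \<in> Mor L" and x: "x \<in> cyl L (src L l)"
  shows "glue l x \<in> cyl L m \<longleftrightarrow> (\<exists>(\<alpha>, \<beta>)\<in>Lmin L l m. x \<in> cyl L \<alpha>)"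
proof
  let ?y = "glue l x"
  have y: "?y \<in> bpaths L" "is_path ?y" "le_ext (deg L l) (fst ?y)" "snd ?y (0, deg L l) = l"
    using glue_cyl[OF l x] by (auto simp: cyl_def has_segment_def bpaths_is_path)
  {
    assume "?y \<in> cyl L m"
    then have ym: "le_ext (deg L m) (fst ?y)" "snd ?y (0, deg L m) = m"
      by (auto simp: cyl_def has_segment_def)
    define p where "p = sup (deg L l) (deg L m)"
    have p: "le_ext p (fst ?y)" "deg L l \<le> p" "deg L m \<le> p"
      unfolding p_def using le_ext_sup[OF y(3) ym(1)] by simp_all
    let ?a = "snd ?y (deg L l, p)" and ?b = "snd ?y (deg L m, p)"
    have a: "?a \<in> Mor L" "rng L ?a = src L l" "cmp L l ?a = snd ?y (0, p)" "deg L ?a = p - deg L l"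
      using path_closed[OF y(2) p(2,1)] path_rng[OF y(2) p(2,1)] path_src[OF y(2) _ y(3), of 0]
        path_cmp[OF y(2) _ p(2,1), of 0] path_deg[OF y(2) p(2,1)] y(4) by simp_all
    have b: "?b \<in> Mor L" "rng L ?b = src L m" "cmp L m ?b = snd ?y (0, p)"
      using path_closed[OF y(2) p(3,1)] path_rng[OF y(2) p(3,1)] path_src[OF y(2) _ ym(1), of 0]
        path_cmp[OF y(2) _ p(3,1), of 0] ym(2) by simp_all
    have "(?a, ?b) \<in> Lmin L l m"
      unfolding Lmin_def from_vertex_def using a b path_deg[OF y(2) _ p(1), of 0] by (simp add: p_def)
    moreover have "x \<in> cyl L ?a"
    proof -
      have "has_segment L ?y (deg L l) ?a"
        using has_segment_init[OF y(2), of "deg L l" "p - deg L l"] p by simp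
      then show ?thesis
        using has_segment_shift[OF y(3), of 0 ?a] shift_glue[OF l x] x by (simp add: cyl_def)
    qed
    ultimately show "\<exists>(\<alpha>, \<beta>)\<in>Lmin L l m. x \<in> cyl L \<alpha>" by blast
  next
    assume "\<exists>(\<alpha>, \<beta>)\<in>Lmin L l m. x \<in> cyl L \<alpha>"
    then obtain \<alpha> \<beta> where ab: "\<alpha> \<in> Mor L" "\<beta> \<in> Mor L" "src L l = rng L \<alpha>" "src L m = rng L \<beta>"
      "cmp L l \<alpha> = cmp L m \<beta>" and xa: "x \<in> cyl L \<alpha>"
      by (auto simp: Lmin_def from_vertex_def)
    have "has_segment L ?y (deg L l) \<alpha>"
      using has_segment_shift[OF y(3), of 0 \<alpha>] shift_glue[OF l x] xa by (simp add: cyl_def)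
    then have "?y \<in> cyl L (cmp L l \<alpha>)"
      using cyl_cmp[OF l ab(1,3)] glue_cyl[OF l x] by simp
    then show "?y \<in> cyl L m" using cyl_cmp[OF m ab(2,4)] ab(5) by simp
  }
qed

text \<open>By \<open>glue_cyl_iff\<close> the preimage of a cylinder is cut out by a union over
  minimal common extensions; finite alignment makes this union finite, hence closed as well as
  open.\<close>

lemma continuous_glue:
  assumes l: "l \<in> Mor L"
  shows "continuous_map (subtopology (bpath_topology L) (cyl L (src L l))) (bpath_topology L) (glue l)"
proof (rule continuous_map_bpath)
  let ?D = "cyl L (src L l)"
  have top: "topspace (subtopology (bpath_topology L) ?D) = ?D" using cyl_bpaths by auto
  show "glue l x \<in> bpaths L" if "x \<in> topspace (subtopology (bpath_topology L) ?D)" for x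
    using that glue_cyl[OF l] cyl_bpaths unfolding top by blast
  fix m assume m: "m \<in> Mor L"
  have eq: "{x \<in> ?D. glue l x \<in> cyl L m} = ?D \<inter> (\<Union>\<alpha>\<in>fst ` Lmin L l m. cyl L \<alpha>)"
    using glue_cyl_iff[OF l m] by fastforce
  have fin: "finite (fst ` Lmin L l m)" using fa l m by (simp add: finitely_aligned_def)
  have "openin (bpath_topology L) (\<Union>\<alpha>\<in>fst ` Lmin L l m. cyl L \<alpha>)" using openin_cyl by blast
  moreover have "closedin (bpath_topology L) (\<Union>\<alpha>\<in>fst ` Lmin L l m. cyl L \<alpha>)"
    using fin closedin_cyl by (intro closedin_Union) auto
  ultimately show "openin (subtopology (bpath_topology L) ?D)
      {x \<in> topspace (subtopology (bpath_topology L) ?D). glue l x \<in> cyl L m}"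
    "closedin (subtopology (bpath_topology L) ?D)
      {x \<in> topspace (subtopology (bpath_topology L) ?D). glue l x \<in> cyl L m}"
    unfolding top eq by (auto simp: openin_subtopology closedin_subtopology)
qed

end

section \<open>Functions vanishing at infinity\<close>

lemma continuous_map_compose1:
  assumes "continuous_map T euclidean f" "continuous_on UNIV h"
  shows "continuous_map T euclidean (\<lambda>x. h (f x))"
  using continuous_map_compose[OF assms(1), of euclidean h] assms(2) by (simp add: o_def)

lemma continuous_map_compose2:
  assumes "continuous_map T euclidean f" "continuous_map T euclidean g"
    and "continuous_on UNIV (\<lambda>p. h (fst p) (snd p))"
  shows "continuous_map T euclidean (\<lambda>x. h (f x) (g x))"
proof -
  have "continuous_map T (prod_topology euclidean euclidean) (\<lambda>x. (f x, g x))"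
    using assms(1,2) by (intro continuous_map_pairedI)
  then have "continuous_map T euclidean (\<lambda>x. (f x, g x))" by (simp add: euclidean_product_topology)
  from continuous_map_compose1[OF this assms(3)] show ?thesis by simp
qed

text \<open>The open sets U and the complement of K cover the space, and f is continuous on the
  first and zero on the second. The complement of K therefore joins the preimage of W exactly when 0
  lies in W.\<close>

lemma continuous_map_glue_zero:
  fixes f :: "'x \<Rightarrow> complex"
  assumes U: "openin T U" and K: "closedin T K" "K \<subseteq> U"
    and f: "continuous_map (subtopology T U) euclidean f" and 0: "\<And>x. x \<notin> K \<Longrightarrow> f x = 0"
  shows "continuous_map T euclidean f"
  unfolding continuous_map_def
proof (intro conjI allI impI)
  fix W :: "complex set" assume "openin euclidean W"
  then have "openin (subtopology T U) {x \<in> topspace (subtopology T U). f x \<in> W}"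
    using f by (simp add: continuous_map_def)
  then have "openin T {x \<in> topspace (subtopology T U). f x \<in> W}"
    using U by (simp add: openin_open_subtopology)
  moreover have "openin T (if 0 \<in> W then topspace T - K else {})" using K(1) by (simp add: closedin_def)
  ultimately have "openin T ({x \<in> topspace (subtopology T U). f x \<in> W} \<union> (if 0 \<in> W then topspace T - K else {}))"
    by (rule openin_Un)
  moreover have "{x \<in> topspace T. f x \<in> W}
      = {x \<in> topspace (subtopology T U). f x \<in> W} \<union> (if 0 \<in> W then topspace T - K else {})"
  proof (intro set_eqI)
    fix x show "x \<in> {x \<in> topspace T. f x \<in> W}
      \<longleftrightarrow> x \<in> {x \<in> topspace (subtopology T U). f x \<in> W} \<union> (if 0 \<in> W then topspace T - K else {})"
      using 0[of x] K(2) by (cases "x \<in> K") auto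
  qed
  ultimately show "openin T {x \<in> topspace T. f x \<in> W}" by simp
qed simp

section \<open>The C*-algebra structure\<close>

lemma C0_simps [simp]:
  "zer (C0 T) = (\<lambda>x. 0)" "add (C0 T) = (\<lambda>a b x. a x + b x)" "scl (C0 T) = (\<lambda>c a x. c * a x)"
  "mul (C0 T) = (\<lambda>a b x. a x * b x)" "star (C0 T) = (\<lambda>a x. cnj (a x))"
  "nrm (C0 T) = (\<lambda>a. SUP x. cmod (a x))"
  by (simp_all add: C0_def)

lemma C0_continuous: "a \<in> elts (C0 T) \<Longrightarrow> continuous_map T euclidean a"
  by (simp add: C0_def)

lemma C0_zero: "a \<in> elts (C0 T) \<Longrightarrow> x \<notin> topspace T \<Longrightarrow> a x = 0"
  by (simp add: C0_def)

lemma C0_compactin: "a \<in> elts (C0 T) \<Longrightarrow> 0 < \<epsilon> \<Longrightarrow> compactin T {x \<in> topspace T. \<epsilon> \<le> cmod (a x)}"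
  by (simp add: C0_def)

lemma closedin_norm_ge:
  fixes a :: "'x \<Rightarrow> complex"
  assumes "continuous_map T euclidean a"
  shows "closedin T {x \<in> topspace T. \<epsilon> \<le> cmod (a x)}"
proof -
  have "closed {z :: complex. \<epsilon> \<le> cmod z}" by (intro closed_Collect_le continuous_intros)
  then have "closedin T {x \<in> topspace T. a x \<in> {z. \<epsilon> \<le> cmod z}}"
    by (intro closedin_continuous_map_preimage[OF assms]) simp
  then show ?thesis by simp
qed

text \<open>By continuity the sets where \<open>cmod (a x)\<close> is at least \<epsilon> are
  closed, so it is enough to enclose each in a compact set.\<close>

lemma C0I:
  assumes c: "continuous_map T euclidean a" and "\<And>x. x \<notin> topspace T \<Longrightarrow> a x = 0"
    and K: "\<And>\<epsilon>. 0 < \<epsilon> \<Longrightarrow> \<exists>K. compactin T K \<and> (\<forall>x\<in>topspace T. \<epsilon> \<le> cmod (a x) \<longrightarrow> x \<in> K)"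
  shows "a \<in> elts (C0 T)"
proof -
  have "compactin T {x \<in> topspace T. \<epsilon> \<le> cmod (a x)}" if "0 < \<epsilon>" for \<epsilon>
    using K[OF that] closedin_norm_ge[OF c, of \<epsilon>] by (auto intro: closed_compactin)
  with assms(1,2) show ?thesis by (simp add: C0_def)
qed

text \<open>Off the compact set where the modulus is at least 1 the bound is 1; on it, the
  continuous image is compact. Hence the bound \<open>max 1 B\<close>.\<close>

lemma C0_bounded:
  assumes "a \<in> elts (C0 T)"
  obtains B where "0 \<le> B" "\<And>x. cmod (a x) \<le> B"
proof -
  let ?K = "{x \<in> topspace T. 1 \<le> cmod (a x)}"
  have "compactin T ?K" using C0_compactin[OF assms, of 1] by simp
  then have "compactin euclidean (a ` ?K)"
    using image_compactin C0_continuous[OF assms] by blast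
  then have "bounded (a ` ?K)" by (simp add: compact_imp_bounded)
  then obtain B where B: "\<And>x. x \<in> ?K \<Longrightarrow> cmod (a x) \<le> B" unfolding bounded_iff by blast
  have "cmod (a x) \<le> max 1 B" for x
    using B[of x] C0_zero[OF assms, of x] by (cases "x \<in> ?K") auto
  then show ?thesis using that[of "max 1 B"] by simp
qed

lemma C0_nrm:
  assumes "a \<in> elts (C0 T)"
  shows "cmod (a x) \<le> nrm (C0 T) a"
proof -
  obtain B where "\<And>x. cmod (a x) \<le> B" using C0_bounded[OF assms] by blast
  then show ?thesis by (auto intro!: cSUP_upper bdd_aboveI2)
qed

lemma C0_nrm_le: "(\<And>x. cmod (a x) \<le> c) \<Longrightarrow> nrm (C0 T) a \<le> c"
  by (simp add: cSUP_least)

text \<open>Continuity is the uniform limit theorem. For decay, the set where the modulus of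
  \<open>a\<close> is at least \<epsilon> lies in the set where that of an
  (\<epsilon>/2)-approximant is at least \<epsilon>/2.\<close>

lemma C0_uniform_limit:
  assumes "\<And>\<epsilon>. 0 < \<epsilon> \<Longrightarrow> \<exists>b\<in>elts (C0 T). \<forall>x. cmod (a x - b x) \<le> \<epsilon>"
  shows "a \<in> elts (C0 T)"
proof (rule C0I)
  have "\<exists>b. \<forall>n. b n \<in> elts (C0 T) \<and> (\<forall>x. cmod (a x - b n x) \<le> 1 / real (Suc n))"
    using assms[of "1 / real (Suc _)"] by (intro choice) fastforce
  then obtain b where b: "\<And>n. b n \<in> elts (C0 T)" "\<And>n x. cmod (a x - b n x) \<le> 1 / real (Suc n)"
    by blast
  have "\<forall>\<^sub>F n in sequentially. \<forall>x\<in>topspace T. dist (b n x) (a x) < \<epsilon>" if "0 < \<epsilon>" for \<epsilon>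
  proof -
    have "\<forall>\<^sub>F n in sequentially. inverse (real (Suc n)) < \<epsilon>"
      using LIMSEQ_inverse_real_of_nat that by (rule order_tendstoD)
    then show ?thesis
    proof (rule eventually_mono, intro ballI)
      fix n x assume "inverse (real (Suc n)) < \<epsilon>"
      then show "dist (b n x) (a x) < \<epsilon>"
        using b(2)[of x n] unfolding dist_norm norm_minus_commute[of "b n x"] inverse_eq_divide by linarith
    qed
  qed
  then have "continuous_map T Met_TC.mtopology a"
    using C0_continuous[OF b(1)]
    by (intro Met_TC.continuous_map_uniform_limit_alt[where F = sequentially and f = b]) auto
  then show "continuous_map T euclidean a" by simp
  show "a x = 0" if "x \<notin> topspace T" for x
  proof -
    have "cmod (a x) \<le> \<epsilon>" if "0 < \<epsilon>" for \<epsilon>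
    proof -
      obtain c where "c \<in> elts (C0 T)" "cmod (a x - c x) \<le> \<epsilon>" using assms[OF \<open>0 < \<epsilon>\<close>] by blast
      then show ?thesis using C0_zero[of c T x] \<open>x \<notin> topspace T\<close> by simp
    qed
    then have "cmod (a x) \<le> 0 + \<epsilon>" if "0 < \<epsilon>" for \<epsilon> using that by simp
    then have "cmod (a x) \<le> 0" by (rule field_le_epsilon)
    then show ?thesis by simp
  qed
  fix \<epsilon> :: real assume e: "0 < \<epsilon>"
  then obtain c where c: "c \<in> elts (C0 T)" "\<forall>x. cmod (a x - c x) \<le> \<epsilon> / 2"
    using assms[of "\<epsilon> / 2"] by auto
  have "\<epsilon> / 2 \<le> cmod (c x)" if "\<epsilon> \<le> cmod (a x)" for x
  proof -
    have "cmod (a x) \<le> cmod (a x - c x) + cmod (c x)" by (metis diff_add_cancel norm_triangle_ineq)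
    with spec[OF c(2), of x] that show ?thesis by simp
  qed
  then show "\<exists>K. compactin T K \<and> (\<forall>x\<in>topspace T. \<epsilon> \<le> cmod (a x) \<longrightarrow> x \<in> K)"
    using C0_compactin[OF c(1), of "\<epsilon> / 2"] e by (intro exI[of _ "{x \<in> topspace T. \<epsilon> / 2 \<le> cmod (c x)}"]) auto
qed

lemma C0_add:
  assumes a: "a \<in> elts (C0 T)" and b: "b \<in> elts (C0 T)"
  shows "(\<lambda>x. a x + b x) \<in> elts (C0 T)"
proof (rule C0I)
  show "continuous_map T euclidean (\<lambda>x. a x + b x)"
    using C0_continuous[OF a] C0_continuous[OF b]
    by (rule continuous_map_compose2) (intro continuous_intros)
  show "a x + b x = 0" if "x \<notin> topspace T" for x using C0_zero[OF a that] C0_zero[OF b that] by simp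
  fix \<epsilon> :: real assume "0 < \<epsilon>"
  then have "compactin T ({x \<in> topspace T. \<epsilon> / 2 \<le> cmod (a x)} \<union> {x \<in> topspace T. \<epsilon> / 2 \<le> cmod (b x)})"
    using C0_compactin[OF a, of "\<epsilon> / 2"] C0_compactin[OF b, of "\<epsilon> / 2"] by (simp add: compactin_Un)
  moreover have "\<epsilon> / 2 \<le> cmod (a x) \<or> \<epsilon> / 2 \<le> cmod (b x)" if "\<epsilon> \<le> cmod (a x + b x)" for x
    using norm_triangle_ineq[of "a x" "b x"] that by linarith
  ultimately show "\<exists>K. compactin T K \<and> (\<forall>x\<in>topspace T. \<epsilon> \<le> cmod (a x + b x) \<longrightarrow> x \<in> K)" by blast
qed

lemma C0_bounded_mult:
  assumes a: "a \<in> elts (C0 T)" and g: "continuous_map T euclidean g" and B: "\<And>x. x \<in> topspace T \<Longrightarrow> cmod (g x) \<le> B"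
  shows "(\<lambda>x. a x * g x) \<in> elts (C0 T)"
proof (rule C0I)
  show "continuous_map T euclidean (\<lambda>x. a x * g x)"
    using C0_continuous[OF a] g by (rule continuous_map_compose2) (intro continuous_intros)
  show "a x * g x = 0" if "x \<notin> topspace T" for x using C0_zero[OF a that] by simp
  fix \<epsilon> :: real assume e: "0 < \<epsilon>"
  \<comment> \<open>The bound B carries no sign when the space is empty and may be 0; the divisor
    \<open>\<bar>B\<bar> + 1\<close> is positive in every case.\<close>
  have "\<epsilon> / (\<bar>B\<bar> + 1) \<le> cmod (a x)" if "\<epsilon> \<le> cmod (a x * g x)" "x \<in> topspace T" for x
  proof -
    have "cmod (g x) \<le> \<bar>B\<bar> + 1" using B[OF that(2)] by linarith
    then have "cmod (a x) * cmod (g x) \<le> cmod (a x) * (\<bar>B\<bar> + 1)" by (intro mult_left_mono) simp_all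
    then have "\<epsilon> \<le> cmod (a x) * (\<bar>B\<bar> + 1)" using that(1) by (simp add: norm_mult)
    then show ?thesis by (simp add: divide_le_eq)
  qed
  moreover have "compactin T {x \<in> topspace T. \<epsilon> / (\<bar>B\<bar> + 1) \<le> cmod (a x)}"
    using e by (intro C0_compactin[OF a]) simp
  ultimately show "\<exists>K. compactin T K \<and> (\<forall>x\<in>topspace T. \<epsilon> \<le> cmod (a x * g x) \<longrightarrow> x \<in> K)" by blast
qed

lemma C0_mult: "a \<in> elts (C0 T) \<Longrightarrow> b \<in> elts (C0 T) \<Longrightarrow> (\<lambda>x. a x * b x) \<in> elts (C0 T)"
  by (metis C0_bounded C0_bounded_mult C0_continuous)

lemma C0_scale: "a \<in> elts (C0 T) \<Longrightarrow> (\<lambda>x. c * a x) \<in> elts (C0 T)"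
  using C0_bounded_mult[of a T "\<lambda>_. c" "cmod c"] by (simp add: mult.commute)

lemma C0_zero_fun: "(\<lambda>x. 0) \<in> elts (C0 T)"
  by (rule C0I) (auto intro: exI[of _ "{}"])

lemma C0_sum: "finite I \<Longrightarrow> (\<And>i. i \<in> I \<Longrightarrow> a i \<in> elts (C0 T)) \<Longrightarrow> (\<lambda>x. \<Sum>i\<in>I. a i x) \<in> elts (C0 T)"
  by (induction I rule: finite_induct) (simp_all add: C0_zero_fun C0_add)

text \<open>The last premise is continuity of h at 0 in contrapositive form; it puts the level sets
  of the composite inside those of \<open>a\<close>.\<close>

lemma C0_compose:
  assumes a: "a \<in> elts (C0 T)" and h: "continuous_on UNIV h" "h 0 = 0"
    and \<delta>: "\<And>\<epsilon>. 0 < \<epsilon> \<Longrightarrow> \<exists>\<delta>>0. \<forall>z. \<epsilon> \<le> cmod (h z) \<longrightarrow> \<delta> \<le> cmod z"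
  shows "(\<lambda>x. h (a x)) \<in> elts (C0 T)"
proof (rule C0I)
  show "continuous_map T euclidean (\<lambda>x. h (a x))" using continuous_map_compose1[OF C0_continuous[OF a] h(1)] .
  show "h (a x) = 0" if "x \<notin> topspace T" for x using C0_zero[OF a that] h(2) by simp
  fix \<epsilon> :: real assume "0 < \<epsilon>"
  then obtain d where "0 < d" "\<forall>z. \<epsilon> \<le> cmod (h z) \<longrightarrow> d \<le> cmod z" using \<delta> by blast
  then show "\<exists>K. compactin T K \<and> (\<forall>x\<in>topspace T. \<epsilon> \<le> cmod (h (a x)) \<longrightarrow> x \<in> K)"
    using C0_compactin[OF a, of d] by (intro exI[of _ "{x \<in> topspace T. d \<le> cmod (a x)}"]) auto
qed

lemma C0_cnj: "a \<in> elts (C0 T) \<Longrightarrow> (\<lambda>x. cnj (a x)) \<in> elts (C0 T)"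
  by (rule C0_compose[of _ _ cnj]) (auto intro!: continuous_intros)

lemma C0_dif: "dif (C0 T) a b = (\<lambda>x. a x - b x)"
  by (simp add: dif_def)

lemma C0_diff: "a \<in> elts (C0 T) \<Longrightarrow> b \<in> elts (C0 T) \<Longrightarrow> (\<lambda>x. a x - b x) \<in> elts (C0 T)"
  using C0_add[OF _ C0_scale[of b T "- 1"]] by simp

text \<open>The witness is the pointwise square root, and for it a modulus of at least \<epsilon>
  means a modulus of at least the square of \<epsilon> for \<open>a\<close>.\<close>

lemma C0_positive:
  assumes "a \<in> elts (C0 T)" "\<And>x. a x = complex_of_real (f x)" "\<And>x. 0 \<le> f x"
  shows "positive (C0 T) a"
proof -
  let ?h = "\<lambda>z. complex_of_real (sqrt (cmod z))"
  have "(\<lambda>x. ?h (a x)) \<in> elts (C0 T)"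
  proof (rule C0_compose[OF assms(1)])
    show "\<exists>\<delta>>0. \<forall>z. \<epsilon> \<le> cmod (?h z) \<longrightarrow> \<delta> \<le> cmod z" if "0 < \<epsilon>" for \<epsilon>
    proof (intro exI[of _ "\<epsilon>\<^sup>2"] conjI allI impI)
      fix z assume "\<epsilon> \<le> cmod (?h z)"
      then have "\<epsilon> \<le> sqrt (cmod z)" by simp
      then show "\<epsilon>\<^sup>2 \<le> cmod z" using that by (metis less_le_trans norm_ge_zero order_less_imp_le power_mono real_sqrt_pow2)
    qed (use that in simp)
  qed (intro continuous_intros, simp)
  moreover have "a x = cnj (?h (a x)) * ?h (a x)" for x
    using assms(3)[of x] by (simp add: assms(2) flip: of_real_mult)
  ultimately show ?thesis unfolding positive_def by (intro bexI[of _ "\<lambda>x. ?h (a x)"]) auto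
qed

lemma C0_cvspace: "cvspace (C0 T)"
  by unfold_locales
    (simp_all add: C0_zero_fun C0_add C0_scale dif_def algebra_simps)

lemma C0_complete:
  assumes "seq_cauchy (C0 T) (nrm (C0 T)) u"
  shows "\<exists>a. seq_lim (C0 T) (nrm (C0 T)) u a"
proof -
  have u: "u i \<in> elts (C0 T)" for i using assms by (simp add: seq_cauchy_def)
  have M: "\<exists>M. \<forall>i\<ge>M. \<forall>j\<ge>M. \<forall>x. cmod (u i x - u j x) < \<epsilon>" if e: "0 < \<epsilon>" for \<epsilon>
  proof -
    obtain M where "\<forall>i\<ge>M. \<forall>j\<ge>M. nrm (C0 T) (dif (C0 T) (u i) (u j)) < \<epsilon>"
      using assms e unfolding seq_cauchy_def by blast
    moreover have "cmod (u i x - u j x) \<le> nrm (C0 T) (dif (C0 T) (u i) (u j))" for i j x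
      using C0_nrm[OF C0_diff[OF u u]] unfolding C0_dif .
    ultimately show ?thesis by (meson le_less_trans)
  qed
  have "Cauchy (\<lambda>i. u i x)" for x
  proof (rule metric_CauchyI)
    fix e :: real assume "0 < e"
    from M[OF this] show "\<exists>M. \<forall>i\<ge>M. \<forall>j\<ge>M. dist (u i x) (u j x) < e" unfolding dist_norm by blast
  qed
  then have conv: "convergent (\<lambda>i. u i x)" for x by (rule Cauchy_convergent)
  define a where "a x = lim (\<lambda>i. u i x)" for x
  have a: "(\<lambda>i. u i x) \<longlonglongrightarrow> a x" for x using conv[of x] by (simp add: a_def convergent_LIMSEQ_iff)
  have un: "\<exists>M. \<forall>i\<ge>M. \<forall>x. cmod (u i x - a x) \<le> \<epsilon>" if e: "0 < \<epsilon>" for \<epsilon>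
  proof -
    obtain M where N: "\<And>i j x. i \<ge> M \<Longrightarrow> j \<ge> M \<Longrightarrow> cmod (u i x - u j x) < \<epsilon>" using M[OF e] by blast
    have "cmod (u i x - a x) \<le> \<epsilon>" if "i \<ge> M" for i x
    proof (rule LIMSEQ_le_const2)
      show "(\<lambda>j. cmod (u i x - u j x)) \<longlonglongrightarrow> cmod (u i x - a x)" by (intro tendsto_intros a)
      show "\<exists>N. \<forall>j\<ge>N. cmod (u i x - u j x) \<le> \<epsilon>" using N[OF that] by (meson order_less_imp_le)
    qed
    then show ?thesis by blast
  qed
  have "a \<in> elts (C0 T)"
  proof (rule C0_uniform_limit)
    fix \<epsilon> :: real assume "0 < \<epsilon>"
    from un[OF this] obtain i where "\<forall>x. cmod (u i x - a x) \<le> \<epsilon>" by blast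
    then show "\<exists>b\<in>elts (C0 T). \<forall>x. cmod (a x - b x) \<le> \<epsilon>"
      using u[of i] by (intro bexI[of _ "u i"]) (simp_all add: norm_minus_commute)
  qed
  moreover have "(\<lambda>i. nrm (C0 T) (dif (C0 T) (u i) a)) \<longlonglongrightarrow> 0"
  proof (rule LIMSEQ_I)
    fix r :: real assume r: "0 < r"
    then obtain M where N: "\<And>i x. i \<ge> M \<Longrightarrow> cmod (u i x - a x) \<le> r / 2" using un[of "r / 2"] by (metis half_gt_zero)
    have "norm (nrm (C0 T) (dif (C0 T) (u i) a) - 0) < r" if "i \<ge> M" for i
    proof -
      have "nrm (C0 T) (dif (C0 T) (u i) a) \<le> r / 2" unfolding C0_dif by (rule C0_nrm_le) (rule N[OF that])
      moreover have "0 \<le> nrm (C0 T) (dif (C0 T) (u i) a)"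
        using C0_nrm[OF C0_diff[OF u[of i] \<open>a \<in> elts (C0 T)\<close>]] norm_ge_zero order_trans
        unfolding C0_dif by blast
      ultimately show ?thesis using r by (simp del: C0_simps)
    qed
    then show "\<exists>no. \<forall>n\<ge>no. norm (nrm (C0 T) (dif (C0 T) (u n) a) - 0) < r" by blast
  qed
  ultimately show ?thesis unfolding seq_lim_def by blast
qed

lemma C0_cstar_algebra: "cstar_algebra (C0 T)"
proof -
  interpret cvspace "C0 T" by (rule C0_cvspace)
  show ?thesis
  proof (unfold_locales, goal_cases)
    case (12 a)
    then show ?case using C0_nrm[of a T] norm_ge_zero order_trans by blast
  next
    case (13 a)
    show ?case
    proof
      assume "nrm (C0 T) a = 0"
      then have "cmod (a x) \<le> 0" for x using C0_nrm[OF 13, of x] by simp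
      then show "a = zer (C0 T)" by (simp add: fun_eq_iff)
    qed simp
  next
    case (14 a b)
    have "cmod (a x + b x) \<le> nrm (C0 T) a + nrm (C0 T) b" for x
      using norm_triangle_ineq[of "a x" "b x"] C0_nrm[OF 14(1), of x] C0_nrm[OF 14(2), of x] by linarith
    from C0_nrm_le[of "\<lambda>x. a x + b x", OF this] show ?case by simp
  next
    case (15 a z)
    have le: "nrm (C0 T) (\<lambda>x. z * a x) \<le> cmod z * nrm (C0 T) a" if "a \<in> elts (C0 T)" for z a
      using C0_nrm[OF that] by (intro C0_nrm_le) (simp add: norm_mult mult_left_mono)
    show ?case
    proof (cases "z = 0")
      case False
      \<comment> \<open>The reverse inequality is the same estimate with scalar 1/z, applied to the
        function z a.\<close>
      have "nrm (C0 T) a \<le> cmod (1 / z) * nrm (C0 T) (\<lambda>x. z * a x)"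
        using le[OF C0_scale[OF 15, of z], of "1 / z"] False by simp
      then have "cmod z * nrm (C0 T) a \<le> nrm (C0 T) (\<lambda>x. z * a x)"
        using False by (simp add: norm_divide field_simps del: C0_simps)
      with le[OF 15, of z] show ?thesis by simp
    qed simp
  next
    case (16 a b)
    have "cmod (a x * b x) \<le> nrm (C0 T) a * nrm (C0 T) b" for x
      unfolding norm_mult
      by (intro mult_mono C0_nrm[OF 16(1)] C0_nrm[OF 16(2)] norm_ge_zero order_trans[OF norm_ge_zero C0_nrm[OF 16(1)]])
    from C0_nrm_le[of "\<lambda>x. a x * b x", OF this] show ?case by simp
  next
    case (17 a)
    have m: "(\<lambda>x. cnj (a x) * a x) \<in> elts (C0 T)" using C0_mult[OF C0_cnj[OF 17] 17] .
    have n: "cmod (cnj (a x) * a x) = (cmod (a x))\<^sup>2" for x by (simp add: norm_mult power2_eq_square)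
    have a0: "0 \<le> nrm (C0 T) a" using C0_nrm[OF 17] norm_ge_zero order_trans by blast
    have le: "nrm (C0 T) (\<lambda>x. cnj (a x) * a x) \<le> (nrm (C0 T) a)\<^sup>2"
      using C0_nrm[OF 17] by (intro C0_nrm_le) (simp only: n power_mono norm_ge_zero)
    \<comment> \<open>For the other half of the C*-identity the square root is taken pointwise,
      before the supremum.\<close>
    have "(cmod (a x))\<^sup>2 \<le> nrm (C0 T) (\<lambda>x. cnj (a x) * a x)" for x
      using C0_nrm[OF m, of x] unfolding n .
    then have "nrm (C0 T) a \<le> sqrt (nrm (C0 T) (\<lambda>x. cnj (a x) * a x))"
      by (intro C0_nrm_le real_le_rsqrt)
    then have "(nrm (C0 T) a)\<^sup>2 \<le> (sqrt (nrm (C0 T) (\<lambda>x. cnj (a x) * a x)))\<^sup>2" using a0 by (rule power_mono)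
    moreover have "0 \<le> nrm (C0 T) (\<lambda>x. cnj (a x) * a x)" using C0_nrm[OF m] norm_ge_zero order_trans by blast
    ultimately show ?case using le by (simp add: antisym)
  next
    case (18 u)
    then show ?case by (rule C0_complete)
  qed (simp_all add: C0_mult C0_cnj algebra_simps)
qed

section \<open>Compactly supported functions\<close>

text \<open>In a Hausdorff space the compact support is closed, so extension by zero from the open
  set U is continuous on all of T. Compactly supported functions on the domain of a shift can thus
  be treated as functions on the whole path space.\<close>

lemma Cc_open_iff:
  assumes H: "Hausdorff_space T" and U: "openin T U"
  shows "f \<in> Cc (subtopology T U) \<longleftrightarrow>
    continuous_map T euclidean f \<and> (\<exists>K. compactin T K \<and> K \<subseteq> U \<and> (\<forall>x. x \<notin> K \<longrightarrow> f x = 0))"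
proof
  let ?S = "subtopology T U"
  have top: "topspace ?S = U" using U openin_subset by fastforce
  {
    assume f: "f \<in> Cc ?S"
    let ?K = "?S closure_of {x \<in> topspace ?S. f x \<noteq> 0}"
    have K: "compactin T ?K" "?K \<subseteq> U" using f by (simp_all add: Cc_def compactin_subtopology)
    have 0: "f x = 0" if "x \<notin> ?K" for x
      using f that closure_of_subset[of "{x \<in> topspace ?S. f x \<noteq> 0}" ?S] by (auto simp: Cc_def)
    have "continuous_map T euclidean f"
      using continuous_map_glue_zero[OF U compactin_imp_closedin[OF H K(1)] K(2) _ 0] f by (simp add: Cc_def)
    with K 0 show "continuous_map T euclidean f \<and> (\<exists>K. compactin T K \<and> K \<subseteq> U \<and> (\<forall>x. x \<notin> K \<longrightarrow> f x = 0))"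
      by blast
  next
    assume "continuous_map T euclidean f \<and> (\<exists>K. compactin T K \<and> K \<subseteq> U \<and> (\<forall>x. x \<notin> K \<longrightarrow> f x = 0))"
    then obtain K where f: "continuous_map T euclidean f" and K: "compactin T K" "K \<subseteq> U"
      and 0: "\<And>x. x \<notin> K \<Longrightarrow> f x = 0" by blast
    have cK: "compactin ?S K" using K by (simp add: compactin_subtopology)
    then have "closedin ?S K" using H Hausdorff_space_subtopology compactin_imp_closedin by blast
    then have "?S closure_of {x \<in> topspace ?S. f x \<noteq> 0} \<subseteq> K"
      using 0 by (intro closure_of_minimal) auto
    then have "compactin ?S (?S closure_of {x \<in> topspace ?S. f x \<noteq> 0})"
      by (rule closed_compactin[OF cK]) simp
    then show "f \<in> Cc ?S"
      unfolding Cc_def mem_Collect_eq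
      using continuous_map_from_subtopology[OF f, of U] 0 K(2) top by blast
  }
qed

section \<open>The Hilbert bimodules\<close>

lemma Xmod_simps [simp]:
  "zer (Xmod L n) = (\<lambda>x. 0)" "add (Xmod L n) = (\<lambda>f g x. f x + g x)" "scl (Xmod L n) = (\<lambda>c f x. c * f x)"
  "ainner (Xmod L n) = (\<lambda>f g x. \<Sum>\<^sub>\<infinity>y\<in>fibre L n x. cnj (f y) * g y)"
  "ract (Xmod L n) = (\<lambda>f a x. f x * a (shift n x))" "lact (Xmod L n) = (\<lambda>a f x. a x * f x)"
  by (simp_all add: Xmod_def)

lemma Xmod_dif: "dif (Xmod L n) f g = (\<lambda>x. f x - g x)"
  by (simp add: dif_def)

lemma Xmod_zero: "f \<in> elts (Xmod L n) \<Longrightarrow> x \<notin> bpaths_ge L n \<Longrightarrow> f x = 0"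
  by (cases x) (simp add: Xmod_def)

lemma Xmod_approx:
  "f \<in> elts (Xmod L n) \<Longrightarrow> 0 < \<epsilon> \<Longrightarrow> \<exists>g\<in>Cc_ge L n. norm_le L n (\<lambda>y. f y - g y) \<epsilon>"
  by (simp add: Xmod_def)

lemma XmodI:
  "(\<And>x. x \<notin> bpaths_ge L n \<Longrightarrow> f x = 0)
    \<Longrightarrow> (\<And>\<epsilon>. 0 < \<epsilon> \<Longrightarrow> \<exists>g\<in>Cc_ge L n. norm_le L n (\<lambda>y. f y - g y) \<epsilon>) \<Longrightarrow> f \<in> elts (Xmod L n)"
  by (simp add: Xmod_def)

text \<open>The constant for products: if both factors are approximated within d, and d \<le> 1
  bounds the first approximant by a + 1, the error is at most d b + (a + 1) d = d (a + b +
  1).\<close>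

lemma small_factor:
  fixes \<epsilon> a b :: real
  assumes "0 < \<epsilon>" "0 \<le> a" "0 \<le> b"
  obtains d where "0 < d" "d \<le> 1" "d * (a + b + 1) \<le> \<epsilon>"
proof -
  define d where "d = min 1 (\<epsilon> / (a + b + 1))"
  have "0 < a + b + 1" using assms by simp
  moreover have "d \<le> \<epsilon> / (a + b + 1)" by (simp add: d_def)
  ultimately have "d * (a + b + 1) \<le> \<epsilon>" by (simp only: pos_le_divide_eq)
  moreover have "0 < d" "d \<le> 1" using assms by (simp_all add: d_def)
  ultimately show ?thesis by (intro that)
qed

section \<open>Estimates on fibres\<close>

lemma norm_le_mono: "norm_le L n f a \<Longrightarrow> 0 \<le> a \<Longrightarrow> a \<le> b \<Longrightarrow> norm_le L n f b"
  unfolding norm_le_def by (meson order_trans power_mono)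

lemma norm_le_minus_commute: "norm_le L n (\<lambda>y. f y - g y) a \<longleftrightarrow> norm_le L n (\<lambda>y. g y - f y) a"
  by (simp add: norm_le_def norm_minus_commute)

lemma norm_le_mult:
  assumes f: "norm_le L n f a" and g: "\<And>y. y \<in> bpaths_ge L n \<Longrightarrow> cmod (g y) \<le> B" and a: "0 \<le> a" "0 \<le> B"
  shows "norm_le L n (\<lambda>y. f y * g y) (a * B)"
  unfolding norm_le_def
proof (intro allI impI)
  fix x S assume S: "finite S" "S \<subseteq> fibre L n x"
  have "(\<Sum>y\<in>S. (cmod (f y * g y))\<^sup>2) \<le> (\<Sum>y\<in>S. (cmod (f y))\<^sup>2 * B\<^sup>2)"
    unfolding norm_mult power_mult_distrib
  proof (intro sum_mono mult_left_mono power_mono g)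
    show "y \<in> bpaths_ge L n" if "y \<in> S" for y using S(2) that by (auto simp: fibre_def)
  qed simp_all
  also have "\<dots> \<le> a\<^sup>2 * B\<^sup>2"
    unfolding sum_distrib_right[symmetric]
    using f S unfolding norm_le_def by (intro mult_right_mono) (blast, simp)
  finally show "(\<Sum>y\<in>S. (cmod (f y * g y))\<^sup>2) \<le> (a * B)\<^sup>2" by (simp add: power_mult_distrib)
qed

text \<open>Each y is by itself a finite part of the fibre over \<open>shift n y\<close>.
  Convergence in X_n therefore implies pointwise convergence.\<close>

lemma norm_le_pointwise:
  assumes "norm_le L n f a" "0 \<le> a" "y \<in> bpaths_ge L n"
  shows "cmod (f y) \<le> a"
proof -
  have "finite {y}" "{y} \<subseteq> fibre L n (shift n y)" using assms(3) by (simp_all add: fibre_def)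
  then have "(\<Sum>y\<in>{y}. (cmod (f y))\<^sup>2) \<le> a\<^sup>2" using assms(1) unfolding norm_le_def by blast
  then show ?thesis using assms(2) by (simp add: power2_le_iff_abs_le)
qed

lemma norm_le_square_summable:
  assumes "norm_le L n f a"
  shows "(\<lambda>y. (cmod (f y))\<^sup>2) summable_on fibre L n x" "(\<Sum>\<^sub>\<infinity>y\<in>fibre L n x. (cmod (f y))\<^sup>2) \<le> a\<^sup>2"
proof -
  have le: "sum (\<lambda>y. (cmod (f y))\<^sup>2) S \<le> a\<^sup>2" if "finite S" "S \<subseteq> fibre L n x" for S
    using assms that unfolding norm_le_def by blast
  then have "bdd_above (sum (\<lambda>y. (cmod (f y))\<^sup>2) ` {F. F \<subseteq> fibre L n x \<and> finite F})"
    by (intro bdd_aboveI2[of _ _ "a\<^sup>2"]) simp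
  then show s: "(\<lambda>y. (cmod (f y))\<^sup>2) summable_on fibre L n x"
    by (rule nonneg_bdd_above_summable_on[rotated]) simp
  show "(\<Sum>\<^sub>\<infinity>y\<in>fibre L n x. (cmod (f y))\<^sup>2) \<le> a\<^sup>2"
    using s le by (rule infsum_le_finite_sums)
qed

text \<open>The Cauchy-Schwarz inequality on finite subsets of the fibre bounds all partial sums of
  absolute values, which gives absolute summability and the estimate at once.\<close>

lemma norm_le_inner:
  assumes f: "norm_le L n f a" and g: "norm_le L n g b" and ab: "0 \<le> a" "0 \<le> b"
  shows "(\<lambda>y. norm (cnj (f y) * g y)) summable_on fibre L n x"
    and "cmod (\<Sum>\<^sub>\<infinity>y\<in>fibre L n x. cnj (f y) * g y) \<le> a * b"
proof -
  have le: "(\<Sum>y\<in>S. cmod (cnj (f y) * g y)) \<le> a * b" if S: "finite S" "S \<subseteq> fibre L n x" for S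
  proof -
    have "L2_set (\<lambda>y. cmod (h y)) S \<le> c" if "norm_le L n h c" "0 \<le> c" for h c
      using that S unfolding norm_le_def L2_set_def by (intro real_le_lsqrt) blast+
    then have "L2_set (\<lambda>y. cmod (f y)) S * L2_set (\<lambda>y. cmod (g y)) S \<le> a * b"
      using f g ab by (intro mult_mono) (auto simp: L2_set_nonneg)
    moreover have "(\<Sum>y\<in>S. cmod (cnj (f y) * g y)) \<le> L2_set (\<lambda>y. cmod (f y)) S * L2_set (\<lambda>y. cmod (g y)) S"
      using L2_set_mult_ineq[of "\<lambda>y. cmod (f y)" "\<lambda>y. cmod (g y)" S] by (simp add: norm_mult)
    ultimately show ?thesis by linarith
  qed
  then have "bdd_above (sum (\<lambda>y. norm (cnj (f y) * g y)) ` {F. F \<subseteq> fibre L n x \<and> finite F})"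
    by (intro bdd_aboveI2[of _ _ "a * b"]) simp
  then show s: "(\<lambda>y. norm (cnj (f y) * g y)) summable_on fibre L n x"
    by (simp only: abs_summable_iff_bdd_above)
  have "cmod (\<Sum>\<^sub>\<infinity>y\<in>fibre L n x. cnj (f y) * g y) \<le> (\<Sum>\<^sub>\<infinity>y\<in>fibre L n x. cmod (cnj (f y) * g y))"
    using s by (rule norm_infsum_bound)
  also have "\<dots> \<le> a * b" using s le by (rule infsum_le_finite_sums)
  finally show "cmod (\<Sum>\<^sub>\<infinity>y\<in>fibre L n x. cnj (f y) * g y) \<le> a * b" .
qed

text \<open>If the squares are not summable, both infinite sums take the default value 0.\<close>

lemma inner_self: "(\<Sum>\<^sub>\<infinity>y\<in>S. cnj (f y) * f y) = complex_of_real (\<Sum>\<^sub>\<infinity>y\<in>S. (cmod (f y))\<^sup>2)"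
proof -
  have "cnj (f y) * f y = complex_of_real ((cmod (f y))\<^sup>2)" for y
    by (metis complex_norm_square mult.commute)
  then have eq: "(\<lambda>y. cnj (f y) * f y) = (\<lambda>y. complex_of_real ((cmod (f y))\<^sup>2))" by (rule ext)
  show ?thesis
  proof (cases "(\<lambda>y. (cmod (f y))\<^sup>2) summable_on S")
    case True
    then show ?thesis unfolding eq by (intro infsumI has_sum_of_real has_sum_infsum)
  next
    case False
    then have "\<not> (\<lambda>y. complex_of_real ((cmod (f y))\<^sup>2)) summable_on S"
      using summable_on_Re by fastforce
    with False show ?thesis unfolding eq by (simp add: infsum_not_exists)
  qed
qed

context fa_kgraph
begin

section \<open>Compactly supported functions and finite fibre sums\<close>

lemma Cc_ge_iff:
  "f \<in> Cc_ge L n \<longleftrightarrow> continuous_map (bpath_topology L) euclidean f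
    \<and> (\<exists>K. compactin (bpath_topology L) K \<and> K \<subseteq> bpaths_ge L n \<and> (\<forall>x. x \<notin> K \<longrightarrow> f x = 0))"
  unfolding Cc_ge_def by (rule Cc_open_iff[OF Hausdorff_bpath openin_bpaths_ge])

lemma Cc_geE:
  assumes "f \<in> Cc_ge L n"
  obtains K where "continuous_map (bpath_topology L) euclidean f" "compactin (bpath_topology L) K"
    "K \<subseteq> bpaths_ge L n" "\<And>x. x \<notin> K \<Longrightarrow> f x = 0"
  using assms unfolding Cc_ge_iff by blast

lemma Cc_ge_compact:
  assumes "f \<in> Cc_ge L n"
  obtains K where "compactin (bpath_topology L) K" "K \<subseteq> bpaths_ge L n" "\<And>x. x \<notin> K \<Longrightarrow> f x = 0"
  using assms unfolding Cc_ge_iff by blast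

lemma closedin_compactin: "compactin (bpath_topology L) K \<Longrightarrow> closedin (bpath_topology L) K"
  using compactin_imp_closedin Hausdorff_bpath by blast

lemma Cc_ge_C0: "f \<in> Cc_ge L n \<Longrightarrow> f \<in> elts (C0 (bpath_topology L))"
proof (elim Cc_geE, rule C0I)
  fix K x assume "K \<subseteq> bpaths_ge L n" "\<And>x. x \<notin> K \<Longrightarrow> f x = 0" "x \<notin> topspace (bpath_topology L)"
  then show "f x = 0" using bpaths_ge_sub[of n] unfolding topspace_bpath by blast
next
  fix K and \<epsilon> :: real assume K: "compactin (bpath_topology L) K" "\<And>x. x \<notin> K \<Longrightarrow> f x = 0" and e: "0 < \<epsilon>"
  have "x \<in> K" if "\<epsilon> \<le> cmod (f x)" for x using K(2)[of x] that e by (cases "x \<in> K") simp_all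
  then show "\<exists>K. compactin (bpath_topology L) K \<and> (\<forall>x\<in>topspace (bpath_topology L). \<epsilon> \<le> cmod (f x) \<longrightarrow> x \<in> K)"
    using K(1) by blast
qed

lemma Cc_ge_zero: "f \<in> Cc_ge L n \<Longrightarrow> x \<notin> bpaths_ge L n \<Longrightarrow> f x = 0"
  by (elim Cc_geE) blast

lemma Cc_ge_zero_fun: "(\<lambda>x. 0) \<in> Cc_ge L n"
  unfolding Cc_ge_iff by (auto intro: exI[of _ "{}"])

lemma Cc_ge_add:
  assumes "f \<in> Cc_ge L n" "g \<in> Cc_ge L n"
  shows "(\<lambda>x. f x + g x) \<in> Cc_ge L n"
proof -
  obtain K where K: "continuous_map (bpath_topology L) euclidean f" "compactin (bpath_topology L) K"
    "K \<subseteq> bpaths_ge L n" "\<And>x. x \<notin> K \<Longrightarrow> f x = 0" using Cc_geE[OF assms(1)] by blast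
  obtain M where M: "continuous_map (bpath_topology L) euclidean g" "compactin (bpath_topology L) M"
    "M \<subseteq> bpaths_ge L n" "\<And>x. x \<notin> M \<Longrightarrow> g x = 0" using Cc_geE[OF assms(2)] by blast
  have "continuous_map (bpath_topology L) euclidean (\<lambda>x. f x + g x)"
    using K(1) M(1) by (rule continuous_map_compose2) (intro continuous_intros)
  then show ?thesis unfolding Cc_ge_iff
    using K M by (intro conjI exI[of _ "K \<union> M"]) (simp_all add: compactin_Un)
qed

lemma Cc_ge_mult:
  assumes f: "f \<in> Cc_ge L n"
    and g: "continuous_map (subtopology (bpath_topology L) (bpaths_ge L n)) euclidean g"
  shows "(\<lambda>x. f x * g x) \<in> Cc_ge L n"
proof -
  obtain K where K: "continuous_map (bpath_topology L) euclidean f" "compactin (bpath_topology L) K"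
    "K \<subseteq> bpaths_ge L n" "\<And>x. x \<notin> K \<Longrightarrow> f x = 0" using Cc_geE[OF f] by blast
  have "continuous_map (subtopology (bpath_topology L) (bpaths_ge L n)) euclidean (\<lambda>x. f x * g x)"
    using continuous_map_from_subtopology[OF K(1)] g
    by (rule continuous_map_compose2) (intro continuous_intros)
  then have "continuous_map (bpath_topology L) euclidean (\<lambda>x. f x * g x)"
    by (rule continuous_map_glue_zero[OF openin_bpaths_ge closedin_compactin[OF K(2)] K(3)]) (simp add: K(4))
  then show ?thesis unfolding Cc_ge_iff using K(2-4) by (intro conjI exI[of _ K]) simp_all
qed

lemma compact_cyl_cover:
  assumes K: "compactin (bpath_topology L) K" "K \<subseteq> bpaths_ge L n"
  obtains M where "finite M" "M \<subseteq> {l \<in> Mor L. deg L l = n}" "K \<subseteq> (\<Union>l\<in>M. cyl L l)"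
proof -
  let ?U = "cyl L ` {l \<in> Mor L. deg L l = n}"
  have "Ball ?U (openin (bpath_topology L))" "K \<subseteq> \<Union> ?U"
    using openin_cyl K(2) unfolding bpaths_ge_eq_Union by auto
  then obtain F where "finite F" "F \<subseteq> ?U" "K \<subseteq> \<Union> F"
    using K(1) unfolding compactin_def by meson
  then obtain M where "M \<subseteq> {l \<in> Mor L. deg L l = n}" "finite M" "F = cyl L ` M"
    by (meson finite_subset_image)
  with \<open>K \<subseteq> \<Union> F\<close> show ?thesis using that by blast
qed

text \<open>Transport of f from the cylinder of l to that of s(l) along the shift homeomorphism,
  extended by zero.\<close>

definition push :: "'m \<Rightarrow> (('m, 'k) path \<Rightarrow> complex) \<Rightarrow> ('m, 'k) path \<Rightarrow> complex" where
  "push l f x = (if x \<in> cyl L (src L l) then f (glue l x) else 0)"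

text \<open>The compact set is the shifted image of the part of the support in the cylinder of l;
  that part is compact because the cylinder is closed.\<close>

lemma push_compact:
  assumes f: "f \<in> Cc_ge L (deg L l + n)" and l: "l \<in> Mor L"
  obtains K where "compactin (bpath_topology L) K" "K \<subseteq> bpaths_ge L n" "\<And>x. x \<notin> K \<Longrightarrow> push l f x = 0"
proof -
  obtain K where K: "compactin (bpath_topology L) K" "K \<subseteq> bpaths_ge L (deg L l + n)" "\<And>x. x \<notin> K \<Longrightarrow> f x = 0"
    using Cc_ge_compact[OF f] by blast
  have "compactin (bpath_topology L) (K \<inter> cyl L l)"
    using compact_Int_closedin[OF K(1) closedin_cyl] .
  then have "compactin (subtopology (bpath_topology L) (bpaths_ge L (deg L l))) (K \<inter> cyl L l)"
    unfolding compactin_subtopology using K(2) bpaths_ge_add by blast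
  then have "compactin (bpath_topology L) (shift (deg L l) ` (K \<inter> cyl L l))"
    using continuous_shift by (rule image_compactin)
  moreover have "shift (deg L l) ` (K \<inter> cyl L l) \<subseteq> bpaths_ge L n" using K(2) bpaths_ge_add by blast
  moreover have "push l f x = 0" if "x \<notin> shift (deg L l) ` (K \<inter> cyl L l)" for x
  proof (cases "x \<in> cyl L (src L l)")
    case True
    have "glue l x \<notin> K"
    proof
      assume "glue l x \<in> K"
      then have "glue l x \<in> K \<inter> cyl L l" using glue_cyl[OF l True] by blast
      then have "shift (deg L l) (glue l x) \<in> shift (deg L l) ` (K \<inter> cyl L l)" by (rule imageI)
      with that show False by (simp only: shift_glue[OF l True])
    qed
    then show ?thesis using K(3)[of "glue l x"] by (simp add: push_def)
  qed (simp add: push_def)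
  ultimately show ?thesis by (rule that)
qed

lemma push_continuous:
  assumes f: "continuous_map (bpath_topology L) euclidean f" and l: "l \<in> Mor L"
  shows "continuous_map (bpath_topology L) euclidean (push l f)"
proof (rule continuous_map_glue_zero[OF openin_cyl closedin_cyl order_refl])
  have "continuous_map (subtopology (bpath_topology L) (cyl L (src L l))) euclidean (f \<circ> glue l)"
    using continuous_glue[OF l] f by (rule continuous_map_compose)
  then show "continuous_map (subtopology (bpath_topology L) (cyl L (src L l))) euclidean (push l f)"
    by (rule continuous_map_eq) (simp add: push_def)
qed (simp add: push_def)

lemma push_Cc:
  assumes f: "f \<in> Cc_ge L (deg L l + n)" and l: "l \<in> Mor L"
  shows "push l f \<in> Cc_ge L n"
proof -
  have c: "continuous_map (bpath_topology L) euclidean f" using f by (simp add: Cc_ge_iff)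
  have "\<exists>K. compactin (bpath_topology L) K \<and> K \<subseteq> bpaths_ge L n \<and> (\<forall>x. x \<notin> K \<longrightarrow> push l f x = 0)"
    using push_compact[OF f l] by metis
  with push_continuous[OF c l] show ?thesis unfolding Cc_ge_iff by blast
qed

text \<open>The fibre meets each cylinder of M in at most the point lx. Distinct l of degree n give
  distinct points, and where lx does not exist \<open>push l f\<close> contributes 0.\<close>

lemma infsum_fibre:
  assumes M: "finite M" "M \<subseteq> {l \<in> Mor L. deg L l = n}" and 0: "\<And>y. y \<notin> (\<Union>l\<in>M. cyl L l) \<Longrightarrow> f y = 0"
  shows "(\<Sum>\<^sub>\<infinity>y\<in>fibre L n x. f y) = (\<Sum>l\<in>M. push l f x)"
proof -
  let ?M = "{l \<in> M. x \<in> cyl L (src L l)}"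
  have l: "l \<in> Mor L" "deg L l = n" if "l \<in> M" for l using M(2) that by auto
  have inj: "inj_on (\<lambda>l. glue l x) ?M"
  proof (rule inj_onI)
    fix l m assume "l \<in> ?M" "m \<in> ?M" "glue l x = glue m x"
    then show "l = m"
      using cyl_eq[OF glue_cyl[OF l(1)], of l x] cyl_eq[OF glue_cyl[OF l(1)], of m x] l(2)[of l] l(2)[of m] by simp
  qed
  have sub: "glue l x \<in> fibre L n x" if "l \<in> ?M" for l
    using that l[of l] fibre_cyl[of l x] by auto
  have "(\<Sum>\<^sub>\<infinity>y\<in>fibre L n x. f y) = (\<Sum>\<^sub>\<infinity>y\<in>(\<lambda>l. glue l x) ` ?M. f y)"
  proof (rule infsum_cong_neutral)
    fix y assume y: "y \<in> fibre L n x - (\<lambda>l. glue l x) ` ?M"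
    have "y \<notin> cyl L l" if "l \<in> M" for l
      using y that l[OF that] fibre_cyl[of l x] by (auto split: if_splits)
    then show "f y = 0" using 0 by blast
  qed (use sub in auto)
  also have "\<dots> = (\<Sum>l\<in>?M. f (glue l x))"
    using M(1) inj by (simp add: sum.reindex)
  also have "\<dots> = (\<Sum>l\<in>M. push l f x)"
    using M(1) by (simp add: push_def sum.inter_filter)
  finally show ?thesis .
qed

lemma inner_Cc_ge:
  assumes f: "f \<in> Cc_ge L n" and g: "g \<in> Cc_ge L n"
  shows "ainner (Xmod L n) f g \<in> elts (C0 (bpath_topology L))"
proof -
  obtain K where K: "continuous_map (bpath_topology L) euclidean f" "compactin (bpath_topology L) K"
    "K \<subseteq> bpaths_ge L n" "\<And>x. x \<notin> K \<Longrightarrow> f x = 0" using Cc_geE[OF f] by blast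
  obtain M where M: "finite M" "M \<subseteq> {l \<in> Mor L. deg L l = n}" "K \<subseteq> (\<Union>l\<in>M. cyl L l)"
    using compact_cyl_cover[OF K(2,3)] .
  let ?h = "\<lambda>y. cnj (f y) * g y"
  have "continuous_map (subtopology (bpath_topology L) (bpaths_ge L n)) euclidean (\<lambda>y. cnj (f y))"
    using continuous_map_from_subtopology[OF K(1)] by (rule continuous_map_compose1) (intro continuous_intros)
  from Cc_ge_mult[OF g this] have h: "?h \<in> Cc_ge L n" by (simp add: mult.commute)
  have "(\<lambda>x. \<Sum>l\<in>M. push l ?h x) \<in> elts (C0 (bpath_topology L))"
  proof (intro C0_sum M(1) Cc_ge_C0[of _ 0] push_Cc)
    fix l assume "l \<in> M"
    then have "l \<in> Mor L" "deg L l = n" using M(2) by auto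
    with h show "?h \<in> Cc_ge L (deg L l + 0)" "l \<in> Mor L" by simp_all
  qed
  moreover have "(\<Sum>\<^sub>\<infinity>y\<in>fibre L n x. ?h y) = (\<Sum>l\<in>M. push l ?h x)" for x
    using M(3) K(4) by (intro infsum_fibre[OF M(1,2)]) auto
  ultimately show ?thesis by simp
qed

text \<open>Within one fibre, y -> y(0, n) injects the points of the support into the finite cover
  M. So at most \<open>card M\<close> terms occur, each bounded by the square of B.\<close>

lemma Cc_ge_norm_le:
  assumes f: "f \<in> Cc_ge L n"
  obtains c where "0 \<le> c" "norm_le L n f c"
proof -
  obtain K where K: "compactin (bpath_topology L) K" "K \<subseteq> bpaths_ge L n" "\<And>x. x \<notin> K \<Longrightarrow> f x = 0"
    using Cc_ge_compact[OF f] by blast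
  obtain M where M: "finite M" "M \<subseteq> {l \<in> Mor L. deg L l = n}" "K \<subseteq> (\<Union>l\<in>M. cyl L l)"
    using compact_cyl_cover[OF K(1,2)] .
  obtain B where B: "0 \<le> B" "\<And>x. cmod (f x) \<le> B" using C0_bounded[OF Cc_ge_C0[OF f]] by blast
  have "norm_le L n f (sqrt (card M) * B)"
    unfolding norm_le_def
  proof (intro allI impI)
    fix x S assume S: "finite S" "S \<subseteq> fibre L n x"
    have *: "\<exists>l\<in>M. snd y (0, n) = l \<and> y = glue l x" if y: "y \<in> S \<inter> K" for y
    proof -
      obtain l where l: "l \<in> M" "y \<in> cyl L l" using y M(3) by blast
      then have "deg L l = n" "l \<in> Mor L" using M(2) by auto
      then have "y \<in> fibre L (deg L l) x \<inter> cyl L l" using S y l(2) by auto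
      then have "y = glue l x" using fibre_cyl[OF \<open>l \<in> Mor L\<close>, of x] by (auto split: if_splits)
      then show ?thesis using cyl_eq[OF l(2)] l(1) \<open>deg L l = n\<close> by blast
    qed
    have "card (S \<inter> K) \<le> card M"
    proof (rule card_inj_on_le[OF _ _ M(1)])
      show "inj_on (\<lambda>y. snd y (0, n)) (S \<inter> K)" by (rule inj_onI) (metis *)
      show "(\<lambda>y. snd y (0, n)) ` (S \<inter> K) \<subseteq> M" using * by blast
    qed
    have "(\<Sum>y\<in>S. (cmod (f y))\<^sup>2) = (\<Sum>y\<in>S \<inter> K. (cmod (f y))\<^sup>2)"
      using S(1) K(3) by (intro sum.mono_neutral_right) auto
    also have "\<dots> \<le> real (card (S \<inter> K)) * B\<^sup>2"
      by (intro sum_bounded_above power_mono B) simp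
    also have "\<dots> \<le> real (card M) * B\<^sup>2"
      using \<open>card (S \<inter> K) \<le> card M\<close> by (intro mult_right_mono) simp_all
    finally show "(\<Sum>y\<in>S. (cmod (f y))\<^sup>2) \<le> (sqrt (card M) * B)\<^sup>2" by (simp add: power_mult_distrib)
  qed
  then show ?thesis using that[of "sqrt (card M) * B"] B(1) by simp
qed

section \<open>Inner products and actions on X_n\<close>

lemma Xmod_norm_le:
  assumes "f \<in> elts (Xmod L n)"
  obtains c where "0 \<le> c" "norm_le L n f c"
proof -
  obtain g where g: "g \<in> Cc_ge L n" "norm_le L n (\<lambda>y. f y - g y) 1" using Xmod_approx[OF assms, of 1] by auto
  obtain c where c: "0 \<le> c" "norm_le L n g c" using Cc_ge_norm_le[OF g(1)] .
  have "norm_le L n (\<lambda>y. f y - g y + g y) (1 + c)" using g(2) c(2) by (rule norm_le_triangle) (use c in simp_all)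
  then show ?thesis using that[of "1 + c"] c(1) by simp
qed

lemma Cc_ge_Xmod: "f \<in> Cc_ge L n \<Longrightarrow> f \<in> elts (Xmod L n)"
  by (rule XmodI) (auto simp: Cc_ge_zero norm_le_def intro!: bexI[of _ f])

lemma Xmod_add:
  assumes "f \<in> elts (Xmod L n)" "g \<in> elts (Xmod L n)"
  shows "(\<lambda>x. f x + g x) \<in> elts (Xmod L n)"
proof (rule XmodI)
  show "f x + g x = 0" if "x \<notin> bpaths_ge L n" for x using assms that by (simp add: Xmod_zero)
  fix \<epsilon> :: real assume "0 < \<epsilon>"
  then obtain f' g' where f': "f' \<in> Cc_ge L n" "norm_le L n (\<lambda>y. f y - f' y) (\<epsilon> / 2)"
    and g': "g' \<in> Cc_ge L n" "norm_le L n (\<lambda>y. g y - g' y) (\<epsilon> / 2)"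
    using Xmod_approx[OF assms(1), of "\<epsilon> / 2"] Xmod_approx[OF assms(2), of "\<epsilon> / 2"] by auto
  have "norm_le L n (\<lambda>y. (f y - f' y) + (g y - g' y)) (\<epsilon> / 2 + \<epsilon> / 2)"
    using f'(2) g'(2) by (rule norm_le_triangle) (use \<open>0 < \<epsilon>\<close> in simp_all)
  moreover have "(f y - f' y) + (g y - g' y) = f y + g y - (f' y + g' y)" for y by simp
  ultimately have "norm_le L n (\<lambda>y. f y + g y - (f' y + g' y)) \<epsilon>" by simp
  then show "\<exists>h\<in>Cc_ge L n. norm_le L n (\<lambda>y. f y + g y - h y) \<epsilon>"
    using Cc_ge_add[OF f'(1) g'(1)] by (intro bexI[of _ "\<lambda>x. f' x + g' x"])
qed

text \<open>Common source of both actions: g is \<open>a\<close> for the left one and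
  \<open>a\<close> composed with the shift for the right one. The divisor B + 1 allows B =
  0.\<close>

lemma Xmod_mult:
  assumes f: "f \<in> elts (Xmod L n)"
    and g: "continuous_map (subtopology (bpath_topology L) (bpaths_ge L n)) euclidean g"
    and B: "\<And>y. y \<in> bpaths_ge L n \<Longrightarrow> cmod (g y) \<le> B" "0 \<le> B"
  shows "(\<lambda>x. f x * g x) \<in> elts (Xmod L n)"
proof (rule XmodI)
  show "f x * g x = 0" if "x \<notin> bpaths_ge L n" for x using f that by (simp add: Xmod_zero)
  fix \<epsilon> :: real assume e: "0 < \<epsilon>"
  then obtain f' where f': "f' \<in> Cc_ge L n" "norm_le L n (\<lambda>y. f y - f' y) (\<epsilon> / (B + 1))"
    using Xmod_approx[OF f, of "\<epsilon> / (B + 1)"] B(2) by auto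
  have "norm_le L n (\<lambda>y. (f y - f' y) * g y) (\<epsilon> / (B + 1) * B)"
    using f'(2) B e by (intro norm_le_mult) simp_all
  moreover have "\<epsilon> / (B + 1) * B \<le> \<epsilon>"
    using mult_left_mono[of B "B + 1" "\<epsilon> / (B + 1)"] e B(2) by simp
  moreover have "0 \<le> \<epsilon> / (B + 1) * B" using e B(2) by simp
  ultimately have "norm_le L n (\<lambda>y. (f y - f' y) * g y) \<epsilon>" by (blast intro: norm_le_mono)
  then show "\<exists>h\<in>Cc_ge L n. norm_le L n (\<lambda>y. f y * g y - h y) \<epsilon>"
    using Cc_ge_mult[OF f'(1) g] by (intro bexI[of _ "\<lambda>x. f' x * g x"]) (simp_all add: left_diff_distrib)
qed

lemma Xmod_scale: "f \<in> elts (Xmod L n) \<Longrightarrow> (\<lambda>x. c * f x) \<in> elts (Xmod L n)"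
  using Xmod_mult[of f n "\<lambda>_. c" "cmod c"] by (simp add: mult.commute)

lemma Xmod_diff: "f \<in> elts (Xmod L n) \<Longrightarrow> g \<in> elts (Xmod L n) \<Longrightarrow> (\<lambda>x. f x - g x) \<in> elts (Xmod L n)"
  using Xmod_add[OF _ Xmod_scale[of g n "- 1"]] by simp

lemma Xmod_lact:
  assumes a: "a \<in> elts (C0 (bpath_topology L))" and f: "f \<in> elts (Xmod L n)"
  shows "(\<lambda>x. a x * f x) \<in> elts (Xmod L n)"
proof -
  obtain B where "0 \<le> B" "\<And>x. cmod (a x) \<le> B" using C0_bounded[OF a] by blast
  then have "(\<lambda>x. f x * a x) \<in> elts (Xmod L n)"
    using continuous_map_from_subtopology[OF C0_continuous[OF a]] by (intro Xmod_mult[OF f]) auto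
  then show ?thesis by (simp add: mult.commute)
qed

lemma Xmod_ract:
  assumes a: "a \<in> elts (C0 (bpath_topology L))" and f: "f \<in> elts (Xmod L n)"
  shows "(\<lambda>x. f x * a (shift n x)) \<in> elts (Xmod L n)"
proof -
  obtain B where B: "0 \<le> B" "\<And>x. cmod (a x) \<le> B" using C0_bounded[OF a] by blast
  have "continuous_map (subtopology (bpath_topology L) (bpaths_ge L n)) euclidean (a \<circ> shift n)"
    using continuous_shift C0_continuous[OF a] by (rule continuous_map_compose)
  then show ?thesis using B by (intro Xmod_mult[OF f]) (auto simp: o_def)
qed

lemma Xmod_summable:
  assumes "f \<in> elts (Xmod L n)" "g \<in> elts (Xmod L n)"
  shows "(\<lambda>y. norm (cnj (f y) * g y)) summable_on fibre L n x"
proof -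
  obtain a where a: "0 \<le> a" "norm_le L n f a" using Xmod_norm_le[OF assms(1)] .
  obtain b where b: "0 \<le> b" "norm_le L n g b" using Xmod_norm_le[OF assms(2)] .
  show ?thesis by (rule norm_le_inner(1)[OF a(2) b(2) a(1) b(1)])
qed

lemma Xmod_summable':
  assumes "f \<in> elts (Xmod L n)" "g \<in> elts (Xmod L n)"
  shows "(\<lambda>y. cnj (f y) * g y) summable_on fibre L n x"
  using Xmod_summable[OF assms] by (rule Infinite_Sum.abs_summable_summable)

text \<open>The difference is \<langle>f - f', g\<rangle> + \<langle>f', g - g'\<rangle>, so the
  bounds taken are those of g and of f'.\<close>

lemma inner_diff_bound:
  assumes f: "f \<in> elts (Xmod L n)" "f' \<in> elts (Xmod L n)" and g: "g \<in> elts (Xmod L n)" "g' \<in> elts (Xmod L n)"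
    and a: "norm_le L n (\<lambda>y. f y - f' y) d" "norm_le L n f' a" and b: "norm_le L n (\<lambda>y. g y - g' y) e" "norm_le L n g b"
    and pos: "0 \<le> d" "0 \<le> a" "0 \<le> e" "0 \<le> b"
  shows "cmod (ainner (Xmod L n) f g x - ainner (Xmod L n) f' g' x) \<le> d * b + a * e"
proof -
  let ?S = "\<lambda>h. \<Sum>\<^sub>\<infinity>y\<in>fibre L n x. h y"
  have "?S (\<lambda>y. cnj (f y) * g y)
      = ?S (\<lambda>y. cnj (f' y) * g' y + (cnj (f y - f' y) * g y + cnj (f' y) * (g y - g' y)))"
    by (intro infsum_cong) (simp add: algebra_simps)
  also have "\<dots> = ?S (\<lambda>y. cnj (f' y) * g' y) + ?S (\<lambda>y. cnj (f y - f' y) * g y + cnj (f' y) * (g y - g' y))"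
    by (intro infsum_add summable_on_add Xmod_summable' f g Xmod_diff)
  also have "?S (\<lambda>y. cnj (f y - f' y) * g y + cnj (f' y) * (g y - g' y))
      = ?S (\<lambda>y. cnj (f y - f' y) * g y) + ?S (\<lambda>y. cnj (f' y) * (g y - g' y))"
    by (intro infsum_add Xmod_summable' f g Xmod_diff)
  finally have "ainner (Xmod L n) f g x - ainner (Xmod L n) f' g' x
      = ?S (\<lambda>y. cnj (f y - f' y) * g y) + ?S (\<lambda>y. cnj (f' y) * (g y - g' y))" by simp
  also have "cmod \<dots> \<le> d * b + a * e"
    using norm_le_inner(2)[OF a(1) b(2) pos(1,4)] norm_le_inner(2)[OF a(2) b(1) pos(2,3)]
    by (intro norm_triangle_le add_mono)
  finally show ?thesis .
qed

lemma inner_Xmod: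
  assumes f: "f \<in> elts (Xmod L n)" and g: "g \<in> elts (Xmod L n)"
  shows "ainner (Xmod L n) f g \<in> elts (C0 (bpath_topology L))"
proof (rule C0_uniform_limit)
  fix \<epsilon> :: real assume e: "0 < \<epsilon>"
  obtain a where a: "0 \<le> a" "norm_le L n f a" using Xmod_norm_le[OF f] .
  obtain b where b: "0 \<le> b" "norm_le L n g b" using Xmod_norm_le[OF g] .
  obtain d where d: "0 < d" "d \<le> 1" "d * (a + b + 1) \<le> \<epsilon>"
    using small_factor[OF e a(1) b(1)] .
  obtain f' where f': "f' \<in> Cc_ge L n" "norm_le L n (\<lambda>y. f y - f' y) d" using Xmod_approx[OF f d(1)] by blast
  obtain g' where g': "g' \<in> Cc_ge L n" "norm_le L n (\<lambda>y. g y - g' y) d" using Xmod_approx[OF g d(1)] by blast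
  have "norm_le L n (\<lambda>y. f' y - f y + f y) (d + a)"
    using norm_le_minus_commute[THEN iffD1, OF f'(2)] a(2)
    by (rule norm_le_triangle) (use a d in simp_all)
  then have "norm_le L n f' (a + d)" by (simp add: add.commute)
  then have nf': "norm_le L n f' (a + 1)" by (rule norm_le_mono) (use d a(1) in simp_all)
  have "cmod (ainner (Xmod L n) f g x - ainner (Xmod L n) f' g' x) \<le> d * b + (a + 1) * d" for x
    using f'(2) nf' g'(2) b(2)
    by (intro inner_diff_bound[OF f Cc_ge_Xmod[OF f'(1)] g Cc_ge_Xmod[OF g'(1)]]) (use d a b in simp_all)
  moreover have "d * b + (a + 1) * d \<le> \<epsilon>" using d(3) by (simp add: algebra_simps)
  ultimately have "cmod (ainner (Xmod L n) f g x - ainner (Xmod L n) f' g' x) \<le> \<epsilon>" for x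
    using order_trans by blast
  then show "\<exists>c\<in>elts (C0 (bpath_topology L)). \<forall>x. cmod (ainner (Xmod L n) f g x - c x) \<le> \<epsilon>"
    using inner_Cc_ge[OF f'(1) g'(1)] by blast
qed

text \<open>With \<open>hnorm_le\<close> this identifies \<open>hnorm\<close> as the least
  nonnegative c with \<open>norm_le L n f c\<close>: finite partial sums lie below the fibre sum,
  which is a value of \<langle>f, f\<rangle>.\<close>

lemma norm_le_hnorm:
  assumes f: "f \<in> elts (Xmod L n)"
  shows "norm_le L n f (hnorm (C0 (bpath_topology L)) (Xmod L n) f)" "0 \<le> hnorm (C0 (bpath_topology L)) (Xmod L n) f"
proof -
  obtain c where c: "0 \<le> c" "norm_le L n f c" using Xmod_norm_le[OF f] .
  note nrm = C0_nrm[OF inner_Xmod[OF f f]]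
  have 0: "0 \<le> nrm (C0 (bpath_topology L)) (ainner (Xmod L n) f f)" using nrm norm_ge_zero order_trans by blast
  then show "0 \<le> hnorm (C0 (bpath_topology L)) (Xmod L n) f" by (simp add: hnorm_def del: C0_simps)
  show "norm_le L n f (hnorm (C0 (bpath_topology L)) (Xmod L n) f)"
    unfolding norm_le_def
  proof (intro allI impI)
    fix x S assume S: "finite S" "S \<subseteq> fibre L n x"
    have "(\<Sum>y\<in>S. (cmod (f y))\<^sup>2) \<le> (\<Sum>\<^sub>\<infinity>y\<in>fibre L n x. (cmod (f y))\<^sup>2)"
      by (intro finite_sum_le_infsum norm_le_square_summable(1)[OF c(2)] S) simp
    also have "\<dots> \<le> cmod (ainner (Xmod L n) f f x)" by (simp add: inner_self)
    also have "\<dots> \<le> nrm (C0 (bpath_topology L)) (ainner (Xmod L n) f f)" by (rule nrm)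
    also have "\<dots> = (hnorm (C0 (bpath_topology L)) (Xmod L n) f)\<^sup>2" using 0 by (simp add: hnorm_def del: C0_simps)
    finally show "(\<Sum>y\<in>S. (cmod (f y))\<^sup>2) \<le> (hnorm (C0 (bpath_topology L)) (Xmod L n) f)\<^sup>2" .
  qed
qed

lemma hnorm_le:
  assumes "norm_le L n f c" "0 \<le> c"
  shows "hnorm (C0 (bpath_topology L)) (Xmod L n) f \<le> c"
proof -
  have "cmod (ainner (Xmod L n) f f x) \<le> c\<^sup>2" for x
    using norm_le_inner(2)[OF assms(1,1,2,2), of x] by (simp add: power2_eq_square)
  then have "nrm (C0 (bpath_topology L)) (ainner (Xmod L n) f f) \<le> c\<^sup>2" by (rule C0_nrm_le)
  then show ?thesis using assms(2) by (simp add: hnorm_def real_le_lsqrt del: C0_simps)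
qed

lemma Xmod_hnorm_complete:
  assumes "seq_cauchy (Xmod L n) (hnorm (C0 (bpath_topology L)) (Xmod L n)) u"
  shows "\<exists>f. seq_lim (Xmod L n) (hnorm (C0 (bpath_topology L)) (Xmod L n)) u f"
proof -
  let ?N = "hnorm (C0 (bpath_topology L)) (Xmod L n)"
  have u: "u i \<in> elts (Xmod L n)" for i using assms by (simp add: seq_cauchy_def)
  have "\<exists>M. \<forall>i\<ge>M. \<forall>j\<ge>M. norm_le L n (\<lambda>y. u i y - u j y) \<epsilon>" if e: "0 < \<epsilon>" for \<epsilon>
  proof -
    obtain M where M: "\<forall>i\<ge>M. \<forall>j\<ge>M. ?N (dif (Xmod L n) (u i) (u j)) < \<epsilon>"
      using assms e unfolding seq_cauchy_def by blast
    have "norm_le L n (\<lambda>y. u i y - u j y) \<epsilon>" if "i \<ge> M" "j \<ge> M" for i j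
      using norm_le_hnorm[OF Xmod_diff[OF u[of i] u[of j]]]
    proof (rule norm_le_mono)
      show "?N (\<lambda>x. u i x - u j x) \<le> \<epsilon>" using M that unfolding Xmod_dif by (simp add: less_imp_le)
    qed
    then show ?thesis by blast
  qed
  then obtain f where f: "f \<in> elts (Xmod L n)" "\<forall>\<epsilon>>0. \<exists>M. \<forall>i\<ge>M. norm_le L n (\<lambda>y. u i y - f y) \<epsilon>"
    using Xmod_complete[of u L n, OF u] by blast
  have "(\<lambda>i. ?N (dif (Xmod L n) (u i) f)) \<longlonglongrightarrow> 0"
  proof (rule LIMSEQ_I)
    fix r :: real assume r: "0 < r"
    then obtain M where M: "\<And>i. i \<ge> M \<Longrightarrow> norm_le L n (\<lambda>y. u i y - f y) (r / 2)"
      using f(2) half_gt_zero by blast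
    have "norm (?N (dif (Xmod L n) (u i) f) - 0) < r" if "i \<ge> M" for i
      using hnorm_le[OF M[OF that]] r norm_le_hnorm(2)[OF Xmod_diff[OF u[of i] f(1)]] by (simp add: Xmod_dif)
    then show "\<exists>no. \<forall>i\<ge>no. norm (?N (dif (Xmod L n) (u i) f) - 0) < r" by blast
  qed
  with f(1) show ?thesis unfolding seq_lim_def by blast
qed

lemma Xmod_cvspace: "cvspace (Xmod L n)"
  by unfold_locales
    (simp_all add: Xmod_add Xmod_scale dif_def algebra_simps Cc_ge_Xmod[OF Cc_ge_zero_fun])

lemma Xmod_definite:
  assumes f: "f \<in> elts (Xmod L n)" and 0: "ainner (Xmod L n) f f = (\<lambda>x. 0)"
  shows "f = (\<lambda>x. 0)"
proof
  fix y
  obtain c where c: "0 \<le> c" "norm_le L n f c" using Xmod_norm_le[OF f] .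
  show "f y = 0"
  proof (cases "y \<in> bpaths_ge L n")
    case True
    then have y: "y \<in> fibre L n (shift n y)" by (simp add: fibre_def)
    have "(\<Sum>y\<in>{y}. (cmod (f y))\<^sup>2) \<le> (\<Sum>\<^sub>\<infinity>y\<in>fibre L n (shift n y). (cmod (f y))\<^sup>2)"
      using y by (intro finite_sum_le_infsum norm_le_square_summable(1)[OF c(2)]) auto
    also have "\<dots> = 0" using fun_cong[OF 0, of "shift n y"] by (simp add: inner_self)
    finally show ?thesis by simp
  qed (simp add: Xmod_zero[OF f])
qed

lemma Xmod_hilbert_bimodule: "hilbert_bimodule (C0 (bpath_topology L)) (Xmod L n)"
proof -
  interpret cstar_algebra "C0 (bpath_topology L)" by (rule C0_cstar_algebra)
  interpret E: cvspace "Xmod L n" by (rule Xmod_cvspace)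
  show ?thesis
  proof (unfold_locales, goal_cases)
    case (1 x a) then show ?case by (simp add: Xmod_ract)
  next
    case (7 x y) then show ?case by (rule inner_Xmod)
  next
    case (8 f g h)
    then show ?case by (simp add: distrib_left infsum_add[OF Xmod_summable' Xmod_summable'])
  next
    case (9 f g z)
    have "(\<Sum>\<^sub>\<infinity>y\<in>fibre L n x. cnj (f y) * (z * g y)) = z * (\<Sum>\<^sub>\<infinity>y\<in>fibre L n x. cnj (f y) * g y)" for x
      using infsum_cmult_right'[of z "\<lambda>y. cnj (f y) * g y" "fibre L n x"] by (simp add: mult.left_commute)
    then show ?case by simp
  next
    case (10 f g a)
    \<comment> \<open>On the fibre over x the right action multiplies by the constant
      \<open>a x\<close>.\<close>
    have "(\<Sum>\<^sub>\<infinity>y\<in>fibre L n x. cnj (f y) * (g y * a (shift n y))) = (\<Sum>\<^sub>\<infinity>y\<in>fibre L n x. cnj (f y) * g y * a x)" for x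
      by (rule infsum_cong) (simp add: fibre_def)
    then show ?case by (simp add: infsum_cmult_left')
  next
    case (11 f g)
    have "cnj (\<Sum>\<^sub>\<infinity>y\<in>fibre L n x. cnj (f y) * g y) = (\<Sum>\<^sub>\<infinity>y\<in>fibre L n x. cnj (g y) * f y)" for x
      unfolding infsum_cnj[symmetric] by (simp add: mult.commute)
    then show ?case by simp
  next
    case (12 f)
    show ?case
      by (rule C0_positive[OF inner_Xmod[OF 12 12]]) (auto simp: inner_self intro: infsum_nonneg)
  next
    case (13 f) then show ?case using Xmod_definite[of f n] by simp
  next
    case (14 u) then show ?case by (rule Xmod_hnorm_complete)
  next
    case (15 a f) then show ?case by (simp add: Xmod_lact)
  qed (simp_all add: algebra_simps)
qed

end

section \<open>Multiplication\<close>

definition tmul :: "('k \<Rightarrow> nat) \<Rightarrow> (('m, 'k) path \<Rightarrow> complex) \<Rightarrow> (('m, 'k) path \<Rightarrow> complex)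
    \<Rightarrow> ('m, 'k) path \<Rightarrow> complex" where
  "tmul m f g x = f x * g (shift m x)"

text \<open>The modulus of \<open>csplit z\<close> is the square root of that of z, so the
  convention that division by 0 gives 0 yields the continuous value at 0.\<close>

definition csplit :: "complex \<Rightarrow> complex" where
  "csplit z = z / complex_of_real (sqrt (cmod z))"

lemma csplit_mult: "csplit z * complex_of_real (sqrt (cmod z)) = z"
  by (simp add: csplit_def)

lemma csplit_0 [simp]: "csplit 0 = 0"
  by (simp add: csplit_def)

lemma continuous_csplit: "continuous_on UNIV csplit"
proof (rule continuous_at_imp_continuous_on, intro ballI)
  fix z :: complex
  show "isCont csplit z"
  proof (cases "z = 0")
    case True
    have n: "norm (csplit w) = sqrt (cmod w)" for w
      by (simp add: csplit_def norm_divide real_div_sqrt)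
    have "((\<lambda>w. sqrt (cmod w)) \<longlongrightarrow> sqrt (cmod 0)) (at 0)" by (intro tendsto_intros)
    then have "((\<lambda>w. norm (csplit w)) \<longlongrightarrow> 0) (at 0)" by (simp only: n norm_zero real_sqrt_zero)
    then have "(csplit \<longlongrightarrow> 0) (at 0)" by (simp only: tendsto_norm_zero_iff)
    then show ?thesis using True by (simp add: isCont_def)
  next
    case False
    then show ?thesis unfolding csplit_def by (intro continuous_intros) simp_all
  qed
qed

text \<open>Group the points of S by their image z under \<open>shift m\<close>: each group
  contributes at most the square of \<open>a\<close> times that of \<open>cmod (g z)\<close>, and
  the z lie in one fibre of \<open>shift n\<close>. The premise \<open>fib\<close> is the half of
  \<open>fibre_add\<close> that this grouping uses.\<close>

lemma norm_le_tmul: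
  assumes f: "norm_le L m f a" and g: "norm_le L n g b" and 0: "0 \<le> a" "0 \<le> b"
    and fib: "\<And>x y. y \<in> fibre L (m + n) x \<Longrightarrow> y \<in> bpaths_ge L m \<and> shift m y \<in> fibre L n x"
  shows "norm_le L (m + n) (tmul m f g) (a * b)"
  unfolding norm_le_def
proof (intro allI impI)
  fix x S assume S: "finite S" "S \<subseteq> fibre L (m + n) x"
  have "(\<Sum>y\<in>S. (cmod (tmul m f g y))\<^sup>2)
      = (\<Sum>z\<in>shift m ` S. \<Sum>y\<in>{y \<in> S. shift m y = z}. (cmod (tmul m f g y))\<^sup>2)"
    using S(1) by (rule sum.image_gen)
  also have "\<dots> = (\<Sum>z\<in>shift m ` S. (\<Sum>y\<in>{y \<in> S. shift m y = z}. (cmod (f y))\<^sup>2) * (cmod (g z))\<^sup>2)"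
    unfolding sum_distrib_right
    by (intro sum.cong refl) (auto simp: tmul_def norm_mult power_mult_distrib)
  also have "\<dots> \<le> (\<Sum>z\<in>shift m ` S. a\<^sup>2 * (cmod (g z))\<^sup>2)"
  proof (intro sum_mono mult_right_mono)
    fix z
    have "finite {y \<in> S. shift m y = z}" using S(1) by simp
    moreover have "{y \<in> S. shift m y = z} \<subseteq> fibre L m z"
    proof
      fix y assume "y \<in> {y \<in> S. shift m y = z}"
      then show "y \<in> fibre L m z" using fib[of y x] S(2) unfolding fibre_def by blast
    qed
    ultimately show "(\<Sum>y\<in>{y \<in> S. shift m y = z}. (cmod (f y))\<^sup>2) \<le> a\<^sup>2"
      using f unfolding norm_le_def by blast
  qed simp
  also have "\<dots> = a\<^sup>2 * (\<Sum>z\<in>shift m ` S. (cmod (g z))\<^sup>2)" by (simp add: sum_distrib_left)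
  also have "\<dots> \<le> a\<^sup>2 * b\<^sup>2"
  proof (intro mult_left_mono)
    have "finite (shift m ` S)" "shift m ` S \<subseteq> fibre L n x" using S fib by blast+
    then show "(\<Sum>z\<in>shift m ` S. (cmod (g z))\<^sup>2) \<le> b\<^sup>2" using g unfolding norm_le_def by blast
  qed simp
  finally show "(\<Sum>y\<in>S. (cmod (tmul m f g y))\<^sup>2) \<le> (a * b)\<^sup>2" by (simp add: power_mult_distrib)
qed

context fa_kgraph
begin

text \<open>The factor g composed with the shift is continuous only on the domain of
  \<open>shift m\<close>; the compact support of f there permits extension by zero. The product is
  supported in the part of K that the shift maps into M, a closed subset of K.\<close>

lemma tmul_Cc:
  assumes f: "f \<in> Cc_ge L m" and g: "g \<in> Cc_ge L n"
  shows "tmul m f g \<in> Cc_ge L (m + n)"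
proof -
  let ?T = "bpath_topology L"
  let ?S = "subtopology ?T (bpaths_ge L m)"
  obtain K where K: "continuous_map ?T euclidean f" "compactin ?T K" "K \<subseteq> bpaths_ge L m"
    "\<And>x. x \<notin> K \<Longrightarrow> f x = 0" using Cc_geE[OF f] by blast
  obtain M where M: "continuous_map ?T euclidean g" "compactin ?T M" "M \<subseteq> bpaths_ge L n"
    "\<And>x. x \<notin> M \<Longrightarrow> g x = 0" using Cc_geE[OF g] by blast
  have "continuous_map ?S euclidean (g \<circ> shift m)"
    using continuous_shift M(1) by (rule continuous_map_compose)
  with continuous_map_from_subtopology[OF K(1)] have "continuous_map ?S euclidean (\<lambda>x. f x * (g \<circ> shift m) x)"
    by (rule continuous_map_compose2) (intro continuous_intros)
  then have "continuous_map ?S euclidean (tmul m f g)" by (simp add: tmul_def[abs_def])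
  then have c: "continuous_map ?T euclidean (tmul m f g)"
    by (rule continuous_map_glue_zero[OF openin_bpaths_ge closedin_compactin[OF K(2)] K(3)])
       (simp add: K(4) tmul_def)
  let ?K = "K \<inter> {x \<in> topspace ?S. shift m x \<in> M}"
  have "closedin ?S {x \<in> topspace ?S. shift m x \<in> M}"
    using continuous_shift closedin_compactin[OF M(2)] by (rule closedin_continuous_map_preimage)
  moreover have "compactin ?S K" using K(2,3) by (simp add: compactin_subtopology)
  ultimately have "compactin ?S ?K" by (intro compact_Int_closedin)
  then have k: "compactin ?T ?K" by (simp add: compactin_subtopology)
  have sub: "?K \<subseteq> bpaths_ge L (m + n)" using K(3) M(3) bpaths_ge_add by blast
  have "tmul m f g x = 0" if "x \<notin> ?K" for x
  proof (cases "x \<in> K")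
    case True
    then have "x \<in> topspace ?S" using K(3) bpaths_ge_sub[of m] by auto
    then have "shift m x \<notin> M" using True that by blast
    then show ?thesis using M(4)[of "shift m x"] by (simp add: tmul_def)
  next
    case False
    then show ?thesis using K(4)[of x] by (simp add: tmul_def)
  qed
  with c k sub show ?thesis unfolding Cc_ge_iff by blast
qed

lemma tmul_norm_le:
  "norm_le L m f a \<Longrightarrow> norm_le L n g b \<Longrightarrow> 0 \<le> a \<Longrightarrow> 0 \<le> b \<Longrightarrow> norm_le L (m + n) (tmul m f g) (a * b)"
  by (rule norm_le_tmul) (simp_all add: fibre_add)

text \<open>Approximate both factors and write fg - f'g' as (f - f')g + f'(g - g'), with products in
  the sense of \<open>tmul\<close>.\<close>

lemma tmul_Xmod:
  assumes f: "f \<in> elts (Xmod L m)" and g: "g \<in> elts (Xmod L n)"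
  shows "tmul m f g \<in> elts (Xmod L (m + n))"
proof (rule XmodI)
  show "tmul m f g x = 0" if "x \<notin> bpaths_ge L (m + n)" for x
    using that bpaths_ge_add[of x m n] Xmod_zero[OF f, of x] Xmod_zero[OF g, of "shift m x"]
    by (auto simp: tmul_def)
  fix \<epsilon> :: real assume e: "0 < \<epsilon>"
  obtain a where a: "0 \<le> a" "norm_le L m f a" using Xmod_norm_le[OF f] .
  obtain b where b: "0 \<le> b" "norm_le L n g b" using Xmod_norm_le[OF g] .
  obtain d where d: "0 < d" "d \<le> 1" "d * (a + b + 1) \<le> \<epsilon>"
    using small_factor[OF e a(1) b(1)] .
  obtain f' where f': "f' \<in> Cc_ge L m" "norm_le L m (\<lambda>y. f y - f' y) d" using Xmod_approx[OF f d(1)] by blast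
  obtain g' where g': "g' \<in> Cc_ge L n" "norm_le L n (\<lambda>y. g y - g' y) d" using Xmod_approx[OF g d(1)] by blast
  have "norm_le L m (\<lambda>y. f' y - f y + f y) (d + a)"
    using norm_le_minus_commute[THEN iffD1, OF f'(2)] a(2)
    by (rule norm_le_triangle) (use a d in simp_all)
  then have "norm_le L m f' (a + d)" by (simp add: add.commute)
  then have nf': "norm_le L m f' (a + 1)" by (rule norm_le_mono) (use d a(1) in simp_all)
  have "norm_le L (m + n) (\<lambda>y. tmul m (\<lambda>y. f y - f' y) g y + tmul m f' (\<lambda>y. g y - g' y) y) (d * b + (a + 1) * d)"
    using tmul_norm_le[OF f'(2) b(2)] tmul_norm_le[OF nf' g'(2)] a(1) b(1) d(1)
    by (intro norm_le_triangle) simp_all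
  moreover have "d * b + (a + 1) * d \<le> \<epsilon>" using d(3) by (simp add: algebra_simps)
  moreover have "0 \<le> d * b + (a + 1) * d" using a(1) b(1) d(1) by simp
  ultimately have "norm_le L (m + n) (\<lambda>y. tmul m (\<lambda>y. f y - f' y) g y + tmul m f' (\<lambda>y. g y - g' y) y) \<epsilon>"
    by (blast intro: norm_le_mono)
  moreover have "(\<lambda>y. tmul m (\<lambda>y. f y - f' y) g y + tmul m f' (\<lambda>y. g y - g' y) y)
      = (\<lambda>y. tmul m f g y - tmul m f' g' y)" by (simp add: tmul_def algebra_simps)
  ultimately have "norm_le L (m + n) (\<lambda>y. tmul m f g y - tmul m f' g' y) \<epsilon>" by simp
  then show "\<exists>h\<in>Cc_ge L (m + n). norm_le L (m + n) (\<lambda>y. tmul m f g y - h y) \<epsilon>"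
    using tmul_Cc[OF f'(1) g'(1)] by blast
qed

lemma inner_tmul:
  assumes f: "f \<in> elts (Xmod L m)" "f' \<in> elts (Xmod L m)" and g: "g \<in> elts (Xmod L n)" "g' \<in> elts (Xmod L n)"
  shows "ainner (Xmod L (m + n)) (tmul m f g) (tmul m f' g')
    = ainner (Xmod L n) g (lact (Xmod L n) (ainner (Xmod L m) f f') g')"
proof
  fix x
  let ?F = "\<lambda>y. cnj (tmul m f g y) * tmul m f' g' y"
  \<comment> \<open>A point y of the large fibre determines its intermediate point z =
    \<open>shift m y\<close>, so pairs (z, y) and points y correspond.\<close>
  have bij: "bij_betw snd (Sigma (fibre L n x) (fibre L m)) (fibre L (m + n) x)"
  proof (rule bij_betwI[where g = "\<lambda>y. (shift m y, y)"])
    show "snd \<in> Sigma (fibre L n x) (fibre L m) \<rightarrow> fibre L (m + n) x"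
      unfolding Pi_def fibre_add by (auto simp: fibre_def)
    show "(\<lambda>y. (shift m y, y)) \<in> fibre L (m + n) x \<rightarrow> Sigma (fibre L n x) (fibre L m)"
      unfolding Pi_def fibre_add by (auto simp: fibre_def)
    show "(shift m (snd p), snd p) = p" if "p \<in> Sigma (fibre L n x) (fibre L m)" for p
      using that by (auto simp: fibre_def)
  qed simp
  \<comment> \<open>Summability over the whole fibre justifies the iteration; it holds because both
    products lie in X_(m+n).\<close>
  have "?F summable_on fibre L (m + n) x"
    using tmul_Xmod[OF f(1) g(1)] tmul_Xmod[OF f(2) g(2)] by (rule Xmod_summable')
  then have s: "(\<lambda>p. ?F (snd p)) summable_on Sigma (fibre L n x) (fibre L m)"
    using summable_on_reindex_bij_betw[OF bij, of ?F] by simp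
  have "(\<Sum>\<^sub>\<infinity>y\<in>fibre L (m + n) x. ?F y) = (\<Sum>\<^sub>\<infinity>p\<in>Sigma (fibre L n x) (fibre L m). ?F (snd p))"
    using infsum_reindex_bij_betw[OF bij, of ?F] by simp
  also have "\<dots> = (\<Sum>\<^sub>\<infinity>z\<in>fibre L n x. \<Sum>\<^sub>\<infinity>y\<in>fibre L m z. ?F y)"
    using infsum_Sigma_banach[OF s] by simp
  also have "\<dots> = (\<Sum>\<^sub>\<infinity>z\<in>fibre L n x. cnj (g z) * ((\<Sum>\<^sub>\<infinity>y\<in>fibre L m z. cnj (f y) * f' y) * g' z))"
  proof (rule infsum_cong)
    fix z
    have "(\<Sum>\<^sub>\<infinity>y\<in>fibre L m z. ?F y) = (\<Sum>\<^sub>\<infinity>y\<in>fibre L m z. (cnj (g z) * g' z) * (cnj (f y) * f' y))"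
      by (rule infsum_cong) (simp add: fibre_def tmul_def)
    also have "\<dots> = (cnj (g z) * g' z) * (\<Sum>\<^sub>\<infinity>y\<in>fibre L m z. cnj (f y) * f' y)"
      by (rule infsum_cmult_right')
    finally show "(\<Sum>\<^sub>\<infinity>y\<in>fibre L m z. ?F y) = cnj (g z) * ((\<Sum>\<^sub>\<infinity>y\<in>fibre L m z. cnj (f y) * f' y) * g' z)"
      by simp
  qed
  finally show "ainner (Xmod L (m + n)) (tmul m f g) (tmul m f' g') x
      = ainner (Xmod L n) g (lact (Xmod L n) (ainner (Xmod L m) f f') g') x" by simp
qed

text \<open>Both factors inherit a compact support from \<open>h\<close>, so compactness of the cylinder sets is not
  needed.\<close>

lemma Cc_ge_factor:
  assumes h: "h \<in> Cc_ge L (m + n)" and l: "l \<in> Mor L" "deg L l = m" and 0: "\<And>x. x \<notin> cyl L l \<Longrightarrow> h x = 0"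
  obtains f g where "f \<in> Cc_ge L m" "g \<in> Cc_ge L n" "h = tmul m f g"
proof -
  \<comment> \<open>Since \<open>k 0 = 0\<close>, the support does not grow. The first factor uses
    this with p = m, the square root \<open>r\<close> with p = m + n, before \<open>push\<close>
    lowers the degree to n.\<close>
  have compose: "(\<lambda>x. k (h x)) \<in> Cc_ge L p"
    if k: "continuous_on UNIV k" "k 0 = 0" and p: "bpaths_ge L (m + n) \<subseteq> bpaths_ge L p" for k :: "complex \<Rightarrow> complex" and p
  proof -
    obtain K where K: "continuous_map (bpath_topology L) euclidean h" "compactin (bpath_topology L) K"
      "K \<subseteq> bpaths_ge L (m + n)" "\<And>x. x \<notin> K \<Longrightarrow> h x = 0" using Cc_geE[OF h] by blast
    have "continuous_map (bpath_topology L) euclidean (\<lambda>x. k (h x))" using K(1) k(1) by (rule continuous_map_compose1)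
    moreover have "k (h x) = 0" if "x \<notin> K" for x using K(4)[OF that] k(2) by simp
    ultimately show ?thesis unfolding Cc_ge_iff using K(2,3) p by blast
  qed
  define f where "f x = csplit (h x)" for x
  define r where "r x = complex_of_real (sqrt (cmod (h x)))" for x
  have f: "f \<in> Cc_ge L m"
    unfolding f_def[abs_def] using bpaths_ge_add by (intro compose continuous_csplit) auto
  have "r \<in> Cc_ge L (deg L l + n)"
    unfolding r_def[abs_def] l(2)
    by (rule compose[OF _ _ order_refl]) (intro continuous_intros, simp)
  then have g: "push l r \<in> Cc_ge L n" using l(1) by (rule push_Cc)
  have "h x = tmul m f (push l r) x" for x
  proof (cases "x \<in> cyl L l")
    case True
    then have "push l r (shift m x) = r x"
      using shift_cyl[OF True] glue_shift[OF True] l(2) by (simp add: push_def)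
    then show ?thesis by (simp add: tmul_def f_def r_def csplit_mult)
  next
    case False
    then show ?thesis by (simp add: 0 tmul_def f_def)
  qed
  then have "h = tmul m f (push l r)" by (rule ext)
  with f g show ?thesis by (rule that)
qed

text \<open>The cutoff stays continuous because the cylinder is both open and closed.\<close>

lemma Cc_ge_cyl:
  assumes h: "h \<in> Cc_ge L n"
  shows "(\<lambda>x. if x \<in> cyl L l then h x else 0) \<in> Cc_ge L n"
proof -
  obtain K where K: "continuous_map (bpath_topology L) euclidean h" "compactin (bpath_topology L) K"
    "K \<subseteq> bpaths_ge L n" "\<And>x. x \<notin> K \<Longrightarrow> h x = 0" using Cc_geE[OF h] by blast
  have "continuous_map (subtopology (bpath_topology L) (cyl L l)) euclidean (\<lambda>x. if x \<in> cyl L l then h x else 0)"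
    using continuous_map_from_subtopology[OF K(1), of "cyl L l"] by (rule continuous_map_eq) simp
  then have "continuous_map (bpath_topology L) euclidean (\<lambda>x. if x \<in> cyl L l then h x else 0)"
    by (rule continuous_map_glue_zero[OF openin_cyl closedin_cyl order_refl]) simp
  moreover have "(if x \<in> cyl L l then h x else 0) = 0" if "x \<notin> K" for x using K(4)[OF that] by simp
  ultimately show ?thesis unfolding Cc_ge_iff using K(2,3) by blast
qed

text \<open>Finitely many cylinders of degree m cover the support. They are pairwise disjoint, so
  the cutoffs of h to them add up to h, and each cutoff is a single product by
  \<open>Cc_ge_factor\<close>.\<close>

lemma Cc_ge_sum_tmul:
  assumes h: "h \<in> Cc_ge L (m + n)"
  obtains us where "set us \<subseteq> Cc_ge L m \<times> Cc_ge L n" "h = (\<lambda>x. \<Sum>(f, g)\<leftarrow>us. tmul m f g x)"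
proof -
  obtain K where K: "compactin (bpath_topology L) K" "K \<subseteq> bpaths_ge L (m + n)" "\<And>x. x \<notin> K \<Longrightarrow> h x = 0"
    using Cc_ge_compact[OF h] by blast
  have Km: "K \<subseteq> bpaths_ge L m" using K(2) bpaths_ge_add by blast
  obtain M where M: "finite M" "M \<subseteq> {l \<in> Mor L. deg L l = m}" "K \<subseteq> (\<Union>l\<in>M. cyl L l)"
    using compact_cyl_cover[OF K(1) Km] .
  let ?h = "\<lambda>l x. if x \<in> cyl L l then h x else 0"
  have "\<forall>l\<in>M. \<exists>p. p \<in> Cc_ge L m \<times> Cc_ge L n \<and> ?h l = tmul m (fst p) (snd p)"
  proof
    fix l assume "l \<in> M"
    then have l: "l \<in> Mor L" "deg L l = m" using M(2) by auto
    obtain f g where "f \<in> Cc_ge L m" "g \<in> Cc_ge L n" "?h l = tmul m f g"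
      by (rule Cc_ge_factor[OF Cc_ge_cyl[OF h] l, of l]) auto
    then show "\<exists>p. p \<in> Cc_ge L m \<times> Cc_ge L n \<and> ?h l = tmul m (fst p) (snd p)"
      by (intro exI[of _ "(f, g)"]) simp
  qed
  from bchoice[OF this] obtain P where
    P: "\<forall>l\<in>M. P l \<in> Cc_ge L m \<times> Cc_ge L n \<and> ?h l = tmul m (fst (P l)) (snd (P l))" ..
  obtain ls where ls: "set ls = M" "distinct ls" using finite_distinct_list[OF M(1)] by blast
  have "h x = (\<Sum>(f, g)\<leftarrow>map P ls. tmul m f g x)" for x
  proof -
    have "(\<Sum>(f, g)\<leftarrow>map P ls. tmul m f g x) = (\<Sum>l\<leftarrow>ls. tmul m (fst (P l)) (snd (P l)) x)"
      by (simp add: split_beta o_def)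
    also have "\<dots> = (\<Sum>l\<in>M. tmul m (fst (P l)) (snd (P l)) x)"
      using ls by (simp add: sum_list_distinct_conv_sum_set)
    also have "\<dots> = (\<Sum>l\<in>M. ?h l x)"
    proof (rule sum.cong[OF refl])
      fix l assume "l \<in> M"
      then have "?h l = tmul m (fst (P l)) (snd (P l))" using P by blast
      from fun_cong[OF this, of x] show "tmul m (fst (P l)) (snd (P l)) x = ?h l x" by (rule sym)
    qed
    also have "\<dots> = h x"
    proof (cases "x \<in> K")
      case True
      then obtain l0 where l0: "l0 \<in> M" "x \<in> cyl L l0" using M(3) by blast
      have "l = l0" if "l \<in> M" "x \<in> cyl L l" for l
        using cyl_eq[OF that(2)] cyl_eq[OF l0(2)] subsetD[OF M(2) that(1)] subsetD[OF M(2) l0(1)] by simp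
      then have "(\<Sum>l\<in>M. ?h l x) = (\<Sum>l\<in>{l0}. ?h l x)"
        using M(1) l0(1) by (intro sum.mono_neutral_right) auto
      then show ?thesis using l0(2) by simp
    qed (simp add: K(3) cong: if_cong)
    finally show ?thesis by simp
  qed
  moreover have "set (map P ls) \<subseteq> Cc_ge L m \<times> Cc_ge L n" using P ls(1) by auto
  ultimately show ?thesis using that by blast
qed

text \<open>If k y is nonzero, a compactly supported h within half of its modulus is nonzero at y.
  The cylinder of y(0, m+n) meets the fibre through y only in y, so the inner product of k with the
  cutoff of h has the nonzero value cnj(h y) k y. The cutoff is a product, because it vanishes off
  the larger cylinder of y(0, m).\<close>

lemma Xmod_eq_zeroI:
  assumes k: "k \<in> elts (Xmod L (m + n))"
    and orth: "\<And>f g. f \<in> Cc_ge L m \<Longrightarrow> g \<in> Cc_ge L n \<Longrightarrow> ainner (Xmod L (m + n)) (tmul m f g) k = (\<lambda>x. 0)"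
  shows "k = (\<lambda>x. 0)"
proof (rule ext, rule ccontr)
  fix y assume ne: "k y \<noteq> 0"
  then have y: "y \<in> bpaths_ge L (m + n)" using Xmod_zero[OF k] by blast
  obtain h where h: "h \<in> Cc_ge L (m + n)" "norm_le L (m + n) (\<lambda>y. k y - h y) (cmod (k y) / 2)"
    using Xmod_approx[OF k, of "cmod (k y) / 2"] ne by auto
  have "cmod (k y - h y) \<le> cmod (k y) / 2" using norm_le_pointwise[OF h(2) _ y] by simp
  then have hy: "h y \<noteq> 0" using ne by auto
  let ?l = "snd y (0, m + n)"
  note l = bpaths_ge_cyl[OF y]
  let ?h = "\<lambda>x. if x \<in> cyl L ?l then h x else 0"
  have ml: "m \<le> deg L ?l" using l(2) by simp
  note mu = init_closed[OF l(1) ml] deg_init[OF l(1) ml]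
  have "?h x = 0" if "x \<notin> cyl L (init ?l m)" for x
    using that cyl_cmp[OF mu(1) final_closed[OF l(1) ml] rng_final[OF l(1) ml, symmetric], of x]
      init_final[OF l(1) ml] by simp
  then obtain f g where "f \<in> Cc_ge L m" "g \<in> Cc_ge L n" "?h = tmul m f g"
    using Cc_ge_factor[OF Cc_ge_cyl[OF h(1)] mu] by blast
  then have "ainner (Xmod L (m + n)) ?h k = (\<lambda>x. 0)" using orth by simp
  then have "(\<Sum>\<^sub>\<infinity>z\<in>fibre L (m + n) (shift (m + n) y). cnj (?h z) * k z) = 0"
    by (simp only: Xmod_simps fun_eq_iff)
  moreover have "(\<Sum>\<^sub>\<infinity>z\<in>fibre L (m + n) (shift (m + n) y). cnj (?h z) * k z) = (\<Sum>\<^sub>\<infinity>z\<in>{y}. cnj (?h z) * k z)"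
  proof (rule infsum_cong_neutral)
    show "cnj (?h z) * k z = 0" if "z \<in> fibre L (m + n) (shift (m + n) y) - {y}" for z
    proof -
      have *: "w = glue ?l (shift (m + n) y)"
        if "w \<in> fibre L (m + n) (shift (m + n) y)" "w \<in> cyl L ?l" for w
      proof -
        have "w \<in> fibre L (deg L ?l) (shift (m + n) y) \<inter> cyl L ?l" using that l(2) by simp
        then show ?thesis unfolding fibre_cyl[OF l(1)] by (simp split: if_splits)
      qed
      have "y \<in> fibre L (m + n) (shift (m + n) y)" using y by (simp add: fibre_def)
      from *[OF this l(3)] have "z \<notin> cyl L ?l" using that *[of z] by (metis DiffE singletonI)
      then show ?thesis by simp
    qed
  qed (use y in \<open>auto simp: fibre_def\<close>)
  ultimately show False using hy ne l(3) by simp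
qed

end

section \<open>Tensor products\<close>

lemma C0_seq_lim_pointwise:
  assumes w: "\<And>i. w i \<in> elts (C0 T)" and a: "seq_lim (C0 T) (nrm (C0 T)) w a"
  shows "(\<lambda>i. w i x) \<longlonglongrightarrow> a x"
proof -
  have l: "(\<lambda>i. nrm (C0 T) (dif (C0 T) (w i) a)) \<longlonglongrightarrow> 0" and a': "a \<in> elts (C0 T)"
    using a by (simp_all only: seq_lim_def)
  have "norm (w i x - a x) \<le> nrm (C0 T) (dif (C0 T) (w i) a)" for i
    using C0_nrm[OF C0_diff[OF w a'], of i x] unfolding C0_dif .
  then have "(\<lambda>i. w i x - a x) \<longlonglongrightarrow> 0" by (rule Lim_null_comparison[OF always_eventually[OF allI] l])
  then show ?thesis by (rule LIM_zero_cancel)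
qed

text \<open>Justifies the definite description in the inner product of
  \<open>completion\<close>.\<close>

lemma C0_seq_lim_unique:
  assumes "\<And>i. w i \<in> elts (C0 T)" "seq_lim (C0 T) (nrm (C0 T)) w a" "seq_lim (C0 T) (nrm (C0 T)) w b"
  shows "a = b"
proof
  fix x show "a x = b x"
    using C0_seq_lim_pointwise[OF assms(1,2)] C0_seq_lim_pointwise[OF assms(1,3)] by (rule LIMSEQ_unique)
qed

context fa_kgraph
begin

text \<open>Norm convergence in X_n, phrased with \<open>norm_le\<close> so that fibrewise estimates
  apply directly; \<open>conv_near\<close> and \<open>conv_null\<close> translate from and to
  \<open>hnorm\<close>.\<close>

definition conv :: "('k \<Rightarrow> nat) \<Rightarrow> (nat \<Rightarrow> ('m, 'k) path \<Rightarrow> complex) \<Rightarrow> (('m, 'k) path \<Rightarrow> complex) \<Rightarrow> bool" where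
  "conv n u f \<longleftrightarrow> f \<in> elts (Xmod L n) \<and> (\<forall>i. u i \<in> elts (Xmod L n))
    \<and> (\<forall>\<epsilon>>0. \<exists>M. \<forall>i\<ge>M. norm_le L n (\<lambda>y. u i y - f y) \<epsilon>)"

lemma convD:
  assumes "conv n u f"
  shows "f \<in> elts (Xmod L n)" "u i \<in> elts (Xmod L n)"
    "0 < \<epsilon> \<Longrightarrow> \<exists>M. \<forall>i\<ge>M. norm_le L n (\<lambda>y. u i y - f y) \<epsilon>"
  using assms unfolding conv_def by blast+

lemma conv_const: "f \<in> elts (Xmod L n) \<Longrightarrow> conv n (\<lambda>i. f) f"
  by (simp add: conv_def norm_le_def)

lemma conv_pointwise:
  assumes u: "conv n u f"
  shows "(\<lambda>i. u i y) \<longlonglongrightarrow> f y"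
proof (cases "y \<in> bpaths_ge L n")
  case True
  show ?thesis
  proof (rule LIMSEQ_I)
    fix r :: real assume r: "0 < r"
    then obtain M where M: "\<And>i. i \<ge> M \<Longrightarrow> norm_le L n (\<lambda>y. u i y - f y) (r / 2)"
      using convD(3)[OF u, of "r / 2"] half_gt_zero by blast
    have "norm (u i y - f y) < r" if "i \<ge> M" for i
      using norm_le_pointwise[OF M[OF that] _ True] r by simp
    then show "\<exists>M. \<forall>i\<ge>M. norm (u i y - f y) < r" by blast
  qed
next
  case False
  then show ?thesis using Xmod_zero[OF convD(1)[OF u]] Xmod_zero[OF convD(2)[OF u]] by simp
qed

lemma conv_unique:
  assumes "conv n u f" "conv n u g"
  shows "f = g"
proof
  fix y show "f y = g y" using conv_pointwise[OF assms(1)] conv_pointwise[OF assms(2)] by (rule LIMSEQ_unique)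
qed

text \<open>The one estimate behind three facts: u = v gives the Cauchy property, f = g gives null
  differences, and -v in place of v gives sums.\<close>

lemma conv_diff:
  assumes u: "conv n u f" and v: "conv n v g" and e: "0 < \<epsilon>"
  shows "\<exists>M. \<forall>i\<ge>M. \<forall>j\<ge>M. norm_le L n (\<lambda>y. (u i y - f y) - (v j y - g y)) \<epsilon>"
proof -
  obtain M where M: "\<And>i. i \<ge> M \<Longrightarrow> norm_le L n (\<lambda>y. u i y - f y) (\<epsilon> / 2)"
    using convD(3)[OF u, of "\<epsilon> / 2"] e half_gt_zero by blast
  obtain N where N: "\<And>i. i \<ge> N \<Longrightarrow> norm_le L n (\<lambda>y. v i y - g y) (\<epsilon> / 2)"
    using convD(3)[OF v, of "\<epsilon> / 2"] e half_gt_zero by blast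
  have "norm_le L n (\<lambda>y. (u i y - f y) - (v j y - g y)) \<epsilon>" if "i \<ge> max M N" "j \<ge> max M N" for i j
  proof -
    have "norm_le L n (\<lambda>y. (u i y - f y) + (g y - v j y)) (\<epsilon> / 2 + \<epsilon> / 2)"
      using M[of i] norm_le_minus_commute[THEN iffD1, OF N[of j]] that e
      by (intro norm_le_triangle) simp_all
    moreover have "(u i y - f y) + (g y - v j y) = (u i y - f y) - (v j y - g y)" for y by simp
    ultimately show ?thesis by simp
  qed
  then show ?thesis by blast
qed

lemma conv_mult:
  assumes u: "conv n u f"
    and g: "continuous_map (subtopology (bpath_topology L) (bpaths_ge L n)) euclidean g"
    and B: "\<And>y. y \<in> bpaths_ge L n \<Longrightarrow> cmod (g y) \<le> B" "0 \<le> B"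
  shows "conv n (\<lambda>i y. u i y * g y) (\<lambda>y. f y * g y)"
  unfolding conv_def
proof (intro conjI allI impI)
  show "(\<lambda>y. f y * g y) \<in> elts (Xmod L n)" using convD(1)[OF u] g B by (rule Xmod_mult)
  show "(\<lambda>y. u i y * g y) \<in> elts (Xmod L n)" for i using convD(2)[OF u] g B by (rule Xmod_mult)
  fix \<epsilon> :: real assume e: "0 < \<epsilon>"
  then have e': "0 < \<epsilon> / (B + 1)" using B(2) by simp
  then obtain M where M: "\<And>i. i \<ge> M \<Longrightarrow> norm_le L n (\<lambda>y. u i y - f y) (\<epsilon> / (B + 1))"
    using convD(3)[OF u] by blast
  have le: "\<epsilon> / (B + 1) * B \<le> \<epsilon>"
    using mult_left_mono[of B "B + 1" "\<epsilon> / (B + 1)"] e B(2) by simp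
  have "norm_le L n (\<lambda>y. u i y * g y - f y * g y) \<epsilon>" if "i \<ge> M" for i
  proof -
    have "norm_le L n (\<lambda>y. (u i y - f y) * g y) (\<epsilon> / (B + 1) * B)"
      using M[OF that] B(1) less_imp_le[OF e'] B(2) by (rule norm_le_mult)
    then have "norm_le L n (\<lambda>y. (u i y - f y) * g y) \<epsilon>"
      by (rule norm_le_mono) (use le e B(2) in simp_all)
    then show ?thesis by (simp add: left_diff_distrib)
  qed
  then show "\<exists>M. \<forall>i\<ge>M. norm_le L n (\<lambda>y. u i y * g y - f y * g y) \<epsilon>" by blast
qed

lemma conv_scale: "conv n u f \<Longrightarrow> conv n (\<lambda>i y. c * u i y) (\<lambda>y. c * f y)"
  using conv_mult[of n u f "\<lambda>_. c" "cmod c"] by (simp add: mult.commute)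

lemma conv_add:
  assumes u: "conv n u f" and v: "conv n v g"
  shows "conv n (\<lambda>i y. u i y + v i y) (\<lambda>y. f y + g y)"
  unfolding conv_def
proof (intro conjI allI impI)
  show "(\<lambda>y. f y + g y) \<in> elts (Xmod L n)" using convD(1)[OF u] convD(1)[OF v] by (rule Xmod_add)
  show "(\<lambda>y. u i y + v i y) \<in> elts (Xmod L n)" for i using convD(2)[OF u] convD(2)[OF v] by (rule Xmod_add)
  fix \<epsilon> :: real assume "0 < \<epsilon>"
  from conv_diff[OF u conv_scale[OF v, of "- 1"] this] obtain M where
    M: "\<And>i j. i \<ge> M \<Longrightarrow> j \<ge> M \<Longrightarrow> norm_le L n (\<lambda>y. (u i y - f y) - (- 1 * v j y - - 1 * g y)) \<epsilon>" by blast
  have "(\<lambda>y. (u i y - f y) - (- 1 * v i y - - 1 * g y)) = (\<lambda>y. u i y + v i y - (f y + g y))" for i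
    by (simp add: fun_eq_iff)
  then have "norm_le L n (\<lambda>y. u i y + v i y - (f y + g y)) \<epsilon>" if "i \<ge> M" for i
    using M[OF that that] by simp
  then show "\<exists>M. \<forall>i\<ge>M. norm_le L n (\<lambda>y. u i y + v i y - (f y + g y)) \<epsilon>" by blast
qed

lemma conv_lact:
  assumes "conv n u f" and a: "a \<in> elts (C0 (bpath_topology L))"
  shows "conv n (\<lambda>i y. a y * u i y) (\<lambda>y. a y * f y)"
proof -
  obtain B where "0 \<le> B" "\<And>x. cmod (a x) \<le> B" using C0_bounded[OF a] by blast
  then have "conv n (\<lambda>i y. u i y * a y) (\<lambda>y. f y * a y)"
    using continuous_map_from_subtopology[OF C0_continuous[OF a]] by (intro conv_mult[OF assms(1)])
  then show ?thesis by (simp add: mult.commute)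
qed

lemma conv_ract:
  assumes "conv n u f" and a: "a \<in> elts (C0 (bpath_topology L))"
  shows "conv n (\<lambda>i y. u i y * a (shift n y)) (\<lambda>y. f y * a (shift n y))"
proof -
  obtain B where B: "0 \<le> B" "\<And>x. cmod (a x) \<le> B" using C0_bounded[OF a] by blast
  have "continuous_map (subtopology (bpath_topology L) (bpaths_ge L n)) euclidean (a \<circ> shift n)"
    using continuous_shift C0_continuous[OF a] by (rule continuous_map_compose)
  then have "continuous_map (subtopology (bpath_topology L) (bpaths_ge L n)) euclidean (\<lambda>y. a (shift n y))"
    by (simp add: o_def)
  then show ?thesis by (rule conv_mult[OF assms(1)]) (rule B)+
qed

lemma conv_inner:
  assumes u: "conv n u f" and v: "conv n v g"
  shows "seq_lim (C0 (bpath_topology L)) (nrm (C0 (bpath_topology L)))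
    (\<lambda>i. ainner (Xmod L n) (u i) (v i)) (ainner (Xmod L n) f g)"
proof -
  let ?A = "C0 (bpath_topology L)"
  note uf = convD(2)[OF u] convD(1)[OF u] and vg = convD(2)[OF v] convD(1)[OF v]
  obtain a where a: "0 \<le> a" "norm_le L n f a" using Xmod_norm_le[OF uf(2)] .
  obtain b where b: "0 \<le> b" "norm_le L n g b" using Xmod_norm_le[OF vg(2)] .
  have "(\<lambda>i. nrm ?A (dif ?A (ainner (Xmod L n) (u i) (v i)) (ainner (Xmod L n) f g))) \<longlonglongrightarrow> 0"
  proof (rule LIMSEQ_I)
    fix \<epsilon> :: real assume e: "0 < \<epsilon>"
    obtain d where d: "0 < d" "d \<le> 1" "d * (a + b + 1) \<le> \<epsilon> / 2"
      using small_factor[OF half_gt_zero[OF e] a(1) b(1)] .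
    obtain M where M: "\<And>i. i \<ge> M \<Longrightarrow> norm_le L n (\<lambda>y. u i y - f y) d" using convD(3)[OF u d(1)] by blast
    obtain N where N: "\<And>i. i \<ge> N \<Longrightarrow> norm_le L n (\<lambda>y. v i y - g y) d" using convD(3)[OF v d(1)] by blast
    have "norm (nrm ?A (dif ?A (ainner (Xmod L n) (u i) (v i)) (ainner (Xmod L n) f g)) - 0) < \<epsilon>"
      if i: "i \<ge> max M N" for i
    proof -
      have nu: "norm_le L n (\<lambda>y. u i y - f y) d" and nv: "norm_le L n (\<lambda>y. v i y - g y) d"
        using M N i by simp_all
      have "norm_le L n (\<lambda>y. v i y - g y + g y) (d + b)"
        using nv b(2) by (rule norm_le_triangle) (use d b in simp_all)
      then have vb: "norm_le L n (v i) (d + b)" by simp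
      \<comment> \<open>The bound used for \<open>v i\<close> is d + b. As d \<le> 1, the total is
        at most d (a + b + 1).\<close>
      have *: "cmod (ainner (Xmod L n) (u i) (v i) x - ainner (Xmod L n) f g x) \<le> d * (d + b) + a * d" for x
        using inner_diff_bound[OF uf vg nu a(2) nv vb, of x] a b d by simp
      have "d * (d + b) + a * d \<le> d * (a + b + 1)"
        using mult_left_mono[of d 1 d] d by (simp add: algebra_simps)
      with d(3) have le: "d * (d + b) + a * d \<le> \<epsilon> / 2" by linarith
      have "nrm ?A (dif ?A (ainner (Xmod L n) (u i) (v i)) (ainner (Xmod L n) f g)) \<le> \<epsilon> / 2"
        unfolding C0_dif by (rule C0_nrm_le) (rule order_trans[OF * le])
      moreover have "0 \<le> nrm ?A (dif ?A (ainner (Xmod L n) (u i) (v i)) (ainner (Xmod L n) f g))"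
        unfolding C0_dif using C0_nrm[OF C0_diff[OF inner_Xmod[OF uf(1) vg(1)] inner_Xmod[OF uf(2) vg(2)]]]
        by (rule order_trans[OF norm_ge_zero])
      ultimately show ?thesis using e by (simp del: C0_simps)
    qed
    then show "\<exists>M. \<forall>i\<ge>M. norm (nrm ?A (dif ?A (ainner (Xmod L n) (u i) (v i)) (ainner (Xmod L n) f g)) - 0) < \<epsilon>"
      by blast
  qed
  then show ?thesis unfolding seq_lim_def by (rule conjI[OF inner_Xmod[OF uf(2) vg(2)]])
qed

text \<open>With the converse \<open>conv_null\<close>, this says that two sequences belong to one
  class of the completion exactly when their images have the same limit.\<close>

lemma conv_near:
  assumes u: "conv n u f" and v: "\<And>i. v i \<in> elts (Xmod L n)"
    and 0: "(\<lambda>i. hnorm (C0 (bpath_topology L)) (Xmod L n) (\<lambda>y. u i y - v i y)) \<longlonglongrightarrow> 0"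
  shows "conv n v f"
  unfolding conv_def
proof (intro conjI allI impI)
  show "f \<in> elts (Xmod L n)" "v i \<in> elts (Xmod L n)" for i using convD(1)[OF u] v by blast+
  let ?N = "hnorm (C0 (bpath_topology L)) (Xmod L n)"
  fix \<epsilon> :: real assume e: "0 < \<epsilon>"
  obtain M where M: "\<And>i. i \<ge> M \<Longrightarrow> norm_le L n (\<lambda>y. u i y - f y) (\<epsilon> / 2)"
    using convD(3)[OF u, of "\<epsilon> / 2"] e half_gt_zero by blast
  obtain K where K: "\<And>i. i \<ge> K \<Longrightarrow> norm (?N (\<lambda>y. u i y - v i y) - 0) < \<epsilon> / 2"
    using LIMSEQ_D[OF 0 half_gt_zero[OF e]] by blast
  have "norm_le L n (\<lambda>y. v i y - f y) \<epsilon>" if i: "i \<ge> max M K" for i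
  proof -
    have "norm_le L n (\<lambda>y. u i y - v i y) (\<epsilon> / 2)"
    proof (rule norm_le_mono[OF norm_le_hnorm[OF Xmod_diff[OF convD(2)[OF u] v]]])
      show "?N (\<lambda>y. u i y - v i y) \<le> \<epsilon> / 2" using K[of i] i by simp
    qed
    then have "norm_le L n (\<lambda>y. v i y - u i y) (\<epsilon> / 2)" by (rule norm_le_minus_commute[THEN iffD1])
    then have "norm_le L n (\<lambda>y. (v i y - u i y) + (u i y - f y)) (\<epsilon> / 2 + \<epsilon> / 2)"
      using M[of i] i e by (intro norm_le_triangle) simp_all
    then show ?thesis by simp
  qed
  then show "\<exists>M. \<forall>i\<ge>M. norm_le L n (\<lambda>y. v i y - f y) \<epsilon>" by blast
qed

lemma conv_null:
  assumes u: "conv n u f" and v: "conv n v f"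
  shows "(\<lambda>i. hnorm (C0 (bpath_topology L)) (Xmod L n) (\<lambda>y. u i y - v i y)) \<longlonglongrightarrow> 0"
proof (rule LIMSEQ_I)
  let ?N = "hnorm (C0 (bpath_topology L)) (Xmod L n)"
  fix r :: real assume r: "0 < r"
  obtain M where M: "\<forall>i\<ge>M. \<forall>j\<ge>M. norm_le L n (\<lambda>y. (u i y - f y) - (v j y - f y)) (r / 2)"
    using conv_diff[OF u v half_gt_zero[OF r]] by blast
  have "norm (?N (\<lambda>y. u i y - v i y) - 0) < r" if "i \<ge> M" for i
  proof -
    have "norm_le L n (\<lambda>y. u i y - v i y) (r / 2)" using M[rule_format, OF that that] by simp
    then have "?N (\<lambda>y. u i y - v i y) \<le> r / 2" by (rule hnorm_le) (use r in simp)
    then show ?thesis using norm_le_hnorm(2)[OF Xmod_diff[OF convD(2)[OF u] convD(2)[OF v]]] r by simp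
  qed
  then show "\<exists>M. \<forall>i\<ge>M. norm (?N (\<lambda>y. u i y - v i y) - 0) < r" by blast
qed

lemma conv_iff_cauchy:
  assumes "\<And>i. u i \<in> elts (Xmod L n)"
  shows "(\<exists>f. conv n u f) \<longleftrightarrow>
    (\<forall>\<epsilon>>0. \<exists>M. \<forall>i\<ge>M. \<forall>j\<ge>M. hnorm (C0 (bpath_topology L)) (Xmod L n) (\<lambda>y. u i y - u j y) < \<epsilon>)"
proof
  let ?N = "hnorm (C0 (bpath_topology L)) (Xmod L n)"
  {
    assume "\<exists>f. conv n u f"
    then obtain f where f: "conv n u f" ..
    show "\<forall>\<epsilon>>0. \<exists>M. \<forall>i\<ge>M. \<forall>j\<ge>M. ?N (\<lambda>y. u i y - u j y) < \<epsilon>"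
    proof (intro allI impI)
      fix \<epsilon> :: real assume e: "0 < \<epsilon>"
      obtain M where M: "\<forall>i\<ge>M. \<forall>j\<ge>M. norm_le L n (\<lambda>y. (u i y - f y) - (u j y - f y)) (\<epsilon> / 2)"
        using conv_diff[OF f f half_gt_zero[OF e]] by blast
      have "?N (\<lambda>y. u i y - u j y) < \<epsilon>" if "i \<ge> M" "j \<ge> M" for i j
      proof -
        have "norm_le L n (\<lambda>y. u i y - u j y) (\<epsilon> / 2)" using M[rule_format, OF that] by simp
        then have "?N (\<lambda>y. u i y - u j y) \<le> \<epsilon> / 2" by (rule hnorm_le) (use e in simp)
        then show ?thesis using e by simp
      qed
      then show "\<exists>M. \<forall>i\<ge>M. \<forall>j\<ge>M. ?N (\<lambda>y. u i y - u j y) < \<epsilon>" by blast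
    qed
  next
    assume c: "\<forall>\<epsilon>>0. \<exists>M. \<forall>i\<ge>M. \<forall>j\<ge>M. ?N (\<lambda>y. u i y - u j y) < \<epsilon>"
    have "seq_cauchy (Xmod L n) ?N u" unfolding seq_cauchy_def Xmod_dif using assms c by blast
    then obtain f where f: "f \<in> elts (Xmod L n)" "(\<lambda>i. ?N (\<lambda>y. u i y - f y)) \<longlonglongrightarrow> 0"
      using Xmod_hnorm_complete unfolding seq_lim_def Xmod_dif by blast
    have "(\<lambda>i. ?N (\<lambda>y. f y - u i y)) \<longlonglongrightarrow> 0"
    proof -
      have "?N (\<lambda>y. f y - u i y) = ?N (\<lambda>y. u i y - f y)" for i
      proof (rule antisym)
        show "?N (\<lambda>y. f y - u i y) \<le> ?N (\<lambda>y. u i y - f y)"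
          using norm_le_hnorm[OF Xmod_diff[OF assms[of i] f(1)]]
          by (rule hnorm_le[OF norm_le_minus_commute[THEN iffD1]])
        show "?N (\<lambda>y. u i y - f y) \<le> ?N (\<lambda>y. f y - u i y)"
          using norm_le_hnorm[OF Xmod_diff[OF f(1) assms[of i]]]
          by (rule hnorm_le[OF norm_le_minus_commute[THEN iffD1]])
      qed
      then show ?thesis using f(2) by simp
    qed
    then have "conv n u f" by (rule conv_near[OF conv_const[OF f(1)] assms])
    then show "\<exists>f. conv n u f" by blast
  }
qed

text \<open>An inner-product preserving map with dense range into the complete space X_n induces an
  isomorphism from the completion, by sending a class to the limit of its image. Only values of T
  enter: elements of \<open>P\<close> with the same image, as occur among lists, have the same
  class.\<close>

lemma completion_iso:
  fixes P :: "(('m, 'k) path \<Rightarrow> complex, 'p) hbimod" and T :: "'p \<Rightarrow> ('m, 'k) path \<Rightarrow> complex"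
  defines "A \<equiv> C0 (bpath_topology L)"
  assumes T: "\<And>x. x \<in> elts P \<Longrightarrow> T x \<in> elts (Xmod L n)"
    and add: "\<And>x y. x \<in> elts P \<Longrightarrow> y \<in> elts P \<Longrightarrow> add P x y \<in> elts P \<and> T (add P x y) = (\<lambda>z. T x z + T y z)"
    and scl: "\<And>c x. x \<in> elts P \<Longrightarrow> scl P c x \<in> elts P \<and> T (scl P c x) = (\<lambda>z. c * T x z)"
    and inner: "\<And>x y. x \<in> elts P \<Longrightarrow> y \<in> elts P \<Longrightarrow> ainner P x y = ainner (Xmod L n) (T x) (T y)"
    and ract: "\<And>x a. x \<in> elts P \<Longrightarrow> a \<in> elts A \<Longrightarrow> ract P x a \<in> elts P \<and> T (ract P x a) = ract (Xmod L n) (T x) a"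
    and lact: "\<And>x a. x \<in> elts P \<Longrightarrow> a \<in> elts A \<Longrightarrow> lact P a x \<in> elts P \<and> T (lact P a x) = lact (Xmod L n) a (T x)"
    and dense: "\<And>f \<epsilon>. f \<in> elts (Xmod L n) \<Longrightarrow> 0 < \<epsilon> \<Longrightarrow> \<exists>x\<in>elts P. norm_le L n (\<lambda>y. T x y - f y) \<epsilon>"
  obtains \<Phi> where "hb_iso A (completion A P) (Xmod L n) \<Phi>" "\<And>x. x \<in> elts P \<Longrightarrow> \<Phi> (cls A P (\<lambda>i. x)) = T x"
    "\<And>x. x \<in> elts P \<Longrightarrow> cls A P (\<lambda>i. x) \<in> elts (completion A P)"
proof -
  let ?N = "hnorm A (Xmod L n)"
  have hn: "hnorm A P (dif P x y) = ?N (\<lambda>z. T x z - T y z)" if "x \<in> elts P" "y \<in> elts P" for x y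
  proof -
    have "dif P x y \<in> elts P" "T (dif P x y) = (\<lambda>z. T x z - T y z)"
      using add[OF that(1), of "scl P (- 1) y"] scl[OF that(2), of "- 1"] by (simp_all add: dif_def)
    then show ?thesis using inner[of "dif P x y" "dif P x y"] by (simp add: hnorm_def)
  qed
  define C where "C = {u. seq_cauchy P (hnorm A P) u}"
  \<comment> \<open>As T preserves the seminorm of differences and X_n is complete, being Cauchy in
    \<open>P\<close> means having a convergent image.\<close>
  have C: "u \<in> C \<longleftrightarrow> (\<forall>i. u i \<in> elts P) \<and> (\<exists>f. conv n (\<lambda>i. T (u i)) f)" for u
  proof (cases "\<forall>i. u i \<in> elts P")
    case True
    then show ?thesis
      using conv_iff_cauchy[of "\<lambda>i. T (u i)" n] T hn by (simp add: C_def seq_cauchy_def A_def)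
  next
    case False
    then show ?thesis by (auto simp: C_def seq_cauchy_def)
  qed
  define Lim where "Lim u = (THE f. conv n (\<lambda>i. T (u i)) f)" for u
  have LimI: "Lim u = f" if "conv n (\<lambda>i. T (u i)) f" for u f
    unfolding Lim_def using that conv_unique by (intro the_equality) blast+
  have Lim: "conv n (\<lambda>i. T (u i)) (Lim u)" if "u \<in> C" for u
    using that LimI unfolding C by fastforce
  have CP: "u i \<in> elts P" if "u \<in> C" for u i using that C by blast
  \<comment> \<open>Classes are the level sets of \<open>Lim\<close>. Hence neither the choice made
    by \<open>rep\<close> nor the representatives in the operations matter, and the induced map is
    injective.\<close>
  have cls: "v \<in> cls A P u \<longleftrightarrow> v \<in> C \<and> Lim v = Lim u" if u: "u \<in> C" for u v
  proof (cases "v \<in> C")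
    case True
    have "(\<lambda>i. hnorm A P (dif P (u i) (v i))) = (\<lambda>i. ?N (\<lambda>z. T (u i) z - T (v i) z))"
      using hn CP[OF u] CP[OF True] by blast
    moreover have "(\<lambda>i. ?N (\<lambda>z. T (u i) z - T (v i) z)) \<longlonglongrightarrow> 0 \<longleftrightarrow> Lim v = Lim u"
    proof
      assume "(\<lambda>i. ?N (\<lambda>z. T (u i) z - T (v i) z)) \<longlonglongrightarrow> 0"
      then have "conv n (\<lambda>i. T (v i)) (Lim u)"
        unfolding A_def by (rule conv_near[OF Lim[OF u] T[OF CP[OF True]]])
      then show "Lim v = Lim u" by (rule LimI)
    next
      assume "Lim v = Lim u"
      then have "conv n (\<lambda>i. T (v i)) (Lim u)" using Lim[OF True] by simp
      then show "(\<lambda>i. ?N (\<lambda>z. T (u i) z - T (v i) z)) \<longlonglongrightarrow> 0"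
        unfolding A_def by (rule conv_null[OF Lim[OF u]])
    qed
    ultimately show ?thesis using True by (simp add: cls_def C_def)
  next
    case False
    then show ?thesis by (simp add: cls_def C_def)
  qed
  have rep: "rep (cls A P u) \<in> C \<and> Lim (rep (cls A P u)) = Lim u" if "u \<in> C" for u
  proof -
    have "u \<in> cls A P u" using cls[OF that] that by blast
    then have "rep (cls A P u) \<in> cls A P u" unfolding rep_def by (rule someI[where P = "\<lambda>v. v \<in> cls A P u"])
    then show ?thesis using cls[OF that] by blast
  qed
  define \<Phi> where "\<Phi> U = Lim (rep U)" for U
  have \<Phi>I: "\<Phi> (cls A P w) = f" if "\<And>i. w i \<in> elts P" "conv n (\<lambda>i. T (w i)) f" for w f
  proof -
    have "w \<in> C" unfolding C using that by blast
    then show ?thesis using rep[of w] LimI[OF that(2)] by (simp add: \<Phi>_def)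
  qed
  have rU: "rep U \<in> C" "conv n (\<lambda>i. T (rep U i)) (\<Phi> U)" "rep U i \<in> elts P" if U: "U \<in> elts (completion A P)" for U i
  proof -
    obtain u where "u \<in> C" "U = cls A P u" using U by (auto simp: completion_def C_def)
    then show r: "rep U \<in> C" using rep by blast
    then show "conv n (\<lambda>i. T (rep U i)) (\<Phi> U)" "rep U i \<in> elts P"
      using Lim[OF r] CP[OF r] by (simp_all add: \<Phi>_def)
  qed
  have "hb_iso A (completion A P) (Xmod L n) \<Phi>"
    unfolding hb_iso_def
  proof (intro conjI ballI allI)
    show "bij_betw \<Phi> (elts (completion A P)) (elts (Xmod L n))"
      unfolding bij_betw_def
    proof
      show "inj_on \<Phi> (elts (completion A P))"
      proof (rule inj_onI)
        fix U V assume "U \<in> elts (completion A P)" "V \<in> elts (completion A P)" and eq: "\<Phi> U = \<Phi> V"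
        then obtain u v where u: "u \<in> C" "U = cls A P u" and v: "v \<in> C" "V = cls A P v"
          by (auto simp: completion_def C_def)
        then have "Lim u = Lim v" using eq rep by (simp add: \<Phi>_def)
        then show "U = V" unfolding u(2) v(2) by (intro set_eqI) (simp only: cls[OF u(1)] cls[OF v(1)])
      qed
      show "\<Phi> ` elts (completion A P) = elts (Xmod L n)"
      proof
        show "\<Phi> ` elts (completion A P) \<subseteq> elts (Xmod L n)" using rU(2) convD(1) by blast
        show "elts (Xmod L n) \<subseteq> \<Phi> ` elts (completion A P)"
        proof
          fix f assume f: "f \<in> elts (Xmod L n)"
          have "\<forall>i. \<exists>x. x \<in> elts P \<and> norm_le L n (\<lambda>y. T x y - f y) (1 / real (Suc i))"
          proof
            fix i show "\<exists>x. x \<in> elts P \<and> norm_le L n (\<lambda>y. T x y - f y) (1 / real (Suc i))"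
              using dense[OF f, of "1 / real (Suc i)"] by auto
          qed
          from choice[OF this] obtain u where
            u: "\<And>i. u i \<in> elts P" "\<And>i. norm_le L n (\<lambda>y. T (u i) y - f y) (1 / real (Suc i))" by blast
          have "conv n (\<lambda>i. T (u i)) f"
            unfolding conv_def
          proof (intro conjI allI impI)
            show "f \<in> elts (Xmod L n)" "T (u i) \<in> elts (Xmod L n)" for i using f T[OF u(1)] .
            fix \<epsilon> :: real assume "0 < \<epsilon>"
            then obtain M where M: "1 / real (Suc M) < \<epsilon>" using nat_approx_posE by blast
            have "norm_le L n (\<lambda>y. T (u i) y - f y) \<epsilon>" if "i \<ge> M" for i
            proof (rule norm_le_mono[OF u(2)])
              have "1 / real (Suc i) \<le> 1 / real (Suc M)" using that by (intro divide_left_mono) simp_all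
              with M show "1 / real (Suc i) \<le> \<epsilon>" by linarith
            qed simp
            then show "\<exists>M. \<forall>i\<ge>M. norm_le L n (\<lambda>y. T (u i) y - f y) \<epsilon>" by blast
          qed
          then have "\<Phi> (cls A P u) = f" "u \<in> C"
            using \<Phi>I[of u f, OF u(1)] C[THEN iffD2, of u] u(1) by blast+
          then show "f \<in> \<Phi> ` elts (completion A P)" by (auto simp: completion_def C_def)
        qed
      qed
    qed
  next
    fix U V assume U: "U \<in> elts (completion A P)" and V: "V \<in> elts (completion A P)"
    have "\<Phi> (cls A P (\<lambda>i. add P (rep U i) (rep V i))) = (\<lambda>z. \<Phi> U z + \<Phi> V z)"
      using conv_add[OF rU(2)[OF U] rU(2)[OF V]] add rU(3)[OF U] rU(3)[OF V] by (intro \<Phi>I) simp_all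
    then show "\<Phi> (add (completion A P) U V) = add (Xmod L n) (\<Phi> U) (\<Phi> V)" by (simp add: completion_def)
    have "ainner (completion A P) U V
        = (THE a. seq_lim A (nrm A) (\<lambda>i. ainner (Xmod L n) (T (rep U i)) (T (rep V i))) a)"
      using inner rU(3)[OF U] rU(3)[OF V] by (simp add: completion_def)
    also have "\<dots> = ainner (Xmod L n) (\<Phi> U) (\<Phi> V)"
    proof (rule the_equality)
      show lim: "seq_lim A (nrm A) (\<lambda>i. ainner (Xmod L n) (T (rep U i)) (T (rep V i))) (ainner (Xmod L n) (\<Phi> U) (\<Phi> V))"
        unfolding A_def by (rule conv_inner[OF rU(2)[OF U] rU(2)[OF V]])
      fix a assume "seq_lim A (nrm A) (\<lambda>i. ainner (Xmod L n) (T (rep U i)) (T (rep V i))) a"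
      then show "a = ainner (Xmod L n) (\<Phi> U) (\<Phi> V)"
        using lim inner_Xmod[OF T[OF rU(3)[OF U]] T[OF rU(3)[OF V]]] unfolding A_def
        by (intro C0_seq_lim_unique[of "\<lambda>i. ainner (Xmod L n) (T (rep U i)) (T (rep V i))"])
    qed
    finally show "ainner (Xmod L n) (\<Phi> U) (\<Phi> V) = ainner (completion A P) U V" by (rule sym)
  next
    fix U c assume U: "U \<in> elts (completion A P)"
    have "\<Phi> (cls A P (\<lambda>i. scl P c (rep U i))) = (\<lambda>z. c * \<Phi> U z)"
      using conv_scale[OF rU(2)[OF U]] scl rU(3)[OF U] by (intro \<Phi>I) simp_all
    then show "\<Phi> (scl (completion A P) c U) = scl (Xmod L n) c (\<Phi> U)" by (simp add: completion_def)
  next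
    fix U a assume U: "U \<in> elts (completion A P)" and a: "a \<in> elts A"
    have "\<Phi> (cls A P (\<lambda>i. ract P (rep U i) a)) = ract (Xmod L n) (\<Phi> U) a"
      using conv_ract[OF rU(2)[OF U]] a ract[OF rU(3)[OF U] a] by (intro \<Phi>I) (simp_all add: A_def)
    then show "\<Phi> (ract (completion A P) U a) = ract (Xmod L n) (\<Phi> U) a" by (simp add: completion_def)
    have "\<Phi> (cls A P (\<lambda>i. lact P a (rep U i))) = lact (Xmod L n) a (\<Phi> U)"
      using conv_lact[OF rU(2)[OF U]] a lact[OF rU(3)[OF U] a] by (intro \<Phi>I) (simp_all add: A_def)
    then show "\<Phi> (lact (completion A P) a U) = lact (Xmod L n) a (\<Phi> U)" by (simp add: completion_def)
  qed
  moreover have "\<Phi> (cls A P (\<lambda>i. x)) = T x" if "x \<in> elts P" for x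
    using that conv_const[OF T[OF that]] by (rule \<Phi>I)
  moreover have "cls A P (\<lambda>i. x) \<in> elts (completion A P)" if "x \<in> elts P" for x
    using C[THEN iffD2, of "\<lambda>i. x"] that conv_const[OF T[OF that]] by (auto simp: completion_def C_def)
  ultimately show ?thesis by (rule that)
qed

end

section \<open>The isomorphism from the tensor product\<close>

lemma foldr_add_C0: "foldr (add (C0 T)) fs (zer (C0 T)) = (\<lambda>x. \<Sum>a\<leftarrow>fs. a x)"
  by (induction fs) simp_all

lemma sum_list_concat_map: "(\<Sum>a\<leftarrow>concat (map h us). k a) = (\<Sum>u\<leftarrow>us. \<Sum>a\<leftarrow>h u. k a)"
  by (induction us) simp_all

context fa_kgraph
begin

lemma Xmod_sum_list:
  "(\<And>u. u \<in> set us \<Longrightarrow> F u \<in> elts (Xmod L n)) \<Longrightarrow> (\<lambda>x. \<Sum>u\<leftarrow>us. F u x) \<in> elts (Xmod L n)"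
  by (induction us) (simp_all add: Cc_ge_Xmod[OF Cc_ge_zero_fun] Xmod_add)

lemma inner_sum_list_right:
  assumes f: "f \<in> elts (Xmod L n)"
  shows "(\<And>u. u \<in> set us \<Longrightarrow> F u \<in> elts (Xmod L n)) \<Longrightarrow>
    ainner (Xmod L n) f (\<lambda>x. \<Sum>u\<leftarrow>us. F u x) x = (\<Sum>u\<leftarrow>us. ainner (Xmod L n) f (F u) x)"
proof (induction us)
  case (Cons u us)
  have u: "F u \<in> elts (Xmod L n)" and us: "(\<lambda>x. \<Sum>u\<leftarrow>us. F u x) \<in> elts (Xmod L n)"
    using Cons.prems Xmod_sum_list[of us F n] by simp_all
  have "ainner (Xmod L n) f (\<lambda>x. \<Sum>u\<leftarrow>u # us. F u x) x
      = (\<Sum>\<^sub>\<infinity>y\<in>fibre L n x. cnj (f y) * F u y + cnj (f y) * (\<Sum>u\<leftarrow>us. F u y))"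
    by (simp add: distrib_left)
  also have "\<dots> = (\<Sum>\<^sub>\<infinity>y\<in>fibre L n x. cnj (f y) * F u y) + (\<Sum>\<^sub>\<infinity>y\<in>fibre L n x. cnj (f y) * (\<Sum>u\<leftarrow>us. F u y))"
    by (rule infsum_add[OF Xmod_summable'[OF f u] Xmod_summable'[OF f us]])
  also have "\<dots> = ainner (Xmod L n) f (F u) x + ainner (Xmod L n) f (\<lambda>x. \<Sum>u\<leftarrow>us. F u x) x" by simp
  also have "ainner (Xmod L n) f (\<lambda>x. \<Sum>u\<leftarrow>us. F u x) x = (\<Sum>u\<leftarrow>us. ainner (Xmod L n) f (F u) x)"
    using Cons.prems by (intro Cons.IH) simp
  finally show ?case by (simp only: list.map sum_list.Cons)
qed simp

lemma inner_cnj: "ainner (Xmod L n) f g x = cnj (ainner (Xmod L n) g f x)"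
  unfolding Xmod_simps infsum_cnj[symmetric] by (simp add: mult.commute)

lemma inner_sum_list_left:
  assumes f: "f \<in> elts (Xmod L n)" and F: "\<And>u. u \<in> set us \<Longrightarrow> F u \<in> elts (Xmod L n)"
  shows "ainner (Xmod L n) (\<lambda>x. \<Sum>u\<leftarrow>us. F u x) f x = (\<Sum>u\<leftarrow>us. ainner (Xmod L n) (F u) f x)"
proof -
  have cnj_sum: "cnj (\<Sum>u\<leftarrow>us. k u) = (\<Sum>u\<leftarrow>us. cnj (k u))" for k :: "'a \<Rightarrow> complex"
    by (induction us) simp_all
  have "ainner (Xmod L n) (\<lambda>x. \<Sum>u\<leftarrow>us. F u x) f x = cnj (ainner (Xmod L n) f (\<lambda>x. \<Sum>u\<leftarrow>us. F u x) x)"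
    by (rule inner_cnj)
  also have "ainner (Xmod L n) f (\<lambda>x. \<Sum>u\<leftarrow>us. F u x) x = (\<Sum>u\<leftarrow>us. ainner (Xmod L n) f (F u) x)"
    by (rule inner_sum_list_right[OF f F])
  also have "cnj \<dots> = (\<Sum>u\<leftarrow>us. ainner (Xmod L n) (F u) f x)"
    unfolding cnj_sum inner_cnj[of n f _ x] complex_cnj_cnj by (rule refl)
  finally show ?thesis .
qed

lemma tensor_iso:
  obtains \<Phi> where
    "hb_iso (C0 (bpath_topology L)) (tensor (C0 (bpath_topology L)) (Xmod L m) (Xmod L n)) (Xmod L (m + n)) \<Phi>"
    "\<And>f g. f \<in> elts (Xmod L m) \<Longrightarrow> g \<in> elts (Xmod L n)
      \<Longrightarrow> \<Phi> (elem_tensor (C0 (bpath_topology L)) (Xmod L m) (Xmod L n) f g) = tmul m f g"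
    "\<And>f g. f \<in> elts (Xmod L m) \<Longrightarrow> g \<in> elts (Xmod L n)
      \<Longrightarrow> elem_tensor (C0 (bpath_topology L)) (Xmod L m) (Xmod L n) f g
        \<in> elts (tensor (C0 (bpath_topology L)) (Xmod L m) (Xmod L n))"
proof -
  let ?A = "C0 (bpath_topology L)"
  let ?P = "formal_tensors ?A (Xmod L m) (Xmod L n)"
  \<comment> \<open>The multiplication map on formal sums. Preservation of the inner product forces
    lists at distance zero to have the same image, so relations such as balancing over A come with
    it.\<close>
  define T where "T us = (\<lambda>x. \<Sum>u\<leftarrow>us. tmul m (fst u) (snd u) x)"
    for us :: "((('m, 'k) path \<Rightarrow> complex) \<times> (('m, 'k) path \<Rightarrow> complex)) list"
  have el: "us \<in> elts ?P \<longleftrightarrow> (\<forall>u\<in>set us. fst u \<in> elts (Xmod L m) \<and> snd u \<in> elts (Xmod L n))" for us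
    by (force simp: formal_tensors_def in_lists_conv_set)
  have tX: "tmul m (fst u) (snd u) \<in> elts (Xmod L (m + n))" if "us \<in> elts ?P" "u \<in> set us" for u us
    using that el by (blast intro: tmul_Xmod)
  have T: "T us \<in> elts (Xmod L (m + n))" if "us \<in> elts ?P" for us
    unfolding T_def using tX[OF that] by (rule Xmod_sum_list)
  have "\<exists>\<Phi>. hb_iso ?A (completion ?A ?P) (Xmod L (m + n)) \<Phi> \<and> (\<forall>us. us \<in> elts ?P \<longrightarrow> \<Phi> (cls ?A ?P (\<lambda>i. us)) = T us
      \<and> cls ?A ?P (\<lambda>i. us) \<in> elts (completion ?A ?P))"
  proof (rule completion_iso[of ?P T "m + n"])
    show "T us \<in> elts (Xmod L (m + n))" if "us \<in> elts ?P" for us by (rule T[OF that])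
    show "add ?P us vs \<in> elts ?P \<and> T (add ?P us vs) = (\<lambda>z. T us z + T vs z)"
      if "us \<in> elts ?P" "vs \<in> elts ?P" for us vs
    proof -
      have "add ?P us vs = us @ vs" by (simp add: formal_tensors_def)
      then show ?thesis using that unfolding el by (auto simp: T_def)
    qed
    show "scl ?P c us \<in> elts ?P \<and> T (scl ?P c us) = (\<lambda>z. c * T us z)" if "us \<in> elts ?P" for c us
    proof -
      have s: "scl ?P c us = map (\<lambda>(x, y). ((\<lambda>z. c * x z), y)) us" by (simp add: formal_tensors_def)
      have "T (map (\<lambda>(x, y). ((\<lambda>z. c * x z), y)) us) = (\<lambda>z. c * T us z)"
        unfolding T_def by (induction us) (auto simp: tmul_def distrib_left mult.assoc fun_eq_iff)
      moreover have "map (\<lambda>(x, y). ((\<lambda>z. c * x z), y)) us \<in> elts ?P"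
        using that Xmod_scale unfolding el by (force split: prod.splits)
      ultimately show ?thesis unfolding s by simp
    qed
    show "ract ?P us a \<in> elts ?P \<and> T (ract ?P us a) = ract (Xmod L (m + n)) (T us) a"
      if us: "us \<in> elts ?P" and a: "a \<in> elts ?A" for us a
    proof -
      have s: "ract ?P us a = map (\<lambda>(x, y). (x, (\<lambda>z. y z * a (shift n z)))) us" by (simp add: formal_tensors_def)
      have "(\<forall>u\<in>set us. snd u \<in> elts (Xmod L n)) \<Longrightarrow> (\<forall>u\<in>set us. fst u \<in> elts (Xmod L m)) \<Longrightarrow>
        T (map (\<lambda>(x, y). (x, (\<lambda>z. y z * a (shift n z)))) us) = (\<lambda>z. T us z * a (shift (m + n) z))"
      proof (induction us)
        case (Cons u us)
        \<comment> \<open>The composition law of shifts is available on the domain of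
          \<open>shift (m + n)\<close>; at any other point one of the two factors is zero and both
          sides vanish.\<close>
        have eq: "tmul m (fst u) (\<lambda>z. snd u z * a (shift n z)) z = tmul m (fst u) (snd u) z * a (shift (m + n) z)" for z
          using Xmod_zero[of "fst u" L m z] Xmod_zero[of "snd u" L n "shift m z"] Cons.prems
            bpaths_ge_add[of z m n] shift_shift[of z m n] by (auto simp: tmul_def)
        show ?case
        proof
          fix z
          have "T (map (\<lambda>(x, y). (x, (\<lambda>z. y z * a (shift n z)))) us) = (\<lambda>z. T us z * a (shift (m + n) z))"
            using Cons.prems by (intro Cons.IH) auto
          from fun_cong[OF this, of z] show "T (map (\<lambda>(x, y). (x, (\<lambda>z. y z * a (shift n z)))) (u # us)) z
              = T (u # us) z * a (shift (m + n) z)"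
            using eq[of z] by (simp add: T_def split_beta distrib_right o_def)
        qed
      qed (simp add: T_def)
      moreover have "map (\<lambda>(x, y). (x, (\<lambda>z. y z * a (shift n z)))) us \<in> elts ?P"
        using us Xmod_ract[OF a] unfolding el by (force split: prod.splits)
      ultimately show ?thesis unfolding s using us el by simp
    qed
    show "lact ?P a us \<in> elts ?P \<and> T (lact ?P a us) = lact (Xmod L (m + n)) a (T us)"
      if us: "us \<in> elts ?P" and a: "a \<in> elts ?A" for us a
    proof -
      have s: "lact ?P a us = map (\<lambda>(x, y). ((\<lambda>z. a z * x z), y)) us" by (simp add: formal_tensors_def)
      have "T (map (\<lambda>(x, y). ((\<lambda>z. a z * x z), y)) us) = (\<lambda>z. a z * T us z)"
        unfolding T_def by (induction us) (auto simp: tmul_def distrib_left mult.assoc fun_eq_iff)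
      moreover have "map (\<lambda>(x, y). ((\<lambda>z. a z * x z), y)) us \<in> elts ?P"
        using us Xmod_lact[OF a] unfolding el by (force split: prod.splits)
      ultimately show ?thesis unfolding s by simp
    qed
    show "ainner ?P us vs = ainner (Xmod L (m + n)) (T us) (T vs)" if us: "us \<in> elts ?P" and vs: "vs \<in> elts ?P" for us vs
    proof
      fix x
      let ?I = "ainner (Xmod L (m + n))"
      let ?t = "\<lambda>u. tmul m (fst u) (snd u)"
      have "ainner ?P us vs x = (\<Sum>u\<leftarrow>us. \<Sum>v\<leftarrow>vs.
          ainner (Xmod L n) (snd u) (lact (Xmod L n) (ainner (Xmod L m) (fst u) (fst v)) (snd v)) x)"
        unfolding formal_tensors_def hbimod.simps foldr_add_C0 sum_list_concat_map
        by (simp add: split_beta o_def del: Xmod_simps)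
      also have "\<dots> = (\<Sum>u\<leftarrow>us. \<Sum>v\<leftarrow>vs. ?I (?t u) (?t v) x)"
        using us vs el inner_tmul
        by (intro arg_cong[of _ _ sum_list] map_cong refl) (simp del: Xmod_simps)
      also have "\<dots> = (\<Sum>u\<leftarrow>us. ?I (?t u) (T vs) x)"
        unfolding T_def using tX[OF us] tX[OF vs]
        by (intro arg_cong[of _ _ sum_list] map_cong refl inner_sum_list_right[symmetric])
      also have "\<dots> = ?I (T us) (T vs) x"
        unfolding T_def[of us] using tX[OF us] by (intro inner_sum_list_left[symmetric] T[OF vs])
      finally show "ainner ?P us vs x = ?I (T us) (T vs) x" .
    qed
    show "\<exists>us\<in>elts ?P. norm_le L (m + n) (\<lambda>y. T us y - f y) \<epsilon>"
      if f: "f \<in> elts (Xmod L (m + n))" and e: "0 < \<epsilon>" for f \<epsilon>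
    proof -
      obtain h where h: "h \<in> Cc_ge L (m + n)" "norm_le L (m + n) (\<lambda>y. f y - h y) \<epsilon>"
        using Xmod_approx[OF f e] by blast
      obtain us where us: "set us \<subseteq> Cc_ge L m \<times> Cc_ge L n" "h = (\<lambda>x. \<Sum>(f, g)\<leftarrow>us. tmul m f g x)"
        using Cc_ge_sum_tmul[OF h(1)] .
      have "h = T us" unfolding us(2) T_def by (simp only: case_prod_unfold)
      moreover have "us \<in> elts ?P" unfolding el using us(1) Cc_ge_Xmod by force
      ultimately show ?thesis using norm_le_minus_commute[THEN iffD1, OF h(2)] by blast
    qed
  qed blast
  then obtain \<Phi> where \<Phi>: "hb_iso ?A (completion ?A ?P) (Xmod L (m + n)) \<Phi>"
    "\<And>us. us \<in> elts ?P \<Longrightarrow> \<Phi> (cls ?A ?P (\<lambda>i. us)) = T us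
      \<and> cls ?A ?P (\<lambda>i. us) \<in> elts (completion ?A ?P)" by blast
  show ?thesis
  proof (rule that[of \<Phi>])
    show "hb_iso ?A (tensor ?A (Xmod L m) (Xmod L n)) (Xmod L (m + n)) \<Phi>"
      unfolding tensor_def by (rule \<Phi>(1))
    fix f g assume "f \<in> elts (Xmod L m)" "g \<in> elts (Xmod L n)"
    then have "[(f, g)] \<in> elts ?P" unfolding el by simp
    from \<Phi>(2)[OF this] show "\<Phi> (elem_tensor ?A (Xmod L m) (Xmod L n) f g) = tmul m f g"
      "elem_tensor ?A (Xmod L m) (Xmod L n) f g \<in> elts (tensor ?A (Xmod L m) (Xmod L n))"
      unfolding elem_tensor_def tensor_def by (simp_all add: T_def)
  qed
qed

text \<open>Lowering the modulus of f by \<epsilon>, and cutting off at 0, moves f by at most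
  \<epsilon> and leaves a function supported in the compact set where the modulus was at least
  \<epsilon>. The denominator \<open>max (cmod z) \<epsilon>\<close> stays positive, which keeps
  \<open>h\<close> continuous at 0. As fibres of \<open>shift 0\<close> have at most one point, the
  uniform estimate is the one required.\<close>

lemma C0_Xmod_0:
  assumes f: "f \<in> elts (C0 (bpath_topology L))"
  shows "f \<in> elts (Xmod L 0)"
proof (rule XmodI)
  show "f x = 0" if "x \<notin> bpaths_ge L 0" for x using C0_zero[OF f, of x] that by simp
  fix \<epsilon> :: real assume e: "0 < \<epsilon>"
  define h where "h z = z * complex_of_real (max 0 (cmod z - \<epsilon>) / max (cmod z) \<epsilon>)" for z
    \<comment> \<open>truncation of \<open>z\<close> at level \<open>\<epsilon>\<close>\<close>
  have "continuous_on UNIV h"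
    unfolding h_def[abs_def] using e by (intro continuous_intros) (auto simp: max_def)
  with C0_continuous[OF f] have c: "continuous_map (bpath_topology L) euclidean (\<lambda>x. h (f x))"
    by (rule continuous_map_compose1)
  have "h (f x) = 0" if "x \<notin> {x \<in> topspace (bpath_topology L). \<epsilon> \<le> cmod (f x)}" for x
    using that C0_zero[OF f, of x] by (cases "x \<in> bpaths L") (simp_all add: h_def)
  then have g: "(\<lambda>x. h (f x)) \<in> Cc_ge L 0"
    unfolding Cc_ge_iff using c C0_compactin[OF f e]
    by (intro conjI exI[of _ "{x \<in> topspace (bpath_topology L). \<epsilon> \<le> cmod (f x)}"]) auto
  have h: "cmod (z - h z) \<le> \<epsilon>" for z
  proof (cases "cmod z \<le> \<epsilon>")
    case False
    then have "z - h z = z * complex_of_real (1 - (cmod z - \<epsilon>) / cmod z)"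
      by (simp add: h_def right_diff_distrib)
    also have "1 - (cmod z - \<epsilon>) / cmod z = \<epsilon> / cmod z" using False e by (cases "z = 0") (simp_all add: diff_divide_distrib)
    finally have "cmod (z - h z) = cmod z * (\<epsilon> / cmod z)" using e by (simp add: norm_mult norm_divide)
    then show ?thesis using False e by simp
  qed (simp add: h_def)
  have "norm_le L 0 (\<lambda>y. f y - h (f y)) \<epsilon>"
    unfolding norm_le_def
  proof (intro allI impI)
    fix x S assume S: "finite S" "S \<subseteq> fibre L 0 x"
    have "fibre L 0 x \<subseteq> {x}" using shift_0 by (auto simp: fibre_def)
    then have "(\<Sum>y\<in>S. (cmod (f y - h (f y)))\<^sup>2) \<le> (\<Sum>y\<in>{x}. (cmod (f y - h (f y)))\<^sup>2)"
      using S by (intro sum_mono2) auto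
    also have "\<dots> \<le> \<epsilon>\<^sup>2" using h[of "f x"] by (simp add: power_mono)
    finally show "(\<Sum>y\<in>S. (cmod (f y - h (f y)))\<^sup>2) \<le> \<epsilon>\<^sup>2" .
  qed
  then show "\<exists>g\<in>Cc_ge L 0. norm_le L 0 (\<lambda>y. f y - g y) \<epsilon>"
    using g by (intro bexI[of _ "\<lambda>x. h (f x)"])
qed

text \<open>The choice \<open>Xpi\<close> is prescribed on compactly supported pairs only. Both it
  and the constructed isomorphism preserve inner products and they agree on those pairs, so the two
  candidate values have equal inner products with all products of compactly supported functions;
  \<open>Xmod_eq_zeroI\<close> then makes their difference zero.\<close>

lemma Xpi_elem_tensor:
  assumes f: "f \<in> elts (Xmod L m)" and g: "g \<in> elts (Xmod L n)"
  shows "Xpi L m n (elem_tensor (C0 (bpath_topology L)) (Xmod L m) (Xmod L n) f g) = tmul m f g"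
    and "hb_iso (C0 (bpath_topology L)) (tensor (C0 (bpath_topology L)) (Xmod L m) (Xmod L n)) (Xmod L (m + n)) (Xpi L m n)"
proof -
  let ?A = "C0 (bpath_topology L)"
  let ?T = "tensor ?A (Xmod L m) (Xmod L n)"
  let ?e = "elem_tensor ?A (Xmod L m) (Xmod L n)"
  let ?I = "ainner (Xmod L (m + n))"
  obtain \<Phi> where \<Phi>: "hb_iso ?A ?T (Xmod L (m + n)) \<Phi>"
    "\<And>f g. f \<in> elts (Xmod L m) \<Longrightarrow> g \<in> elts (Xmod L n) \<Longrightarrow> \<Phi> (?e f g) = tmul m f g"
    "\<And>f g. f \<in> elts (Xmod L m) \<Longrightarrow> g \<in> elts (Xmod L n) \<Longrightarrow> ?e f g \<in> elts ?T"
    using tensor_iso[of m n] by blast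
  let ?Q = "\<lambda>\<Psi>. hb_iso ?A ?T (Xmod L (m + n)) \<Psi>
       \<and> (\<forall>f\<in>Cc_ge L m. \<forall>g\<in>Cc_ge L n. \<Psi> (?e f g) = (\<lambda>x. f x * g (shift m x)))"
  have "?Q \<Phi>" using \<Phi> Cc_ge_Xmod by (auto simp: tmul_def)
  then have X: "?Q (Xpi L m n)" unfolding Xpi_def Let_def by (rule someI[where P = ?Q])
  then show iso: "hb_iso ?A ?T (Xmod L (m + n)) (Xpi L m n)" by blast
  have Xe: "Xpi L m n (?e f' g') = tmul m f' g'" if "f' \<in> Cc_ge L m" "g' \<in> Cc_ge L n" for f' g'
    using X that by (simp add: tmul_def[abs_def])
  let ?k = "Xpi L m n (?e f g)"
  have e: "?e f g \<in> elts ?T" by (rule \<Phi>(3)[OF f g])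
  have k: "?k \<in> elts (Xmod L (m + n))" using iso e unfolding hb_iso_def bij_betw_def by blast
  note t = tmul_Xmod[OF f g]
  have "(\<lambda>x. ?k x - tmul m f g x) = (\<lambda>x. 0)"
  proof (rule Xmod_eq_zeroI)
    show "(\<lambda>x. ?k x - tmul m f g x) \<in> elts (Xmod L (m + n))" using k t by (rule Xmod_diff)
    fix f' g' assume fg': "f' \<in> Cc_ge L m" "g' \<in> Cc_ge L n"
    note X' = Cc_ge_Xmod[OF fg'(1)] Cc_ge_Xmod[OF fg'(2)]
    note t' = tmul_Xmod[OF X']
    have e': "?e f' g' \<in> elts ?T" by (rule \<Phi>(3)[OF X'])
    \<comment> \<open>The inner product is carried back to the tensor product by \<open>Xpi\<close>
      and out again by \<Phi>, whose values on all elementary tensors are known.\<close>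
    have "?I (Xpi L m n (?e f' g')) ?k = ainner ?T (?e f' g') (?e f g)"
      using iso e e' unfolding hb_iso_def by blast
    also have "\<dots> = ?I (\<Phi> (?e f' g')) (\<Phi> (?e f g))"
      using \<Phi>(1) e e' unfolding hb_iso_def by metis
    finally have eq: "?I (tmul m f' g') ?k = ?I (tmul m f' g') (tmul m f g)"
      by (simp only: Xe[OF fg'] \<Phi>(2)[OF X'] \<Phi>(2)[OF f g])
    interpret hilbert_bimodule ?A "Xmod L (m + n)" by (rule Xmod_hilbert_bimodule)
    have "?I (tmul m f' g') (dif (Xmod L (m + n)) ?k (tmul m f g))
      = dif ?A (?I (tmul m f' g') ?k) (?I (tmul m f' g') (tmul m f g))"
      unfolding dif_def inner_scl[OF t' t, symmetric] 
      using Xmod_scale[OF t, of "- 1"] by (intro inner_add t' k) simp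
    also have "\<dots> = (\<lambda>x. 0)" unfolding eq C0_dif by simp
    finally show "?I (tmul m f' g') (\<lambda>x. ?k x - tmul m f g x) = (\<lambda>x. 0)" unfolding Xmod_dif .
  qed
  then show "?k = tmul m f g" by (simp add: fun_eq_iff)
qed

end

theorem proposition3p7:
  fixes L :: "('m, 'k::finite) kgraph_data"
  assumes "kgraph L"
    and "finitely_aligned L"
  shows "product_system (C0 (bpath_topology L)) (Xmod L) (Xmult L)"
proof -
  interpret fa_kgraph L using assms by (intro fa_kgraph.intro fa_kgraph_axioms.intro)
  let ?A = "C0 (bpath_topology L)"
  have mult: "Xmult L (m, f) (n, g) = (m + n, tmul m f g)"
    if "f \<in> elts (Xmod L m)" "g \<in> elts (Xmod L n)" for m n f g
    using Xpi_elem_tensor(1)[OF that] by (simp add: Xmult_def)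
  \<comment> \<open>Fibres of \<open>shift 0\<close> have at most one point, so
    \<open>norm_le L 0\<close> bounds the supremum norm, and the closure of the compactly supported
    functions in that norm is C0.\<close>
  have elts0: "elts (Xmod L 0) = elts ?A"
  proof
    show "elts (Xmod L 0) \<subseteq> elts ?A"
    proof
      fix f assume f: "f \<in> elts (Xmod L 0)"
      show "f \<in> elts ?A"
      proof (rule C0_uniform_limit)
        fix \<epsilon> :: real assume e: "0 < \<epsilon>"
        obtain g where g: "g \<in> Cc_ge L 0" "norm_le L 0 (\<lambda>y. f y - g y) \<epsilon>"
          using Xmod_approx[OF f e] by blast
        have "cmod (f x - g x) \<le> \<epsilon>" for x
          using norm_le_pointwise[OF g(2), of x] Xmod_zero[OF f, of x] Cc_ge_zero[OF g(1), of x] e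
          by (cases "x \<in> bpaths L") simp_all
        then show "\<exists>b\<in>elts ?A. \<forall>x. cmod (f x - b x) \<le> \<epsilon>" using Cc_ge_C0[OF g(1)] by blast
      qed
    qed
    show "elts ?A \<subseteq> elts (Xmod L 0)" using C0_Xmod_0 by blast
  qed
  \<comment> \<open>Off the path space the fibre is empty, and the sum 0 agrees with the zero values
    of functions there.\<close>
  have fib0: "fibre L 0 x = (if x \<in> bpaths L then {x} else {})" for x
    using shift_0 by (auto simp: fibre_def)
  show ?thesis
  proof (rule product_system.intro)
    show "hilbert_bimodule ?A (Xmod L n)" for n by (rule Xmod_hilbert_bimodule)
    show "hb_iso ?A (self_bimod ?A) (Xmod L 0) id"
    proof -
      have "(\<Sum>\<^sub>\<infinity>y\<in>fibre L 0 x. cnj (f y) * g y) = cnj (f x) * g x" if "f \<in> elts ?A" for f g x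
        using C0_zero[OF that, of x] by (simp add: fib0)
      moreover have "(\<lambda>x. f x * a (shift 0 x)) = (\<lambda>x. f x * a x)" if "f \<in> elts ?A" for f a
      proof
        fix x show "f x * a (shift 0 x) = f x * a x"
          using C0_zero[OF that, of x] shift_0[of x] by (cases "x \<in> bpaths L") simp_all
      qed
      ultimately show ?thesis by (simp add: hb_iso_def self_bimod_def elts0)
    qed
    show "Xmult L \<xi> \<eta> \<in> graded (Xmod L)" if "\<xi> \<in> graded (Xmod L)" "\<eta> \<in> graded (Xmod L)" for \<xi> \<eta>
      using that tmul_Xmod by (auto simp: graded_def mult)
    show "Xmult L (Xmult L \<xi> \<eta>) \<zeta> = Xmult L \<xi> (Xmult L \<eta> \<zeta>)"
      if gr: "\<xi> \<in> graded (Xmod L)" "\<eta> \<in> graded (Xmod L)" "\<zeta> \<in> graded (Xmod L)" for \<xi> \<eta> \<zeta>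
    proof -
      obtain m f n g p h where fgh: "\<xi> = (m, f)" "\<eta> = (n, g)" "\<zeta> = (p, h)"
        and f: "f \<in> elts (Xmod L m)" and g: "g \<in> elts (Xmod L n)" and h: "h \<in> elts (Xmod L p)"
        using gr unfolding graded_def by blast
      \<comment> \<open>On the domain of \<open>shift (m + n)\<close> the shifts compose; elsewhere
        \<open>f x\<close> or \<open>g (shift m x)\<close> is zero.\<close>
      have "tmul (m + n) (tmul m f g) h x = tmul m f (tmul n g h) x" for x
        using Xmod_zero[OF f, of x] Xmod_zero[OF g, of "shift m x"] bpaths_ge_add[of x m n] shift_shift[of x m n]
        by (auto simp: tmul_def)
      then have "tmul (m + n) (tmul m f g) h = tmul m f (tmul n g h)" by (rule ext)
      then show ?thesis
        unfolding fgh by (simp only: mult f g h tmul_Xmod add.assoc)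
    qed
    show "fst (Xmult L (m, x) (n, y)) = m + n" if "x \<in> elts (Xmod L m)" "y \<in> elts (Xmod L n)" for x y m n
      by (simp add: mult[OF that])
    show "\<exists>\<Phi>. hb_iso ?A (tensor ?A (Xmod L m) (Xmod L n)) (Xmod L (m + n)) \<Phi>
      \<and> (\<forall>x\<in>elts (Xmod L m). \<forall>y\<in>elts (Xmod L n).
            \<Phi> (elem_tensor ?A (Xmod L m) (Xmod L n) x y) = snd (Xmult L (m, x) (n, y)))" for m n
    proof -
      obtain \<Phi> where "hb_iso ?A (tensor ?A (Xmod L m) (Xmod L n)) (Xmod L (m + n)) \<Phi>"
        "\<And>f g. f \<in> elts (Xmod L m) \<Longrightarrow> g \<in> elts (Xmod L n)
          \<Longrightarrow> \<Phi> (elem_tensor ?A (Xmod L m) (Xmod L n) f g) = tmul m f g"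
        by (rule tensor_iso[of m n]) blast
      then show ?thesis by (intro exI[of _ \<Phi>]) (simp add: mult)
    qed
    show "Xmult L (0, a) (n, x) = (n, lact (Xmod L n) a x)" if "a \<in> elts ?A" "x \<in> elts (Xmod L n)" for a x n
    proof -
      have "tmul 0 a x = lact (Xmod L n) a x"
      proof
        fix z show "tmul 0 a x z = lact (Xmod L n) a x z"
          using C0_zero[OF that(1), of z] shift_0[of z] by (cases "z \<in> bpaths L") (simp_all add: tmul_def)
      qed
      then show ?thesis using mult[of a 0 x n] that elts0 by simp
    qed
    show "Xmult L (n, x) (0, a) = (n, ract (Xmod L n) x a)" if "x \<in> elts (Xmod L n)" "a \<in> elts ?A" for a x n
      using mult[of x n a 0] that elts0 by (simp add: tmul_def[abs_def])
  qed
qed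

end
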